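(* Let $\mathbb{F}$ be a field, let $M\in \mathbb{F}^{n\times n}$ be a totally regular matrix, and let $\mathbf{x}=(x_1,\dots,x_n)^T$ and $\mathbf{y}=(y_1,\dots,y_n)^T$ be vectors of distinct variables. Then every read-once planar arithmetic circuit over $\mathbb{F}$ computing the bilinear form $\mathbf{y}^T M\mathbf{x}$ has size $\Omega(n^2)$.
   Context: An arithmetic circuit over $\mathbb{F}$ is a directed acyclic graph whose in-degree-0 vertices (input gates) are labelled by variables or field constants and whose other vertices are labelled $+$ or $\times$; wires may be labelled by field elements, which scale the polynomial carried along them. Each gate computes a polynomial in the natural way; size is the number of gates. A circuit is planar if its underlying undirected graph is planar. A planar circuit is read-once if each variable labels at most one input gate. A matrix is totally regular if every square submatrix of it is non-singular. *)

theory Defs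
  imports
    "HOL-Analysis.Analysis"
    "HOL-Algebra.Indexed_Polynomials"
    "Graph_Theory.Digraph"
begin

section \<open>Multivariate polynomials over a ring\<close>

text \<open>
  \<^theory>\<open>HOL-Algebra.Indexed_Polynomials\<close> represents a polynomial by the function that maps a
  monomial (a multiset of variables) to its coefficient, and provides the set of all polynomials,
  constants, variables and addition. What is missing there is the product of two polynomials, which
  is convolution: the ways to write a monomial m as a product correspond to the sub-multisets of m.
\<close>

definition (in ring) indexed_times ::
    "('x multiset \<Rightarrow> 'a) \<Rightarrow> ('x multiset \<Rightarrow> 'a) \<Rightarrow> ('x multiset \<Rightarrow> 'a)"
  where "indexed_times P Q = (\<lambda>m. \<Oplus>k\<in>{k. k \<subseteq># m}. P k \<otimes> Q (m - k))"

definition (in ring) mpoly_ring :: "('x multiset \<Rightarrow> 'a) ring"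
  where "mpoly_ring =
    \<lparr> carrier = indexed_pset UNIV (carrier R),
      mult = indexed_times,
      one = indexed_const \<one>,
      zero = indexed_const \<zero>,
      add = indexed_padd \<rparr>"

text \<open>The polynomial \<open>y\<^sup>T M x = \<Sum>i j. y\<^sub>i M\<^sub>i\<^sub>j x\<^sub>j\<close>, with indices running from 0 to n - 1.\<close>

definition (in ring) bilinear_form ::
    "nat \<Rightarrow> (nat \<Rightarrow> 'x) \<Rightarrow> (nat \<Rightarrow> nat \<Rightarrow> 'a) \<Rightarrow> (nat \<Rightarrow> 'x) \<Rightarrow> ('x multiset \<Rightarrow> 'a)"
  where "bilinear_form n y M x =
    (\<Oplus>\<^bsub>mpoly_ring\<^esub>i\<in>{..<n}. \<Oplus>\<^bsub>mpoly_ring\<^esub>j\<in>{..<n}.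
       indexed_var (y i) \<otimes>\<^bsub>mpoly_ring\<^esub> indexed_const (M i j) \<otimes>\<^bsub>mpoly_ring\<^esub> indexed_var (x j))"


section \<open>Totally regular matrices\<close>

text \<open>
  The submatrix of M with row set I and column set J, where I and J have the same size, is
  non-singular if it has a two-sided inverse; the rows of the inverse are indexed by J and its
  columns by I.
\<close>

definition (in ring) nonsingular_submatrix ::
    "(nat \<Rightarrow> nat \<Rightarrow> 'a) \<Rightarrow> nat set \<Rightarrow> nat set \<Rightarrow> bool"
  where "nonsingular_submatrix M I J \<longleftrightarrow>
    (\<exists>B \<in> J \<rightarrow> I \<rightarrow> carrier R.
       (\<forall>i\<in>I. \<forall>i'\<in>I. (\<Oplus>j\<in>J. M i j \<otimes> B j i') = (if i = i' then \<one> else \<zero>)) \<and>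
       (\<forall>j\<in>J. \<forall>j'\<in>J. (\<Oplus>i\<in>I. B j i \<otimes> M i j') = (if j = j' then \<one> else \<zero>)))"

definition (in ring) totally_regular :: "nat \<Rightarrow> (nat \<Rightarrow> nat \<Rightarrow> 'a) \<Rightarrow> bool"
  where "totally_regular n M \<longleftrightarrow>
    (\<forall>I J. I \<subseteq> {..<n} \<longrightarrow> J \<subseteq> {..<n} \<longrightarrow> card I = card J \<longrightarrow> nonsingular_submatrix M I J)"


section \<open>Planarity\<close>

text \<open>
  A multigraph is planar if it can be drawn in the plane: vertices are distinct points, edges are
  simple curves joining their endpoints (closed curves in the case of loops), and distinct edges
  meet only in common endpoints and contain no other vertices. The direction in which the curve of
  an arc is traversed is immaterial, so this is planarity of the underlying undirected graph.
\<close>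

definition planar_drawing ::
    "('g, 'w) pre_digraph \<Rightarrow> ('g \<Rightarrow> complex) \<Rightarrow> ('w \<Rightarrow> real \<Rightarrow> complex) \<Rightarrow> bool"
  where "planar_drawing G pos crv \<longleftrightarrow>
    inj_on pos (verts G) \<and>
    (\<forall>e\<in>arcs G. simple_path (crv e) \<and>
        pathstart (crv e) = pos (tail G e) \<and> pathfinish (crv e) = pos (head G e)) \<and>
    (\<forall>e\<in>arcs G. \<forall>v\<in>verts G. pos v \<in> path_image (crv e) \<longrightarrow> v \<in> {tail G e, head G e}) \<and>
    (\<forall>e\<in>arcs G. \<forall>f\<in>arcs G. e \<noteq> f \<longrightarrow>
        path_image (crv e) \<inter> path_image (crv f)
          \<subseteq> pos ` ({tail G e, head G e} \<inter> {tail G f, head G f}))"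

definition planar :: "('g, 'w) pre_digraph \<Rightarrow> bool"
  where "planar G \<longleftrightarrow> (\<exists>pos crv. planar_drawing G pos crv)"


section \<open>Arithmetic circuits\<close>

datatype ('x, 'a) gate_label = Var 'x | Const 'a | Plus | Times

text \<open>
  The wires are the arcs of a multigraph, so that two wires may join the same two gates (as in
  squaring). There is no bound on the number of wires entering or leaving a gate. An unlabelled wire
  has weight 1.
\<close>

record ('g, 'w, 'x, 'a) circuit =
  graph :: "('g, 'w) pre_digraph"
  label :: "'g \<Rightarrow> ('x, 'a) gate_label"
  weight :: "'w \<Rightarrow> 'a"

locale arithmetic_circuit = field R for R (structure) +
  fixes C :: "('g, 'w, 'x, 'a) circuit"
  assumes fin_digraph: "fin_digraph (graph C)"
    and acyclic: "acyclic (arcs_ends (graph C))"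
    and input_label: "\<And>v. \<lbrakk>v \<in> verts (graph C); in_arcs (graph C) v = {}\<rbrakk>
          \<Longrightarrow> label C v \<in> range Var \<union> Const ` carrier R"
    and operation_label: "\<And>v. \<lbrakk>v \<in> verts (graph C); in_arcs (graph C) v \<noteq> {}\<rbrakk>
          \<Longrightarrow> label C v \<in> {Plus, Times}"
    and weight: "\<And>e. e \<in> arcs (graph C) \<Longrightarrow> weight C e \<in> carrier R"

inductive (in ring) gate_computes ::
    "('g, 'w, 'x, 'a) circuit \<Rightarrow> 'g \<Rightarrow> ('x multiset \<Rightarrow> 'a) \<Rightarrow> bool"
  for C where
  var: "\<lbrakk>v \<in> verts (graph C); label C v = Var z\<rbrakk> \<Longrightarrow> gate_computes C v (indexed_var z)"
| const: "\<lbrakk>v \<in> verts (graph C); label C v = Const a\<rbrakk> \<Longrightarrow> gate_computes C v (indexed_const a)"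
| plus: "\<lbrakk>v \<in> verts (graph C); label C v = Plus;
      \<And>e. e \<in> in_arcs (graph C) v \<Longrightarrow> gate_computes C (tail (graph C) e) (p e)\<rbrakk>
    \<Longrightarrow> gate_computes C v
          (\<Oplus>\<^bsub>mpoly_ring\<^esub>e\<in>in_arcs (graph C) v. indexed_const (weight C e) \<otimes>\<^bsub>mpoly_ring\<^esub> p e)"
| times: "\<lbrakk>v \<in> verts (graph C); label C v = Times;
      \<And>e. e \<in> in_arcs (graph C) v \<Longrightarrow> gate_computes C (tail (graph C) e) (p e)\<rbrakk>
    \<Longrightarrow> gate_computes C v
          (\<Otimes>\<^bsub>mpoly_ring\<^esub>e\<in>in_arcs (graph C) v. indexed_const (weight C e) \<otimes>\<^bsub>mpoly_ring\<^esub> p e)"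

text \<open>No output gate is singled out: a circuit computes the polynomials computed by its gates.\<close>

definition (in ring) circuit_computes ::
    "('g, 'w, 'x, 'a) circuit \<Rightarrow> ('x multiset \<Rightarrow> 'a) \<Rightarrow> bool"
  where "circuit_computes C p \<longleftrightarrow> (\<exists>v \<in> verts (graph C). gate_computes C v p)"

definition circuit_size :: "('g, 'w, 'x, 'a) circuit \<Rightarrow> nat"
  where "circuit_size C = card (verts (graph C))"

definition read_once :: "('g, 'w, 'x, 'a) circuit \<Rightarrow> bool"
  where "read_once C \<longleftrightarrow>
    (\<forall>u\<in>verts (graph C). \<forall>v\<in>verts (graph C). \<forall>z. label C u = Var z \<and> label C v = Var z \<longrightarrow> u = v)"

end

theory Submission
  imports Defs
begin

text \<open>
  If a set \<open>S\<close> of gates separates the inputs \<open>x j\<close>, \<open>j \<in> J\<close>, from the inputs \<open>y i\<close>,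
  \<open>i \<in> I\<close>, in the undirected graph of the circuit, then the submatrix of \<open>M\<close> with rows \<open>I\<close> and
  columns \<open>J\<close> has rank at most \<open>3 |S|\<close>. As \<open>M\<close> is totally regular, a set \<open>U\<close> of fewer than
  \<open>n / 16\<close> gates therefore leaves a component with more than half of the \<open>x\<close>-inputs. These big
  components form a haven, and if the number of gates were less than a small multiple of \<open>n\<^sup>2\<close>,
  the argument of Alon, Seymour and Thomas would turn it into a \<open>K\<^sub>6\<close>-minor. In the plane this is
  impossible: the minor contains a closed curve with two crossing chords on the same side, contrary
  to the Jordan curve theorem and Janiszewski's theorem. Using minors makes a triangulation or
  combinatorial embedding of the circuit unnecessary.
\<close>

section \<open>Clique minors from havens\<close>

text \<open>The square arises from two scales: separators below a fixed fraction of \<open>n\<close>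
  never break the circuit up, whereas a graph without a \<open>K\<^sub>6\<close>-minor has a
  balanced separator of the order of the square root of its number of vertices. Separators consist
  of gates rather than wires because fan-in and fan-out are unbounded. The difficulty this brings is
  a product gate in the separator that multiplies polynomials from both sides; one extra linear form
  per such gate repairs the rank bound, whence the factor 3 instead of 2. Read-once makes every
  input a single gate, so that the sides of a separator can be weighed by the inputs they contain.
  Six branch sets are asked for because the topological contradiction takes place in a
  \<open>K\<^sub>3\<^sub>,\<^sub>3\<close> inside the clique: four sets give the curve and one each
  gives a chord.\<close>

definition rel_connected :: "('v \<times> 'v) set \<Rightarrow> 'v set \<Rightarrow> bool" where
  "rel_connected E W \<longleftrightarrow> (\<forall>u\<in>W. \<forall>v\<in>W. (u, v) \<in> (E \<inter> W \<times> W)\<^sup>*)"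

text \<open>Maximality is expressed as closure under the edges of \<open>U\<close>, which turns
  unions of components and the passage to other vertex sets into plain set arguments.\<close>

definition rel_component :: "('v \<times> 'v) set \<Rightarrow> 'v set \<Rightarrow> 'v set \<Rightarrow> bool" where
  "rel_component E U K \<longleftrightarrow>
    K \<subseteq> U \<and> K \<noteq> {} \<and> rel_connected E K \<and> (\<forall>u\<in>K. \<forall>v\<in>U. (u, v) \<in> E \<longrightarrow> v \<in> K)"

text \<open>The form in which connectedness is mostly used: a property inherited along edges inside
  \<open>W\<close> spreads from one vertex to all, without explicit paths.\<close>

lemma rel_connected_induct:
  assumes "rel_connected E W" "a \<in> W" "b \<in> W" "P a"
    and step: "\<And>u v. u \<in> W \<Longrightarrow> v \<in> W \<Longrightarrow> (u, v) \<in> E \<Longrightarrow> P u \<Longrightarrow> P v"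
  shows "P b"
proof -
  have "(a, b) \<in> (E \<inter> W \<times> W)\<^sup>*"
    using assms by (auto simp: rel_connected_def)
  then show ?thesis
    by (induction rule: rtrancl_induct) (use \<open>P a\<close> step in auto)
qed

lemma rel_connected_subset:
  assumes "rel_connected E W" "W \<subseteq> U" "\<And>u v. u \<in> K \<Longrightarrow> v \<in> U \<Longrightarrow> (u, v) \<in> E \<Longrightarrow> v \<in> K"
    and "W \<inter> K \<noteq> {}"
  shows "W \<subseteq> K"
proof
  fix b assume "b \<in> W"
  obtain a where "a \<in> W" "a \<in> K" using assms(4) by auto
  show "b \<in> K"
    using assms(1) \<open>a \<in> W\<close> \<open>b \<in> W\<close> \<open>a \<in> K\<close>
    by (rule rel_connected_induct[where P="\<lambda>v. v \<in> K"]) (use assms in auto)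
qed

lemma rel_connected_singleton: "rel_connected E {v}"
  by (auto simp: rel_connected_def)

lemma rel_connected_insert:
  assumes "rel_connected E T" "u \<in> T" "(u, v) \<in> E" "sym E"
  shows "rel_connected E (insert v T)"
proof -
  let ?E = "E \<inter> insert v T \<times> insert v T"
  have mono: "(E \<inter> T \<times> T)\<^sup>* \<subseteq> ?E\<^sup>*" by (intro rtrancl_mono) auto
  have T: "(a, b) \<in> ?E\<^sup>*" if "a \<in> T" "b \<in> T" for a b
    using assms(1) that mono by (auto simp: rel_connected_def)
  have uv: "(u, v) \<in> ?E" "(v, u) \<in> ?E" using assms by (auto dest: symD)
  have 1: "(a, v) \<in> ?E\<^sup>*" if "a \<in> T" for a
    using T[OF that assms(2)] uv by (simp add: rtrancl_into_rtrancl)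
  have 2: "(v, a) \<in> ?E\<^sup>*" if "a \<in> T" for a
    using T[OF assms(2) that] uv by (meson converse_rtrancl_into_rtrancl)
  show ?thesis
    unfolding rel_connected_def using T 1 2 by auto
qed

lemma rel_component_exists:
  assumes "sym E" "v \<in> U"
  obtains K where "rel_component E U K" "v \<in> K"
proof
  define K where "K = {w. (v, w) \<in> (E \<inter> U \<times> U)\<^sup>*}"
  have KU: "K \<subseteq> U"
  proof
    fix w assume "w \<in> K"
    then have "(v, w) \<in> (E \<inter> U \<times> U)\<^sup>*" by (simp add: K_def)
    then show "w \<in> U" by (induction rule: rtrancl_induct) (use assms in auto)
  qed
  have vK: "v \<in> K" by (simp add: K_def)
  have from_v: "(v, w) \<in> (E \<inter> K \<times> K)\<^sup>*" if "w \<in> K" for w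
  proof -
    have "(v, w) \<in> (E \<inter> U \<times> U)\<^sup>*" using that by (simp add: K_def)
    then show ?thesis
    proof (induction rule: rtrancl_induct)
      case (step a b)
      then have "a \<in> K" "b \<in> K" unfolding K_def by (auto intro: rtrancl_into_rtrancl)
      with step show ?case by (auto intro: rtrancl_into_rtrancl)
    qed simp
  qed
  have "sym ((E \<inter> K \<times> K)\<^sup>*)"
    using assms(1) by (intro sym_rtrancl) (auto simp: sym_def)
  then have "rel_connected E K"
    unfolding rel_connected_def using from_v by (meson rtrancl_trans symD)
  moreover have "\<forall>u\<in>K. \<forall>v\<in>U. (u, v) \<in> E \<longrightarrow> v \<in> K"
    using KU unfolding K_def by (auto intro: rtrancl_into_rtrancl)
  ultimately show "rel_component E U K"
    using KU vK by (auto simp: rel_component_def)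
  show "v \<in> K" by fact
qed

lemma rel_component_absorb:
  assumes "rel_component E U K" "rel_connected E W" "W \<subseteq> U" "W \<inter> K \<noteq> {}"
  shows "W \<subseteq> K"
  using rel_connected_subset[OF assms(2,3), of K] assms(1,4)
  by (auto simp: rel_component_def)

section \<open>Small connected transversals versus small separators\<close>

lemma hitting_tree_or_separator:
  fixes A :: "nat \<Rightarrow> 'v set"
  assumes E: "sym E" and fin: "finite H" and k: "0 < k" and r: "0 < r"
  obtains (tree) T where "T \<subseteq> H" "rel_connected E T" "card T \<le> r" "\<And>i. i < k \<Longrightarrow> T \<inter> A i \<noteq> {}"
  | (separator) Z where "Z \<subseteq> H" "r * card Z \<le> (k - 1) * card H"
      "\<And>K. rel_component E (H - Z) K \<Longrightarrow> \<exists>i<k. K \<inter> A i = {}"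
proof -
  \<comment> \<open>A shortest-path search through \<open>k\<close> copies of the graph, moving from copy \<open>i\<close> to copy \<open>i + 1\<close> at
    the vertices of \<open>A (i + 1)\<close>; if the last copy is not reached within \<open>r\<close> steps, the smallest of the
    \<open>r\<close> distance layers projects to the separator.\<close>
  define ball where "ball d = {(v, i). i < k \<and> (\<exists>T. T \<subseteq> H \<and> rel_connected E T \<and> v \<in> T \<and> card T \<le> d \<and>
      (\<forall>l\<le>i. T \<inter> A l \<noteq> {}))}" for d
  show ?thesis
  proof (cases "\<exists>v. (v, k - 1) \<in> ball r")
    case True
    then obtain v T where T: "T \<subseteq> H" "rel_connected E T" "v \<in> T" "card T \<le> r" "\<forall>l\<le>k - 1. T \<inter> A l \<noteq> {}"
      by (auto simp: ball_def)
    show ?thesis by (rule tree[of T]) (use T in auto)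
  next
    case False
    have ball_mono: "ball d \<subseteq> ball d'" if "d \<le> d'" for d d'
    proof (rule subsetI, clarify)
      fix v i assume "(v, i) \<in> ball d"
      then obtain T where "i < k" "T \<subseteq> H" "rel_connected E T" "v \<in> T" "card T \<le> d" "\<forall>l\<le>i. T \<inter> A l \<noteq> {}"
        by (auto simp: ball_def)
      then show "(v, i) \<in> ball d'"
        using that unfolding ball_def by (auto intro!: exI[of _ T])
    qed
    have no_top: "(v, k - 1) \<notin> ball d" if "d \<le> r" for v d
      using False ball_mono[OF that] by auto
    have ball_sub: "ball d \<subseteq> H \<times> {..<k - 1}" if "d \<le> r" for d
    proof (rule subsetI, clarify)
      fix v i assume vi: "(v, i) \<in> ball d"
      then have "i \<noteq> k - 1" using no_top[OF that, of v] by auto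
      then show "v \<in> H \<and> i \<in> {..<k - 1}" using vi by (auto simp: ball_def)
    qed
    \<comment> \<open>The new states of each step. No state of the last copy is reached within
      \<open>r\<close> steps, so the \<open>r\<close> disjoint layers share
      \<open>(k - 1) * card H\<close> states and some layer has at most an \<open>r\<close>-th of
      them.\<close>
    define layer where "layer d = ball (Suc d) - ball d" for d
    have layer_sub: "layer d \<subseteq> H \<times> {..<k - 1}" if "d < r" for d
      using ball_sub[of "Suc d"] that by (auto simp: layer_def)
    have disj: "layer d \<inter> layer d' = {}" if "d \<noteq> d'" for d d'
      using that ball_mono[of "Suc d" d'] ball_mono[of "Suc d'" d]
      by (auto simp: layer_def neq_iff Suc_le_eq)
    have fin_layer: "finite (layer d)" if "d < r" for d
      using finite_subset[OF layer_sub[OF that]] fin by auto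
    have "(\<Sum>d<r. card (layer d)) = card (\<Union>d<r. layer d)"
      by (rule card_UN_disjoint[symmetric]) (use disj fin_layer in auto)
    also have "\<dots> \<le> card (H \<times> {..<k - 1})"
      by (rule card_mono) (use layer_sub fin in auto)
    finally have sum: "(\<Sum>d<r. card (layer d)) \<le> (k - 1) * card H"
      by (simp add: card_cartesian_product mult.commute)
    obtain d where d: "d < r" "r * card (layer d) \<le> (k - 1) * card H"
    proof (rule ccontr)
      assume "\<not> thesis"
      then have "\<And>d. d < r \<Longrightarrow> (k - 1) * card H < r * card (layer d)"
        using that by (meson not_le_imp_less)
      then have "(\<Sum>d<r. (k - 1) * card H) < (\<Sum>d<r. r * card (layer d))"
        using r by (intro sum_strict_mono) auto
      then have "r * ((k - 1) * card H) < r * (\<Sum>d<r. card (layer d))"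
        by (simp add: sum_distrib_left)
      with sum show False by (simp add: mult_less_cancel1)
    qed
    define Z where "Z = fst ` layer d"
    show ?thesis
    proof (rule separator)
      show "Z \<subseteq> H" using layer_sub[OF d(1)] by (auto simp: Z_def)
      have "card Z \<le> card (layer d)" unfolding Z_def by (rule card_image_le[OF fin_layer[OF d(1)]])
      then show "r * card Z \<le> (k - 1) * card H"
        using d(2) by (meson le_trans mult_le_mono2)
      fix K assume K: "rel_component E (H - Z) K"
      show "\<exists>i<k. K \<inter> A i = {}"
      proof (rule ccontr)
        assume "\<not> ?thesis"
        then have meets: "\<And>i. i < k \<Longrightarrow> K \<inter> A i \<noteq> {}" by auto
        have KHZ: "K \<subseteq> H - Z" "rel_connected E K" using K by (auto simp: rel_component_def)
        \<comment> \<open>A state over \<open>K\<close> first reached at step \<open>Suc d\<close>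
          would lie in the chosen layer and put its vertex into \<open>Z\<close>, which
          \<open>K\<close> avoids.\<close>
        have stay: "(v, i) \<in> ball d" if "(v, i) \<in> ball (Suc d)" "v \<in> K" for v i
        proof (rule ccontr)
          assume "(v, i) \<notin> ball d"
          then have "v \<in> Z" using that(1) by (force simp: Z_def layer_def)
          then show False using that(2) KHZ by auto
        qed
        have step: "(v, i) \<in> ball (Suc d)" if ui: "(u, i) \<in> ball d" and v: "v \<in> K" and uv: "(u, v) \<in> E" for u v i
        proof -
          obtain T where T: "i < k" "T \<subseteq> H" "rel_connected E T" "u \<in> T" "card T \<le> d" "\<forall>l\<le>i. T \<inter> A l \<noteq> {}"
            using ui by (auto simp: ball_def)
          have "rel_connected E (insert v T)"
            using rel_connected_insert[OF T(3,4) uv E] .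
          moreover have "card (insert v T) \<le> Suc d" using T(5) finite_subset[OF T(2) fin]
            by (simp add: card_insert_if)
          ultimately show ?thesis using T KHZ v unfolding ball_def
            by (auto intro!: exI[of _ "insert v T"])
        qed
        have spread: "(v, i) \<in> ball d" if "(u, i) \<in> ball d" "u \<in> K" "v \<in> K" for u v i
          using KHZ(2) that(2,3,1)
          by (rule rel_connected_induct[where P="\<lambda>v. (v, i) \<in> ball d"]) (use step stay in blast)
        \<comment> \<open>As \<open>K\<close> meets every \<open>A i\<close>, changing to the next
          copy at such a vertex costs no step. So \<open>ball d\<close> fills all copies of
          \<open>K\<close>, even the last one, which is out of reach.\<close>
        have all: "\<forall>v\<in>K. (v, i) \<in> ball d" if "i < k" for i
          using that
        proof (induction i)
          case 0
          obtain v where v: "v \<in> K" "v \<in> A 0" using meets[OF k] by auto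
          have "(v, 0) \<in> ball (Suc 0)"
            unfolding ball_def using v KHZ k rel_connected_singleton[of E v]
            by (auto intro!: exI[of _ "{v}"])
          then have "(v, 0) \<in> ball (Suc d)" using ball_mono[of "Suc 0" "Suc d"] by auto
          then show ?case using stay[of v 0] spread v by blast
        next
          case (Suc i)
          obtain v where v: "v \<in> K" "v \<in> A (Suc i)" using meets[OF Suc.prems] by auto
          have "(v, i) \<in> ball d" using Suc v by auto
          then obtain T where T: "T \<subseteq> H" "rel_connected E T" "v \<in> T" "card T \<le> d" "\<forall>l\<le>i. T \<inter> A l \<noteq> {}"
            by (auto simp: ball_def)
          have "(v, Suc i) \<in> ball d"
            unfolding ball_def using T v Suc.prems by (auto simp: le_Suc_eq intro!: exI[of _ T])
          then show ?case using spread v by blast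
        qed
        have "K \<noteq> {}" using K by (auto simp: rel_component_def)
        then obtain v where "v \<in> K" by auto
        with all[of "k - 1"] k no_top[of d v] d(1) show False by auto
      qed
    qed
  qed
qed

section \<open>Clique minors, given by their branch sets\<close>

definition clique_model :: "('v \<times> 'v) set \<Rightarrow> 'v set set \<Rightarrow> bool" where
  "clique_model E CC \<longleftrightarrow> finite CC \<and> (\<forall>C\<in>CC. C \<noteq> {} \<and> rel_connected E C) \<and>
    (\<forall>C\<in>CC. \<forall>C'\<in>CC. C \<noteq> C' \<longrightarrow> C \<inter> C' = {} \<and> (\<exists>u\<in>C. \<exists>v\<in>C'. (u, v) \<in> E))"

lemma clique_model_insert:
  assumes "clique_model E CC" "sym E" "T \<noteq> {}" "rel_connected E T"
    and T: "\<And>C. C \<in> CC \<Longrightarrow> T \<inter> C = {} \<and> (\<exists>u\<in>T. \<exists>v\<in>C. (u, v) \<in> E)"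
  shows "clique_model E (insert T CC)"
proof -
  have "C \<inter> T = {} \<and> (\<exists>u\<in>C. \<exists>v\<in>T. (u, v) \<in> E)" if "C \<in> CC" for C
    using T[OF that] symD[OF assms(2)] by blast
  with T assms(1,3,4) show ?thesis
    unfolding clique_model_def by (metis finite_insert insert_iff)
qed

lemma card_Int_Union_le:
  assumes "finite CC" "U \<subseteq> \<Union> CC" "\<And>C. C \<in> CC \<Longrightarrow> card (U \<inter> C) \<le> q"
  shows "card U \<le> card CC * q"
proof -
  have "U = (\<Union>C\<in>CC. U \<inter> C)" using assms(2) by auto
  then have "card U \<le> (\<Sum>C\<in>CC. card (U \<inter> C))"
    using card_UN_le[OF assms(1), of "\<lambda>C. U \<inter> C"] by simp
  also have "\<dots> \<le> card CC * q"
    using sum_bounded_above[of CC "\<lambda>C. card (U \<inter> C)" q] assms(3) by simp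
  finally show ?thesis .
qed

text \<open>
  Alon, Seymour and Thomas, A separator theorem for nonplanar graphs (1990). The potential
  \<open>(|K|, |CC|)\<close> decreases lexicographically: either \<open>K\<close> contains a small tree meeting the
  neighbourhoods of all members of \<open>CC\<close>, which becomes a new member, or a small set \<open>Z\<close>
  shields the new big component \<open>D\<close> from some member \<open>C\<close>. In the latter case
  \<open>C\<close> is dropped if it has no neighbour in \<open>K\<close>, and otherwise enlarged to the part
  \<open>W\<close> of \<open>K - D\<close> reachable from it, so that the part of \<open>Z\<close> in \<open>W\<close> replaces the old
  boundary of \<open>C\<close>.
\<close>
theorem clique_model_of_haven:
  fixes V :: "'v set"
  assumes E: "sym E" and finV: "finite V" and q: "0 < q" "h * card V \<le> q * q"
    and haven: "\<And>U. U \<subseteq> V \<Longrightarrow> card U \<le> h * q \<Longrightarrow> \<exists>K. rel_component E (V - U) K \<and> big K"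
    and touch: "\<And>K K'. big K \<Longrightarrow> big K' \<Longrightarrow> K \<inter> K' \<noteq> {}"
  obtains CC where "clique_model E CC" "\<Union> CC \<subseteq> V" "card CC = h"
proof -
  \<comment> \<open>\<open>U\<close> is the boundary: every edge from \<open>K\<close> to a branch
    set ends in it, and it takes at most \<open>q\<close> vertices from each. The haven answers for
    sets of size \<open>h * q\<close>, which leaves room for \<open>q\<close> further vertices while
    there are fewer than \<open>h\<close> branch sets.\<close>
  define config where "config CC U K \<longleftrightarrow>
    clique_model E CC \<and> \<Union> CC \<subseteq> V \<and> card CC \<le> h \<and> U \<subseteq> \<Union> CC \<and> (\<forall>C\<in>CC. card (U \<inter> C) \<le> q) \<and>
    rel_component E (V - U) K \<and> big K \<and> (\<forall>C\<in>CC. C \<inter> K = {})" for CC U K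
  have "\<exists>CC'. clique_model E CC' \<and> \<Union> CC' \<subseteq> V \<and> card CC' = h" if "config CC U K" for CC U K
    using that
  \<comment> \<open>The measure encodes the lexicographic order: losing a vertex of \<open>K\<close>
    lowers it by \<open>h + 2\<close>, more than the one branch set a step can add.\<close>
  proof (induction "(h + 2) * card K + card CC" arbitrary: CC U K rule: less_induct)
    case less
    have IH: ?case if "config CC' U' K'" "K' \<subset> K" "card CC' \<le> card CC + 1" for CC' U' K'
    proof (rule less(1)[OF _ that(1)])
      have "finite K" using less(2) finV by (auto simp: config_def rel_component_def intro: finite_subset)
      then have "card K' < card K" using that(2) by (rule psubset_card_mono)
      then have "(h + 2) * Suc (card K') \<le> (h + 2) * card K" by (intro mult_le_mono2) auto
      then show "(h + 2) * card K' + card CC' < (h + 2) * card K + card CC" using that(3) by simp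
    qed
    show ?case
    proof (cases "card CC = h")
      case True
      then show ?thesis using less(2) by (auto simp: config_def)
    next
      case False
      have model: "clique_model E CC" and CCV: "\<Union> CC \<subseteq> V" and small: "card CC < h"
        and XCC: "U \<subseteq> \<Union> CC" and Xq: "\<And>C. C \<in> CC \<Longrightarrow> card (U \<inter> C) \<le> q"
        and K: "rel_component E (V - U) K" "big K" and disjK: "\<And>C. C \<in> CC \<Longrightarrow> C \<inter> K = {}"
        using less(2) False by (auto simp: config_def)
      have finCC: "finite CC" using model by (simp add: clique_model_def)
      have CC: "C \<noteq> {}" "rel_connected E C" if "C \<in> CC" for C
        using model that by (auto simp: clique_model_def)
      have CC2: "C \<inter> C' = {}" "\<exists>u\<in>C. \<exists>v\<in>C'. (u, v) \<in> E" if "C \<in> CC" "C' \<in> CC" "C \<noteq> C'" for C C'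
        using model that by (auto simp: clique_model_def)
      have KV: "K \<subseteq> V - U" and Kne: "K \<noteq> {}" and Kclosed: "\<And>u v. u \<in> K \<Longrightarrow> v \<in> V - U \<Longrightarrow> (u, v) \<in> E \<Longrightarrow> v \<in> K"
        using K by (auto simp: rel_component_def)
      have finK: "finite K" using KV finV by (auto intro: finite_subset)
      have XV: "U \<subseteq> V" using XCC CCV by auto
      have cardX: "card U \<le> card CC * q" using card_Int_Union_le[OF finCC XCC Xq] .
      have room: "card U' \<le> h * q" if "card U' \<le> card U + q" for U' :: "'v set"
      proof -
        have "card U' \<le> Suc (card CC) * q" using that cardX by simp
        also have "\<dots> \<le> h * q" using small by (intro mult_le_mono1) auto
        finally show ?thesis .
      qed
      define att where "att C = {v \<in> K. \<exists>u\<in>C. (u, v) \<in> E}" for C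
      \<comment> \<open>A tree meeting all attachment sets is adjacent to every branch set and
        becomes a new one, entirely part of the boundary. \<open>K\<close> shrinks because the tree
        is taken out of it.\<close>
      have add_tree: ?thesis
        if T: "T \<subseteq> K" "T \<noteq> {}" "rel_connected E T" "card T \<le> q" "\<And>C. C \<in> CC \<Longrightarrow> T \<inter> att C \<noteq> {}" for T
      proof -
        have "card (U \<union> T) \<le> card U + q" using card_Un_le[of U T] T by linarith
        then obtain K' where K': "rel_component E (V - (U \<union> T)) K'" "big K'"
          using haven[OF _ room, of "U \<union> T"] XV T(1) KV by blast
        have K'sub: "K' \<subseteq> V - (U \<union> T)" "rel_connected E K'" using K' by (auto simp: rel_component_def)
        have "K' \<subseteq> K"
          using rel_component_absorb[OF K(1) K'sub(2)] K'sub(1) touch[OF K'(2) K(2)] by auto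
        have TCC: "T \<inter> C = {}" if "C \<in> CC" for C using that T disjK by auto
        have TnotCC: "T \<notin> CC" using TCC T(2) by auto
        have TE: "\<exists>u\<in>T. \<exists>v\<in>C. (u, v) \<in> E" if "C \<in> CC" for C
          using T(5)[OF that] symD[OF E] unfolding att_def by blast
        show ?thesis
        proof (rule IH)
          have "clique_model E (insert T CC)"
            by (rule clique_model_insert[OF model E T(2,3)]) (use TCC TE in blast)
          moreover have "card ((U \<union> T) \<inter> C) \<le> q" if "C \<in> insert T CC" for C
          proof (cases "C = T")
            case True
            then have "(U \<union> T) \<inter> C = T" by auto
            then show ?thesis using T by simp
          next
            case False
            then have "(U \<union> T) \<inter> C = U \<inter> C" using TCC[of C] that by auto
            then show ?thesis using Xq[of C] that False by simp
          qed
          moreover have "C \<inter> K' = {}" if "C \<in> insert T CC" for C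
            using that disjK[of C] \<open>K' \<subseteq> K\<close> K'sub(1) by blast
          moreover have "\<Union> (insert T CC) \<subseteq> V" "U \<union> T \<subseteq> \<Union> (insert T CC)" using CCV T(1) KV XCC by auto
          moreover have "card (insert T CC) \<le> h" using small finCC by (simp add: card_insert_if)
          ultimately show "config (insert T CC) (U \<union> T) K'"
            unfolding config_def using K' by blast
          show "K' \<subset> K" using \<open>K' \<subseteq> K\<close> K'sub T by auto
          show "card (insert T CC) \<le> card CC + 1" using finCC by (simp add: card_insert_if)
        qed
      qed
      show ?thesis
      proof (cases "CC = {}")
        case True
        obtain v where "v \<in> K" using Kne by auto
        show ?thesis
          by (rule add_tree[of "{v}"]) (use True \<open>v \<in> K\<close> q rel_connected_singleton in auto)
      next
        case False
        then have kpos: "0 < card CC" using finCC by (simp add: card_gt_0_iff)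
        obtain f where f: "bij_betw f {0..<card CC} CC" using ex_bij_betw_nat_finite[OF finCC] by auto
        have f_in: "f i \<in> CC" if "i < card CC" for i
          using f that by (auto simp: bij_betw_def)
        have f_onto: "\<exists>i<card CC. C = f i" if "C \<in> CC" for C
          using f that unfolding bij_betw_def by (metis atLeast0LessThan imageE lessThan_iff)
        show ?thesis
        proof (rule hitting_tree_or_separator[OF E finK kpos q(1), of "\<lambda>i. att (f i)"])
          fix T assume T: "T \<subseteq> K" "rel_connected E T" "card T \<le> q" "\<And>i. i < card CC \<Longrightarrow> T \<inter> att (f i) \<noteq> {}"
          show ?thesis
          proof (rule add_tree[of T])
            show "T \<noteq> {}" using T(4)[OF kpos] by auto
            show "T \<inter> att C \<noteq> {}" if "C \<in> CC" for C using f_onto[OF that] T(4) by blast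
          qed (use T in auto)
        next
          \<comment> \<open>At most \<open>q\<close> vertices, because \<open>q * card Z \<le> (card
            CC - 1) * card K \<le> h * card V \<le> q * q\<close>.\<close>
          fix Z assume ZK: "Z \<subseteq> K" and Zcard: "q * card Z \<le> (card CC - 1) * card K"
            and Zsep: "\<And>D. rel_component E (K - Z) D \<Longrightarrow> \<exists>i<card CC. D \<inter> att (f i) = {}"
          have "card K \<le> card V" using KV finV by (intro card_mono) auto
          then have "(card CC - 1) * card K \<le> h * card V" using small by (intro mult_le_mono) auto
          then have "q * card Z \<le> q * q" using Zcard q(2) by linarith
          then have Zq: "card Z \<le> q" using q(1) by simp
          have "card (U \<union> Z) \<le> card U + q" using card_Un_le[of U Z] Zq by linarith
          then obtain D where D: "rel_component E (V - (U \<union> Z)) D" "big D"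
            using haven[OF _ room, of "U \<union> Z"] XV ZK KV by blast
          have Dsub: "D \<subseteq> V - (U \<union> Z)" "rel_connected E D" "D \<noteq> {}"
            and Dclosed: "\<And>u v. u \<in> D \<Longrightarrow> v \<in> V - (U \<union> Z) \<Longrightarrow> (u, v) \<in> E \<Longrightarrow> v \<in> D"
            using D by (auto simp: rel_component_def)
          have "D \<subseteq> K"
            using rel_component_absorb[OF K(1) Dsub(2)] Dsub(1) touch[OF D(2) K(2)] by auto
          then have "rel_component E (K - Z) D"
            using Dsub Dclosed KV unfolding rel_component_def by blast
          then obtain C where C: "C \<in> CC" "D \<inter> att C = {}" using Zsep f_in by blast
          show ?thesis
          proof (cases "att C = {}")
            case True
            show ?thesis
            proof (rule less(1))
              \<comment> \<open>No edge leads from \<open>K\<close> to \<open>C\<close>, so giving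
                back the boundary inside \<open>C\<close> does not enlarge the component.\<close>
              have "rel_component E (V - (U - C)) K"
                unfolding rel_component_def
              proof (intro conjI ballI impI)
                fix u v assume uv: "u \<in> K" "v \<in> V - (U - C)" "(u, v) \<in> E"
                have "v \<notin> C" using True uv symD[OF E] unfolding att_def by blast
                then show "v \<in> K" using Kclosed[of u v] uv by auto
              qed (use K in \<open>auto simp: rel_component_def\<close>)
              moreover have "clique_model E (CC - {C})" using model by (auto simp: clique_model_def)
              moreover have "card ((U - C) \<inter> C') \<le> q" if "C' \<in> CC - {C}" for C'
              proof -
                have "(U - C) \<inter> C' = U \<inter> C'" using CC2(1)[OF C(1), of C'] that by auto
                then show ?thesis using Xq[of C'] that by simp
              qed
              moreover have "card (CC - {C}) \<le> h" using small card_Diff1_le[of CC C] by linarith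
              ultimately show "config (CC - {C}) (U - C) K"
                unfolding config_def using K(2) disjK CCV XCC by auto
              show "(h + 2) * card K + card (CC - {C}) < (h + 2) * card K + card CC"
                using card_Diff1_less[OF finCC C(1)] by simp
            qed
          next
            case False
            have CK: "C \<inter> K = {}" using disjK[OF C(1)] .
            obtain c where c: "c \<in> C" using CC(1)[OF C(1)] by auto
            obtain W where W: "rel_component E (C \<union> (K - D)) W" "c \<in> W"
              using rel_component_exists[OF E, of c "C \<union> (K - D)"] c by auto
            have CW: "C \<subseteq> W"
              using rel_component_absorb[OF W(1) CC(2)[OF C(1)]] c W(2) by auto
            have Wsub: "W \<subseteq> C \<union> (K - D)" "rel_connected E W"
              and Wclosed: "\<And>u v. u \<in> W \<Longrightarrow> v \<in> C \<union> (K - D) \<Longrightarrow> (u, v) \<in> E \<Longrightarrow> v \<in> W"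
              using W by (auto simp: rel_component_def)
            \<comment> \<open>\<open>D\<close> misses the attachments of \<open>C\<close>, so they
              all lie in \<open>K - D\<close> and are reached from \<open>C\<close> in one
              step.\<close>
            have attW: "att C \<subseteq> W"
              using Wclosed CW C(2) unfolding att_def by blast
            \<comment> \<open>Only the part of \<open>Z\<close> inside \<open>W\<close> is kept, so
              that the boundary stays within the branch sets.\<close>
            define U' where "U' = (U - C) \<union> (Z \<inter> W)"
            have "card U' \<le> card (U \<union> Z)"
              unfolding U'_def using finV XV ZK KV
              by (intro card_mono) (auto intro: finite_subset)
            also have "\<dots> \<le> card U + q" by fact
            finally have "card U' \<le> h * q" by (rule room)
            moreover have "U' \<subseteq> V" using XV ZK KV by (auto simp: U'_def)
            ultimately obtain K' where K': "rel_component E (V - U') K'" "big K'"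
              using haven[of U'] by auto
            have K'sub: "K' \<subseteq> V - U'" "rel_connected E K'" using K' by (auto simp: rel_component_def)
            have "D \<subseteq> K'"
              by (rule rel_component_absorb[OF K'(1) Dsub(2)])
                (use Dsub(1) touch[OF D(2) K'(2)] in \<open>auto simp: U'_def\<close>)
            \<comment> \<open>An edge from \<open>K - W\<close> into \<open>W\<close> would start in
              \<open>D\<close>, since \<open>W\<close> absorbs its neighbours in
              \<open>K - D\<close>. It cannot end in \<open>C\<close>, as \<open>D\<close> contains
              no attachment of \<open>C\<close>, nor in \<open>K - D\<close> outside
              \<open>Z\<close>, as \<open>D\<close> is a component. What remains is
              \<open>Z \<inter> W\<close>, which is removed with \<open>U'\<close>.\<close>
            have K'K: "K' \<subseteq> K - W"
            proof (rule rel_connected_subset[OF K'sub(2,1)])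
              fix u v assume u: "u \<in> K - W" and v: "v \<in> V - U'" and uv: "(u, v) \<in> E"
              have vu: "(v, u) \<in> E" using symD[OF E uv] .
              have vW: "v \<notin> W"
              proof
                assume "v \<in> W"
                then have "u \<in> D" using Wclosed[OF _ _ vu] u by auto
                show False
                proof (cases "v \<in> C")
                  case True
                  then have "u \<in> att C" using u vu by (auto simp: att_def)
                  then show False using C(2) \<open>u \<in> D\<close> by auto
                next
                  case False
                  then have "v \<in> K - D" using \<open>v \<in> W\<close> Wsub by auto
                  moreover have "v \<notin> Z" using v \<open>v \<in> W\<close> by (auto simp: U'_def)
                  ultimately show False using Dclosed[OF \<open>u \<in> D\<close> _ uv] KV by auto
                qed
              qed
              then have "v \<notin> U" using v CW by (auto simp: U'_def)
              then show "v \<in> K - W" using Kclosed[of u v] u v uv vW by auto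
            next
              have "D \<inter> W = {}" using \<open>D \<subseteq> K\<close> Wsub(1) CK by blast
              then show "K' \<inter> (K - W) \<noteq> {}"
                using \<open>D \<subseteq> K'\<close> \<open>D \<subseteq> K\<close> Dsub(3) by blast
            qed
            define CC' where "CC' = insert W (CC - {C})"
            have WCC: "W \<inter> C' = {}" if "C' \<in> CC - {C}" for C'
              using Wsub(1) disjK[of C'] CC2(1)[OF C(1), of C'] that by auto
            have WE: "\<exists>u\<in>W. \<exists>v\<in>C'. (u, v) \<in> E" if "C' \<in> CC - {C}" for C'
              using CC2(2)[OF C(1), of C'] CW that by blast
            have "W \<notin> CC - {C}" using WCC[of W] W(2) by auto
            then have cardCC': "card CC' = card CC"
              unfolding CC'_def using finCC C(1) card_Suc_Diff1[OF finCC C(1)] by simp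
            show ?thesis
            proof (rule IH)
              have "clique_model E CC'"
                unfolding CC'_def
              proof (rule clique_model_insert[OF _ E _ Wsub(2)])
                show "clique_model E (CC - {C})" using model by (auto simp: clique_model_def)
              qed (use W(2) WCC WE in blast)+
              moreover have "card (U' \<inter> C') \<le> q" if "C' \<in> CC'" for C'
              proof (cases "C' = W")
                case True
                have "U - C \<subseteq> \<Union> (CC - {C})" using XCC by auto
                then have "(U - C) \<inter> W = {}" using WCC by blast
                then have "U' \<inter> C' = Z \<inter> W" using True by (auto simp: U'_def)
                moreover have "card (Z \<inter> W) \<le> card Z"
                  using ZK finK by (intro card_mono) (auto intro: finite_subset)
                ultimately show ?thesis using Zq by simp
              next
                case False
                then have C': "C' \<in> CC - {C}" using that by (auto simp: CC'_def)
                then have "U' \<inter> C' \<subseteq> U \<inter> C'" using WCC by (auto simp: U'_def)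
                then have "card (U' \<inter> C') \<le> card (U \<inter> C')"
                  using XV finV by (intro card_mono) (auto intro: finite_subset)
                then show ?thesis using Xq[of C'] C' by auto
              qed
              moreover have "U' \<subseteq> \<Union> CC'" using XCC by (auto simp: U'_def CC'_def)
              moreover have "\<Union> CC' \<subseteq> V" using CCV Wsub(1) KV C(1) by (auto simp: CC'_def)
              moreover have "\<forall>C\<in>CC'. C \<inter> K' = {}" using K'K disjK by (auto simp: CC'_def)
              ultimately show "config CC' U' K'"
                unfolding config_def using K' cardCC' small by auto
              show "K' \<subset> K" using K'K attW False by (auto simp: att_def)
              show "card CC' \<le> card CC + 1" using cardCC' by simp
            qed
          qed
        qed
      qed
    qed
  qed
  moreover have "\<exists>K. config {} {} K"
    using haven[of "{}"] by (auto simp: config_def clique_model_def)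
  ultimately show ?thesis using that by blast
qed

section \<open>Crossing chords in the plane\<close>

text \<open>Inside a branch set an arc can be prolonged to any chosen point: \<open>S\<close> is
  arcwise connected and \<open>g\<close> touches it only at its start, so the concatenation stays
  injective. The added piece \<open>s\<close> is kept as a set because it degenerates to a point if
  \<open>z\<close> is already the start.\<close>

lemma arc_extend:
  fixes g :: "real \<Rightarrow> complex"
  assumes "arc g" "path_connected S" "z \<in> S" "path_image g \<inter> S = {pathstart g}"
  obtains s k where "arc k" "pathstart k = z" "pathfinish k = pathfinish g" "path_image k = s \<union> path_image g"
    "s \<subseteq> S" "compact s" "connected s" "z \<in> s" "pathstart g \<in> s"
proof (cases "z = pathstart g")
  case True
  show ?thesis
    by (rule that[of g "{z}"]) (use True assms pathstart_in_path_image[of g] in auto)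
next
  case False
  have gS: "pathstart g \<in> S" using assms(4) by auto
  obtain h where h: "arc h" "path_image h \<subseteq> S" "pathstart h = z" "pathfinish h = pathstart g"
    using assms(2,3) gS False unfolding path_connected_arcwise by metis
  have "arc (h +++ g)"
    by (rule arc_join) (use h assms in auto)
  show ?thesis
  proof (rule that[of "h +++ g" "path_image h"])
    show "path_image (h +++ g) = path_image h \<union> path_image g"
      by (rule path_image_join) (use h in auto)
    show "z \<in> path_image h" using h(3) by (metis pathstart_in_path_image)
    show "pathstart g \<in> path_image h" using h(4) by (metis pathfinish_in_path_image)
  qed (use \<open>arc (h +++ g)\<close> h in \<open>auto simp: arc_imp_path compact_path_image connected_path_image\<close>)
qed

lemma arc_link:
  fixes g h :: "real \<Rightarrow> complex"
  assumes "arc g" "arc h" "path_connected S"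
    "path_image g \<inter> S = {pathfinish g}" "path_image h \<inter> S = {pathstart h}"
    "path_image g \<inter> path_image h \<subseteq> S"
  obtains s k where "arc k" "pathstart k = pathstart g" "pathfinish k = pathfinish h"
    "path_image k = path_image g \<union> s \<union> path_image h"
    "s \<subseteq> S" "compact s" "connected s" "pathfinish g \<in> s" "pathstart h \<in> s"
proof -
  have "pathfinish g \<in> S" using assms(4) by auto
  then obtain s k where k: "arc k" "pathstart k = pathfinish g" "pathfinish k = pathfinish h"
    "path_image k = s \<union> path_image h"
    and s: "s \<subseteq> S" "compact s" "connected s" "pathfinish g \<in> s" "pathstart h \<in> s"
    using arc_extend[OF assms(2,3) _ assms(5)] by metis
  have "arc (g +++ k)"
    by (rule arc_join) (use k s assms in auto)
  moreover have "path_image (g +++ k) = path_image g \<union> s \<union> path_image h"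
    using k by (subst path_image_join) auto
  ultimately show ?thesis
    using that[of "g +++ k" s] k s by auto
qed

text \<open>Stop a path from \<open>w\<close> at its least parameter in the closed preimage of
  \<open>J\<close>. The half-open image \<open>C\<close> is off \<open>J\<close> but has the hit
  point \<open>t\<close> in its closure, which is how a chord without its end points touches the
  curve.\<close>

lemma first_hit:
  fixes D J :: "'a::real_normed_vector set"
  assumes "path_connected D" "closed J" "w \<in> D" "w \<notin> J" "D \<inter> J \<noteq> {}"
  obtains t C where "connected C" "w \<in> C" "C \<subseteq> D - J" "t \<in> D \<inter> J" "t \<in> closure C" "compact (insert t C)"
proof -
  obtain y where y: "y \<in> D" "y \<in> J" using assms(5) by auto
  obtain g where g: "path g" "path_image g \<subseteq> D" "pathstart g = w" "pathfinish g = y"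
    using assms(1,3) y(1) unfolding path_connected_def by metis
  have cont: "continuous_on {0..1} g" using g(1) by (simp add: path_def)
  define H where "H = {0..1} \<inter> g -` J"
  have "closed H" unfolding H_def by (rule continuous_closed_preimage[OF cont _ assms(2)]) auto
  then have "compact H" using compact_Int_closed[of "{0..1::real}" H] by (simp add: H_def Int_absorb1)
  moreover have "1 \<in> H" using g(4) y(2) by (auto simp: H_def pathfinish_def)
  ultimately obtain u where u: "u \<in> H" "\<And>v. v \<in> H \<Longrightarrow> u \<le> v"
    using compact_attains_inf[of H] by auto
  have "g 0 \<notin> J" using g(3) assms(4) by (simp add: pathstart_def)
  then have u01: "0 < u" "u \<le> 1" using u(1) by (auto simp: H_def less_le)
  have before: "g v \<in> D - J" if "0 \<le> v" "v < u" for v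
    using that u(2)[of v] u01 g(2) by (force simp: H_def path_image_def)
  show ?thesis
  proof (rule that[of "g ` {0..<u}" "g u"])
    have sub: "{0..<u} \<subseteq> {0..1}" using u01 by auto
    show "connected (g ` {0..<u})"
      by (rule connected_continuous_image[OF continuous_on_subset[OF cont sub]]) auto
    show "w \<in> g ` {0..<u}" using g(3) u01 by (auto simp: pathstart_def)
    show "g ` {0..<u} \<subseteq> D - J" using before by auto
    show "g u \<in> D \<inter> J" using u u01 g(2) by (auto simp: H_def path_image_def)
    have cu: "continuous_on {0..u} g" using u01 by (intro continuous_on_subset[OF cont]) auto
    have "g ` closure {0..<u} \<subseteq> closure (g ` {0..<u})"
      using u01 by (intro image_closure_subset) (use cu in \<open>auto simp: closure_subset\<close>)
    then show "g u \<in> closure (g ` {0..<u})" using u01 by auto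
    have "{0..u} = insert u {0..<u}" using u01 by auto
    then have "insert (g u) (g ` {0..<u}) = g ` {0..u}" by simp
    then show "compact (insert (g u) (g ` {0..<u}))"
      using compact_continuous_image[OF cu] by simp
  qed
qed

text \<open>
  With \<open>V\<close> the side of the curve not containing \<open>q\<close>, neither \<open>J1 \<union> A\<close> nor \<open>J2 \<union> A\<close>
  separates \<open>V\<close> from \<open>B\<close>, since \<open>p2\<close> resp. \<open>p1\<close> joins the two; by Janiszewski's theorem their
  union does not either, so \<open>B\<close> lies in \<open>V\<close>, whereas \<open>C\<close> puts it on the side of \<open>q\<close>.
\<close>
lemma no_crossing_chords:
  fixes c :: "real \<Rightarrow> complex"
  assumes c: "simple_path c" "pathfinish c = pathstart c" "path_image c = J1 \<union> J2"
    and J12: "compact J1" "compact J2" "J1 \<inter> J2 \<subseteq> A"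
    and A: "compact A" "connected A" "connected (A - (J1 \<union> J2))" "q \<in> A - (J1 \<union> J2)"
    and B: "connected B" "B \<inter> (J1 \<union> J2 \<union> A) = {}" "r \<in> B"
    and p1: "p1 \<in> closure B" "p1 \<in> J1 - A" and p2: "p2 \<in> closure B" "p2 \<in> J2 - A"
    and qr: "connected C" "C \<inter> (J1 \<union> J2) = {}" "q \<in> C" "r \<in> C"
  shows False
proof -
  let ?J = "J1 \<union> J2"
  obtain U V where UV: "open U" "open V" "connected V" "V \<noteq> {}" "U \<inter> V = {}" "U \<union> V = - ?J" "frontier V = ?J" "q \<in> U"
  proof (rule Jordan_curve[OF c(1,2)])
    fix inner outer
    assume *: "inner \<noteq> {}" "open inner" "connected inner" "outer \<noteq> {}" "open outer" "connected outer"
      "inner \<inter> outer = {}" "inner \<union> outer = - path_image c"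
      "frontier inner = path_image c" "frontier outer = path_image c"
    have "q \<in> inner \<union> outer" using A(4) * c(3) by auto
    then show ?thesis
    proof
      assume "q \<in> inner"
      then show ?thesis using that[of inner outer] * c(3) by auto
    next
      assume "q \<in> outer"
      then show ?thesis using that[of outer inner] * c(3) by auto
    qed
  qed
  have sep: "T \<inter> V = {}" if "connected T" "T \<inter> ?J = {}" "q \<in> T" for T
    using connectedD[OF that(1) UV(1,2)] that UV by auto
  have VA: "V \<inter> A = {}"
    using sep[OF A(3)] A(4) UV(6) by auto
  obtain v where v: "v \<in> V" using UV by auto
  have Vcl: "?J \<subseteq> closure V" using UV(7) by (auto simp: frontier_def)
  \<comment> \<open>The whole curve is the frontier of \<open>V\<close>, so \<open>p\<close> is a
    limit of \<open>V\<close> as well as of \<open>B\<close>, and \<open>V\<close>, \<open>p\<close>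
    and \<open>B\<close> form one connected set, which avoids \<open>A\<close> and the half
    \<open>Ji\<close> not containing \<open>p\<close>.\<close>
  have join: "connected_component (- (Ji \<union> A)) v r" if "p \<in> closure B" "p \<in> ?J - A" "Ji \<subseteq> ?J" "p \<notin> Ji" for p Ji
  proof -
    have "connected (insert p V)"
      by (rule connected_intermediate_closure[OF UV(3)]) (use Vcl that closure_subset in auto)
    moreover have "connected (insert p B)"
      by (rule connected_intermediate_closure[OF B(1)]) (use that closure_subset in auto)
    ultimately have "connected (insert p V \<union> insert p B)"
      by (intro connected_Un) auto
    moreover have "insert p V \<union> insert p B \<subseteq> - (Ji \<union> A)"
      using that VA UV(6) B(2) by auto
    ultimately show ?thesis
      unfolding connected_component_def using v B(3) by blast
  qed
  have "p1 \<notin> J2" "p2 \<notin> J1" using p1 p2 J12(3) by auto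
  then have "connected_component (- (J1 \<union> A)) v r" "connected_component (- (J2 \<union> A)) v r"
    using join[of p2 J1] join[of p1 J2] p1 p2 by auto
  \<comment> \<open>Janiszewski's theorem wants a connected intersection. The halves of the curve
    alone may meet in two points; adding \<open>A\<close> to both joins these.\<close>
  moreover have "(J1 \<union> A) \<inter> (J2 \<union> A) = A" using J12(3) by auto
  ultimately have "connected_component (- ((J1 \<union> A) \<union> (J2 \<union> A))) v r"
    using Janiszewski[of "J1 \<union> A" "J2 \<union> A" v r] J12(1,2) A(1,2)
    by (simp add: compact_Un compact_imp_closed)
  then obtain T where T: "connected T" "T \<subseteq> - ((J1 \<union> A) \<union> (J2 \<union> A))" "v \<in> T" "r \<in> T"
    by (auto simp: connected_component_def)
  have "connected (C \<union> T)" using qr T by (intro connected_Un) auto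
  from sep[OF this] show False using qr T v by auto
qed

text \<open>Branch sets take the place of the vertices of \<open>K\<^sub>6\<close>. Arcs with a
  common branch set may meet inside it, just as edges of a drawing may share an end point; elsewhere
  arcs of different pairs are disjoint.\<close>

theorem no_drawing_of_K6:
  fixes b :: "nat \<Rightarrow> complex set" and g :: "nat \<Rightarrow> nat \<Rightarrow> real \<Rightarrow> complex"
  assumes b: "\<And>i. i < 6 \<Longrightarrow> compact (b i)" "\<And>i. i < 6 \<Longrightarrow> path_connected (b i)"
    and disj: "\<And>i j. i < 6 \<Longrightarrow> j < 6 \<Longrightarrow> i \<noteq> j \<Longrightarrow> b i \<inter> b j = {}"
    and arc: "\<And>i j. i < 6 \<Longrightarrow> j < 6 \<Longrightarrow> i \<noteq> j \<Longrightarrow> arc (g i j)"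
    and start: "\<And>i j. i < 6 \<Longrightarrow> j < 6 \<Longrightarrow> i \<noteq> j \<Longrightarrow> path_image (g i j) \<inter> b i = {pathstart (g i j)}"
    and finish: "\<And>i j. i < 6 \<Longrightarrow> j < 6 \<Longrightarrow> i \<noteq> j \<Longrightarrow> path_image (g i j) \<inter> b j = {pathfinish (g i j)}"
    and avoid: "\<And>i j k. i < 6 \<Longrightarrow> j < 6 \<Longrightarrow> k < 6 \<Longrightarrow> i \<noteq> j \<Longrightarrow> k \<notin> {i, j} \<Longrightarrow> path_image (g i j) \<inter> b k = {}"
    and cross: "\<And>i j k l. i < 6 \<Longrightarrow> j < 6 \<Longrightarrow> k < 6 \<Longrightarrow> l < 6 \<Longrightarrow> i \<noteq> j \<Longrightarrow> k \<noteq> l \<Longrightarrow> {i, j} \<noteq> {k, l} \<Longrightarrow>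
      path_image (g i j) \<inter> path_image (g k l) \<subseteq> \<Union> (b ` ({i, j} \<inter> {k, l}))"
  shows False
proof -
  define e where "e i j = path_image (g i j)" for i j
  have st: "pathstart (g i j) \<in> b i" "pathfinish (g i j) \<in> b j" "pathstart (g i j) \<in> e i j" "pathfinish (g i j) \<in> e i j"
    if "i < 6" "j < 6" "i \<noteq> j" for i j
    using start[OF that] finish[OF that] unfolding e_def by blast+
  have dj: "b 0 \<inter> b 1 = {}" "b 0 \<inter> b 2 = {}" "b 0 \<inter> b 3 = {}" "b 0 \<inter> b 4 = {}" "b 0 \<inter> b 5 = {}"
    "b 1 \<inter> b 2 = {}" "b 1 \<inter> b 3 = {}" "b 1 \<inter> b 4 = {}" "b 1 \<inter> b 5 = {}" "b 2 \<inter> b 3 = {}"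
    "b 2 \<inter> b 4 = {}" "b 2 \<inter> b 5 = {}" "b 3 \<inter> b 4 = {}" "b 3 \<inter> b 5 = {}" "b 4 \<inter> b 5 = {}"
    by (rule disj; simp)+
  have start': "e i j \<inter> b i = {pathstart (g i j)}" if "i < 6" "j < 6" "i \<noteq> j" for i j
    using start[OF that] by (simp add: e_def)
  have finish': "e i j \<inter> b j = {pathfinish (g i j)}" if "i < 6" "j < 6" "i \<noteq> j" for i j
    using finish[OF that] by (simp add: e_def)
  have avoid': "e i j \<inter> b k = {}" if "i < 6" "j < 6" "k < 6" "i \<noteq> j" "k \<notin> {i, j}" for i j k
    using avoid[OF that] by (simp add: e_def)
  have cross0: "e i j \<inter> e k l = {}" if "i < 6" "j < 6" "k < 6" "l < 6" "i \<noteq> j" "k \<noteq> l" "{i, j} \<inter> {k, l} = {}" for i j k l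
    using cross[of i j k l] that by (auto simp: e_def)
  have cross1: "e i j \<inter> e k l \<subseteq> b m" if "i < 6" "j < 6" "k < 6" "l < 6" "i \<noteq> j" "k \<noteq> l" "{i, j} \<inter> {k, l} = {m}" for i j k l m
  proof -
    have "{i, j} \<noteq> {k, l}" using that(5,7) by auto
    then show ?thesis using cross[OF that(1-6)] that(7) by (simp add: e_def)
  qed

  \<comment> \<open>Only a \<open>K\<^sub>3\<^sub>,\<^sub>3\<close> is used: the sets 0, 2, 1, 3 are strung together to a closed curve, of which
    4 (joined to 0 and 1) and 5 (joined to 2 and 3) yield crossing chords.\<close>
  obtain s2 k1 where k1: "arc k1" "pathstart k1 = pathstart (g 0 2)" "pathfinish k1 = pathfinish (g 2 1)"
      "path_image k1 = e 0 2 \<union> s2 \<union> e 2 1"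
    and s2: "s2 \<subseteq> b 2" "compact s2" "connected s2" "pathfinish (g 0 2) \<in> s2" "pathstart (g 2 1) \<in> s2"
    unfolding e_def
    by (rule arc_link[of "g 0 2" "g 2 1" "b 2"])
      (use arc b start finish cross1[of 0 2 2 1 2] in \<open>auto simp: e_def\<close>)
  obtain s3 k2 where k2: "arc k2" "pathstart k2 = pathstart (g 0 3)" "pathfinish k2 = pathfinish (g 3 1)"
      "path_image k2 = e 0 3 \<union> s3 \<union> e 3 1"
    and s3: "s3 \<subseteq> b 3" "compact s3" "connected s3" "pathfinish (g 0 3) \<in> s3" "pathstart (g 3 1) \<in> s3"
    unfolding e_def
    by (rule arc_link[of "g 0 3" "g 3 1" "b 3"])
      (use arc b start finish cross1[of 0 3 3 1 3] in \<open>auto simp: e_def\<close>)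
  \<comment> \<open>\<open>k1\<close> and \<open>k2\<close> both run from branch set 0 to branch set
    1, but in general attach there at different points. \<open>k1\<close> is prolonged inside both
    sets to the end points of \<open>k2\<close>, at the far end after a reversal.\<close>
  have k1b: "path_image k1 \<inter> b 0 = {pathstart k1}"
    using k1 s2(1) dj start'[of 0 2] avoid'[of 2 1 0] by auto
  obtain s0 k3 where k3: "arc k3" "pathstart k3 = pathstart (g 0 3)" "pathfinish k3 = pathfinish (g 2 1)"
      "path_image k3 = s0 \<union> (e 0 2 \<union> s2 \<union> e 2 1)"
    and s0: "s0 \<subseteq> b 0" "compact s0" "connected s0" "pathstart (g 0 3) \<in> s0" "pathstart (g 0 2) \<in> s0"
    by (rule arc_extend[OF k1(1) b(2)[of 0] st(1)[of 0 3] k1b]) (use k1 in auto)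
  have k3b: "path_image (reversepath k3) \<inter> b 1 = {pathstart (reversepath k3)}"
    using k3 s0(1) s2(1) dj finish'[of 2 1] avoid'[of 0 2 1] by auto
  obtain s1 k4 where k4: "arc k4" "pathstart k4 = pathfinish (g 3 1)" "pathfinish k4 = pathstart (g 0 3)"
      "path_image k4 = s1 \<union> (s0 \<union> (e 0 2 \<union> s2 \<union> e 2 1))"
    and s1: "s1 \<subseteq> b 1" "compact s1" "connected s1" "pathfinish (g 3 1) \<in> s1" "pathfinish (g 2 1) \<in> s1"
    by (rule arc_extend[OF arc_reversepath[OF k3(1)] b(2)[of 1] st(2)[of 3 1] k3b]) (use k3 in auto)
  define J1 where "J1 = path_image k4"
  define J2 where "J2 = path_image k2"
  have J1: "J1 = s1 \<union> s0 \<union> e 0 2 \<union> s2 \<union> e 2 1" unfolding J1_def k4 by auto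
  have J2: "J2 = e 0 3 \<union> s3 \<union> e 3 1" unfolding J2_def k2 by auto
  have J12: "J1 \<inter> J2 \<subseteq> {pathstart (g 0 3), pathfinish (g 3 1)}"
  proof -
    have "s1 \<inter> J2 \<subseteq> {pathfinish (g 3 1)}"
      using J2 s1(1) s3(1) dj finish'[of 3 1] avoid'[of 0 3 1] by auto
    moreover have "s0 \<inter> J2 \<subseteq> {pathstart (g 0 3)}"
      using J2 s0(1) s3(1) dj start'[of 0 3] avoid'[of 3 1 0] by auto
    moreover have "s2 \<inter> J2 = {}"
      using J2 s2(1) s3(1) dj avoid'[of 0 3 2] avoid'[of 3 1 2] by auto
    moreover have "e 0 2 \<inter> J2 \<subseteq> {pathstart (g 0 3)}"
      using J2 s3(1) cross1[of 0 2 0 3 0] cross0[of 0 2 3 1] avoid'[of 0 2 3] start'[of 0 3] by auto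
    moreover have "e 2 1 \<inter> J2 \<subseteq> {pathfinish (g 3 1)}"
      using J2 s3(1) cross1[of 2 1 3 1 1] cross0[of 2 1 0 3] avoid'[of 2 1 3] finish'[of 3 1] by auto
    ultimately show ?thesis unfolding J1 by auto
  qed
  define c where "c = k4 +++ k2"
  have c: "simple_path c" "pathfinish c = pathstart c" "path_image c = J1 \<union> J2"
    unfolding c_def J1_def J2_def
    using simple_path_join_loop[OF k4(1) k2(1)] J12 k2 k4 path_image_join[of k4 k2]
    by (auto simp: J1_def J2_def)
  have cJ: "compact J1" "compact J2"
    using k2(1) k4(1) by (auto simp: J1_def J2_def arc_imp_path compact_path_image)
  have clJ: "closed (J1 \<union> J2)" using cJ by (intro closed_Un compact_imp_closed)
  have sb: "s \<inter> b k = {}" if "s \<subseteq> b i" "i < 6" "k < 6" "i \<noteq> k" for s i k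
    using disj[OF that(2-4)] that(1) by blast
  \<comment> \<open>Inside the branch sets 0 to 3 the curve is confined to the stretch chosen there,
    and it avoids 4 and 5. A chord can therefore hit it in a branch set only within that
    stretch.\<close>
  have "(s0 \<union> s1 \<union> s2 \<union> s3) \<inter> b 0 \<subseteq> s0"
    using sb[OF s1(1), of 0] sb[OF s2(1), of 0] sb[OF s3(1), of 0] by auto
  moreover have "(e 0 2 \<union> e 2 1 \<union> e 0 3 \<union> e 3 1) \<inter> b 0 \<subseteq> s0"
    using start'[of 0 2] start'[of 0 3] avoid'[of 2 1 0] avoid'[of 3 1 0] s0(4,5) by (simp add: Int_Un_distrib2)
  ultimately have Jb0: "(J1 \<union> J2) \<inter> b 0 \<subseteq> s0" unfolding J1 J2 by blast
  have "(s0 \<union> s1 \<union> s2 \<union> s3) \<inter> b 1 \<subseteq> s1"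
    using sb[OF s0(1), of 1] sb[OF s2(1), of 1] sb[OF s3(1), of 1] by auto
  moreover have "(e 0 2 \<union> e 2 1 \<union> e 0 3 \<union> e 3 1) \<inter> b 1 \<subseteq> s1"
    using finish'[of 2 1] finish'[of 3 1] avoid'[of 0 2 1] avoid'[of 0 3 1] s1(4,5) by (simp add: Int_Un_distrib2)
  ultimately have Jb1: "(J1 \<union> J2) \<inter> b 1 \<subseteq> s1" unfolding J1 J2 by blast
  have "(s0 \<union> s1 \<union> s2 \<union> s3) \<inter> b 2 \<subseteq> s2"
    using sb[OF s0(1), of 2] sb[OF s1(1), of 2] sb[OF s3(1), of 2] by auto
  moreover have "(e 0 2 \<union> e 2 1 \<union> e 0 3 \<union> e 3 1) \<inter> b 2 \<subseteq> s2"
    using finish'[of 0 2] start'[of 2 1] avoid'[of 0 3 2] avoid'[of 3 1 2] s2(4,5) by (simp add: Int_Un_distrib2)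
  ultimately have Jb2: "(J1 \<union> J2) \<inter> b 2 \<subseteq> s2" unfolding J1 J2 by blast
  have "(s0 \<union> s1 \<union> s2 \<union> s3) \<inter> b 3 \<subseteq> s3"
    using sb[OF s0(1), of 3] sb[OF s1(1), of 3] sb[OF s2(1), of 3] by auto
  moreover have "(e 0 2 \<union> e 2 1 \<union> e 0 3 \<union> e 3 1) \<inter> b 3 \<subseteq> s3"
    using finish'[of 0 3] start'[of 3 1] avoid'[of 0 2 3] avoid'[of 2 1 3] s3(4,5) by (simp add: Int_Un_distrib2)
  ultimately have Jb3: "(J1 \<union> J2) \<inter> b 3 \<subseteq> s3" unfolding J1 J2 by blast
  have "(s0 \<union> s1 \<union> s2 \<union> s3) \<inter> b 4 = {}"
    using sb[OF s0(1), of 4] sb[OF s1(1), of 4] sb[OF s2(1), of 4] sb[OF s3(1), of 4] by auto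
  moreover have "(e 0 2 \<union> e 2 1 \<union> e 0 3 \<union> e 3 1) \<inter> b 4 = {}"
    using avoid'[of 0 2 4] avoid'[of 2 1 4] avoid'[of 0 3 4] avoid'[of 3 1 4] by auto
  ultimately have Jb4: "(J1 \<union> J2) \<inter> b 4 = {}" unfolding J1 J2 by blast
  have "(s0 \<union> s1 \<union> s2 \<union> s3) \<inter> b 5 = {}"
    using sb[OF s0(1), of 5] sb[OF s1(1), of 5] sb[OF s2(1), of 5] sb[OF s3(1), of 5] by auto
  moreover have "(e 0 2 \<union> e 2 1 \<union> e 0 3 \<union> e 3 1) \<inter> b 5 = {}"
    using avoid'[of 0 2 5] avoid'[of 2 1 5] avoid'[of 0 3 5] avoid'[of 3 1 5] by auto
  ultimately have Jb5: "(J1 \<union> J2) \<inter> b 5 = {}" unfolding J1 J2 by blast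
  have eJ: "e i j \<inter> (J1 \<union> J2) \<subseteq> b 0 \<union> b 1 \<union> b 2 \<union> b 3" if "i \<in> {4, 5}" "j < 6" "i \<noteq> j" for i j
  proof -
    have "e i j \<inter> e k l \<subseteq> b 0 \<union> b 1 \<union> b 2 \<union> b 3" if "k < 4" "l < 4" "k \<noteq> l" for k l
    proof -
      have "e i j \<inter> e k l \<subseteq> \<Union> (b ` ({i, j} \<inter> {k, l}))"
        unfolding e_def by (rule cross) (use that \<open>i \<in> {4, 5}\<close> \<open>j < 6\<close> \<open>i \<noteq> j\<close> in \<open>auto simp: doubleton_eq_iff\<close>)
      also have "\<dots> \<subseteq> \<Union> (b ` {k, l})" by auto
      also have "\<dots> \<subseteq> \<Union> (b ` {0, 1, 2, 3})"
        using that by (intro Union_mono image_mono) (auto simp: numeral_eq_Suc less_Suc_eq)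
      finally show ?thesis by auto
    qed
    from this[of 0 2] this[of 2 1] this[of 0 3] this[of 3 1]
    have "e i j \<inter> e 0 2 \<subseteq> b 0 \<union> b 1 \<union> b 2 \<union> b 3" "e i j \<inter> e 2 1 \<subseteq> b 0 \<union> b 1 \<union> b 2 \<union> b 3"
      "e i j \<inter> e 0 3 \<subseteq> b 0 \<union> b 1 \<union> b 2 \<union> b 3" "e i j \<inter> e 3 1 \<subseteq> b 0 \<union> b 1 \<union> b 2 \<union> b 3"
      by simp_all
    then show ?thesis
      using s0(1) s1(1) s2(1) s3(1) unfolding J1 J2 by blast
  qed

  obtain q where q: "q \<in> b 4" using st(1)[of 4 0] by auto
  obtain r where r: "r \<in> b 5" using st(1)[of 5 2] by auto
  have pc_e: "path_connected (b i \<union> e i j \<union> b j)" if "i < 6" "j < 6" "i \<noteq> j" for i j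
  proof -
    have "path_connected (e i j)" using arc[OF that] by (simp add: e_def arc_imp_path path_connected_path_image)
    then have "path_connected (b i \<union> e i j)"
      using st[OF that] b(2)[OF that(1)] by (intro path_connected_Un) auto
    then show ?thesis
      by (rule path_connected_Un[OF _ b(2)[OF that(2)]]) (use st[OF that] in auto)
  qed
  \<comment> \<open>On the way from \<open>w\<close> along the edge into branch set
    \<open>j\<close>, the first point of the curve lies in \<open>s\<close>, since neither
    \<open>b i\<close> nor the edge outside \<open>b j\<close> meets the curve.\<close>
  have hit: thesis
    if ij: "i \<in> {4, 5}" "j < 4" and w: "w \<in> b i" and sJ: "(J1 \<union> J2) \<inter> b j \<subseteq> s" "s \<noteq> {}" "s \<subseteq> (J1 \<union> J2) \<inter> b j"
      and thesis: "\<And>t C. \<lbrakk>connected C; w \<in> C; C \<subseteq> b i \<union> e i j \<union> b j; C \<inter> (J1 \<union> J2) = {}; t \<in> s;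
          t \<in> closure C; compact (insert t C)\<rbrakk> \<Longrightarrow> thesis"
    for i j w s thesis
  proof -
    have wJ: "w \<notin> J1 \<union> J2" using w ij Jb4 Jb5 by auto
    obtain t C where tC: "connected C" "w \<in> C" "C \<subseteq> b i \<union> e i j \<union> b j - (J1 \<union> J2)"
        "t \<in> (b i \<union> e i j \<union> b j) \<inter> (J1 \<union> J2)" "t \<in> closure C" "compact (insert t C)"
      by (rule first_hit[OF pc_e[of i j] clJ _ wJ]) (use ij w sJ in auto)
    have "e i j \<inter> b k \<subseteq> b j" if "k < 4" for k
      using avoid'[of i j k] ij that by (cases "k = j") auto
    from this[of 0] this[of 1] this[of 2] this[of 3]
    have "e i j \<inter> b 0 \<subseteq> b j" "e i j \<inter> b 1 \<subseteq> b j" "e i j \<inter> b 2 \<subseteq> b j" "e i j \<inter> b 3 \<subseteq> b j"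
      by simp_all
    moreover have "i < 6" "j < 6" "i \<noteq> j" using ij by auto
    ultimately have "e i j \<inter> (J1 \<union> J2) \<subseteq> b j"
      using eJ[OF ij(1), of j] by blast
    moreover have "b i \<inter> (J1 \<union> J2) = {}" using ij Jb4 Jb5 by auto
    ultimately have "t \<in> s" using tC(4) sJ(1) by blast
    then show thesis using thesis[of C t] tC by auto
  qed
  obtain t0 C0 where C0: "connected C0" "q \<in> C0" "C0 \<subseteq> b 4 \<union> e 4 0 \<union> b 0" "C0 \<inter> (J1 \<union> J2) = {}" "t0 \<in> s0" "compact (insert t0 C0)" "t0 \<in> closure C0"
    by (rule hit[OF _ _ q Jb0]) (use s0 J1 in auto)
  obtain t1 C1 where C1: "connected C1" "q \<in> C1" "C1 \<subseteq> b 4 \<union> e 4 1 \<union> b 1" "C1 \<inter> (J1 \<union> J2) = {}" "t1 \<in> s1" "compact (insert t1 C1)" "t1 \<in> closure C1"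
    by (rule hit[OF _ _ q Jb1]) (use s1 J1 in auto)
  obtain t2 C2 where C2: "connected C2" "r \<in> C2" "C2 \<subseteq> b 5 \<union> e 5 2 \<union> b 2" "C2 \<inter> (J1 \<union> J2) = {}" "t2 \<in> s2" "t2 \<in> closure C2"
    by (rule hit[OF _ _ r Jb2]) (use s2 J1 in auto)
  obtain t3 C3 where C3: "connected C3" "r \<in> C3" "C3 \<subseteq> b 5 \<union> e 5 3 \<union> b 3" "C3 \<inter> (J1 \<union> J2) = {}" "t3 \<in> s3" "t3 \<in> closure C3"
    by (rule hit[OF _ _ r Jb3]) (use s3 J2 in auto)
  \<comment> \<open>The chord through 4 includes the stretches \<open>s0\<close> and
    \<open>s1\<close>: they contain the points where \<open>J1\<close> and \<open>J2\<close> meet,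
    as \<open>no_crossing_chords\<close> demands of \<open>A\<close>, and these points may differ
    from the hit points \<open>t0\<close> and \<open>t1\<close>.\<close>
  define A where "A = insert t0 C0 \<union> s0 \<union> (insert t1 C1 \<union> s1)"
  have Asub: "A \<subseteq> b 0 \<union> b 1 \<union> b 4 \<union> e 4 0 \<union> e 4 1"
    using C0 C1 s0 s1 unfolding A_def by auto
  have cl: "connected (insert t C)" if "connected C" "t \<in> closure C" for t and C :: "complex set"
    by (rule connected_intermediate_closure[OF that(1)]) (use that closure_subset in auto)
  have A0: "connected (insert t0 C0 \<union> s0)"
    by (rule connected_Un[OF cl[OF C0(1,7)] s0(3)]) (use C0(5) in auto)
  have A1: "connected (insert t1 C1 \<union> s1)"
    by (rule connected_Un[OF cl[OF C1(1,7)] s1(3)]) (use C1(5) in auto)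
  have A_J: "A - (J1 \<union> J2) = C0 \<union> C1"
    using C0 C1 J1 by (auto simp: A_def)
  have B_sub: "C2 \<union> C3 \<subseteq> b 5 \<union> b 2 \<union> b 3 \<union> e 5 2 \<union> e 5 3" using C2 C3 by auto
  have bA: "b k \<inter> A = {}" if "k \<in> {2, 3, 5}" for k
  proof -
    have "b k \<inter> b 0 = {}" "b k \<inter> b 1 = {}" "b k \<inter> b 4 = {}" "e 4 0 \<inter> b k = {}" "e 4 1 \<inter> b k = {}"
      by (rule disj avoid'; use that in auto)+
    then show ?thesis using Asub by blast
  qed
  have eA: "e 5 k \<inter> A = {}" if "k \<in> {2, 3}" for k
  proof -
    have "e 5 k \<inter> b 0 = {}" "e 5 k \<inter> b 1 = {}" "e 5 k \<inter> b 4 = {}" "e 5 k \<inter> e 4 0 = {}" "e 5 k \<inter> e 4 1 = {}"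
      by (rule cross0 avoid'; use that in auto)+
    then show ?thesis using Asub by blast
  qed
  have "(b 2 \<union> b 3 \<union> b 5) \<inter> A = {}" "(e 5 2 \<union> e 5 3) \<inter> A = {}"
    using bA[of 2] bA[of 3] bA[of 5] eA[of 2] eA[of 3] by (simp_all add: Int_Un_distrib2)
  note b23A = this(1) and e5A = this(2)
  have "(C2 \<union> C3) \<inter> A = {}" using B_sub b23A e5A by blast
  show False
  proof (rule no_crossing_chords[OF c cJ])
    show "J1 \<inter> J2 \<subseteq> A" using J12 s0 s1 by (auto simp: A_def)
    show "compact A" unfolding A_def by (rule compact_Un[OF compact_Un[OF C0(6) s0(2)] compact_Un[OF C1(6) s1(2)]])
    show "connected A" unfolding A_def by (rule connected_Un[OF A0 A1]) (use C0(2) C1(2) in auto)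
    show "connected (A - (J1 \<union> J2))" unfolding A_J by (rule connected_Un[OF C0(1) C1(1)]) (use C0(2) C1(2) in auto)
    show "q \<in> A - (J1 \<union> J2)" using A_J C0 by auto
    show "connected (C2 \<union> C3)" by (rule connected_Un[OF C2(1) C3(1)]) (use C2(2) C3(2) in auto)
    show "(C2 \<union> C3) \<inter> (J1 \<union> J2 \<union> A) = {}" using C2(4) C3(4) \<open>(C2 \<union> C3) \<inter> A = {}\<close> by blast
    show "r \<in> C2 \<union> C3" using C2 by auto
    show "t2 \<in> closure (C2 \<union> C3)" "t3 \<in> closure (C2 \<union> C3)" using C2 C3 by auto
    show "t2 \<in> J1 - A" using C2(5) s2(1) b23A J1 by auto
    show "t3 \<in> J2 - A" using C3(5) s3(1) b23A J2 by auto
    \<comment> \<open>The edge between 4 and 5 avoids the curve and so puts both chords on the same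
      side.\<close>
    show "connected (b 4 \<union> e 4 5 \<union> b 5)" using pc_e[of 4 5] by (simp add: path_connected_imp_connected)
    have "e 4 5 \<inter> (J1 \<union> J2) = {}"
      using eJ[of 4 5] avoid'[of 4 5 0] avoid'[of 4 5 1] avoid'[of 4 5 2] avoid'[of 4 5 3] by simp blast
    then show "(b 4 \<union> e 4 5 \<union> b 5) \<inter> (J1 \<union> J2) = {}"
      using Jb4 Jb5 by blast
    show "q \<in> b 4 \<union> e 4 5 \<union> b 5" "r \<in> b 4 \<union> e 4 5 \<union> b 5" using q r by auto
  qed
qed

section \<open>Planar drawings exclude clique minors\<close>

definition adjacency :: "('g, 'w) pre_digraph \<Rightarrow> ('g \<times> 'g) set" where
  "adjacency G = arcs_ends G \<union> (arcs_ends G)\<inverse>"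

lemma sym_adjacency: "sym (adjacency G)"
  by (auto simp: adjacency_def sym_def)

lemma adjacency_iff:
  "(u, v) \<in> adjacency G \<longleftrightarrow> (\<exists>e\<in>arcs G. tail G e = u \<and> head G e = v \<or> tail G e = v \<and> head G e = u)"
  by (auto simp: adjacency_def arcs_ends_conv)

text \<open>The drawing of the subgraph induced by \<open>W\<close>; it serves as a branch set in
  the plane.\<close>

definition drawn :: "('g, 'w) pre_digraph \<Rightarrow> ('g \<Rightarrow> complex) \<Rightarrow> ('w \<Rightarrow> real \<Rightarrow> complex) \<Rightarrow> 'g set \<Rightarrow> complex set" where
  "drawn G pos crv W = pos ` W \<union> (\<Union>e\<in>{e \<in> arcs G. tail G e \<in> W \<and> head G e \<in> W}. path_image (crv e))"

context
  fixes G :: "('g, 'w) pre_digraph" and pos crv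
  assumes drawing: "planar_drawing G pos crv" and fin: "fin_digraph G"
begin

lemma curve:
  assumes "e \<in> arcs G"
  shows "simple_path (crv e)" "path (crv e)" "pathstart (crv e) = pos (tail G e)" "pathfinish (crv e) = pos (head G e)"
    "pos (tail G e) \<in> path_image (crv e)" "pos (head G e) \<in> path_image (crv e)"
    "tail G e \<in> verts G" "head G e \<in> verts G"
proof -
  show *: "simple_path (crv e)" "pathstart (crv e) = pos (tail G e)" "pathfinish (crv e) = pos (head G e)"
    using drawing assms by (auto simp: planar_drawing_def)
  show "path (crv e)" by (rule simple_path_imp_path) fact
  show "pos (tail G e) \<in> path_image (crv e)" "pos (head G e) \<in> path_image (crv e)"
    using pathstart_in_path_image[of "crv e"] pathfinish_in_path_image[of "crv e"] * by auto
  show "tail G e \<in> verts G" "head G e \<in> verts G"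
    using fin assms by (auto simp: fin_digraph_def wf_digraph_def)
qed

lemma pos_inj: "u \<in> verts G \<Longrightarrow> v \<in> verts G \<Longrightarrow> pos u = pos v \<Longrightarrow> u = v"
  using drawing by (auto simp: planar_drawing_def inj_on_def)

lemma vertex_on_curve:
  "e \<in> arcs G \<Longrightarrow> v \<in> verts G \<Longrightarrow> pos v \<in> path_image (crv e) \<Longrightarrow> v \<in> {tail G e, head G e}"
  using drawing unfolding planar_drawing_def by blast

lemma curves_meet:
  "e \<in> arcs G \<Longrightarrow> f \<in> arcs G \<Longrightarrow> e \<noteq> f \<Longrightarrow>
    path_image (crv e) \<inter> path_image (crv f) \<subseteq> pos ` ({tail G e, head G e} \<inter> {tail G f, head G f})"
  using drawing by (simp add: planar_drawing_def)

lemma compact_drawn: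
  assumes "W \<subseteq> verts G"
  shows "compact (drawn G pos crv W)"
proof -
  have "finite W" "finite {e \<in> arcs G. tail G e \<in> W \<and> head G e \<in> W}"
    using assms fin fin_digraph.finite_verts[OF fin] fin_digraph.finite_arcs[OF fin] by (auto intro: finite_subset)
  then show ?thesis
    unfolding drawn_def
    by (intro compact_Un compact_UN) (auto intro: compact_path_image curve finite_imp_compact)
qed

lemma path_connected_drawn:
  assumes "rel_connected (adjacency G) W"
  shows "path_connected (drawn G pos crv W)"
proof -
  let ?D = "drawn G pos crv W"
  have edge: "path_component ?D x y"
    if "e \<in> arcs G" "tail G e \<in> W" "head G e \<in> W" "x \<in> path_image (crv e)" "y \<in> path_image (crv e)" for e x y
  proof (rule path_component_of_subset)
    show "path_image (crv e) \<subseteq> ?D" using that by (auto simp: drawn_def)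
    show "path_component (path_image (crv e)) x y"
      using path_connected_path_image[OF curve(2)[OF that(1)]] that by (simp add: path_connected_component)
  qed
  have verts: "path_component ?D (pos u) (pos v)" if "u \<in> W" "v \<in> W" for u v
    using assms that
  proof (rule rel_connected_induct)
    show "path_component ?D (pos u) (pos u)" using that by (simp add: path_component_refl drawn_def)
    fix v w assume vw: "v \<in> W" "w \<in> W" "(v, w) \<in> adjacency G" "path_component ?D (pos u) (pos v)"
    obtain e where e: "e \<in> arcs G" "tail G e = v \<and> head G e = w \<or> tail G e = w \<and> head G e = v"
      using vw(3) by (auto simp: adjacency_iff)
    have "path_component ?D (pos v) (pos w)"
      by (rule edge[OF e(1)]) (use e(2) vw curve(5,6)[OF e(1)] in auto)
    with vw(4) show "path_component ?D (pos u) (pos w)" by (rule path_component_trans)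
  qed
  have to_vert: "\<exists>u\<in>W. path_component ?D x (pos u)" if "x \<in> ?D" for x
    using that edge curve(5)
    by (fastforce simp: drawn_def intro: path_component_refl)
  show ?thesis
    unfolding path_connected_component
  proof (intro ballI)
    fix x y assume "x \<in> ?D" "y \<in> ?D"
    then obtain u v where "u \<in> W" "path_component ?D x (pos u)" "v \<in> W" "path_component ?D y (pos v)"
      using to_vert by meson
    with verts[of u v] show "path_component ?D x y"
      by (meson path_component_sym path_component_trans)
  qed
qed

text \<open>Distinct curves meet only in common end points, and the curve of \<open>e\<close> is not
  among those drawn for \<open>W\<close>. This one fact yields the start, finish and avoidance
  conditions on the arcs between branch sets.\<close>

lemma curve_Int_drawn:
  assumes e: "e \<in> arcs G" and W: "W \<subseteq> verts G" and out: "\<not> {tail G e, head G e} \<subseteq> W"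
  shows "path_image (crv e) \<inter> drawn G pos crv W = pos ` ({tail G e, head G e} \<inter> W)"
proof
  have "v \<in> {tail G e, head G e}" if "v \<in> W" "pos v \<in> path_image (crv e)" for v
    using vertex_on_curve[OF e] W that by auto
  moreover have "path_image (crv e) \<inter> path_image (crv f) \<subseteq> pos ` ({tail G e, head G e} \<inter> W)"
    if "f \<in> arcs G" "tail G f \<in> W" "head G f \<in> W" for f
  proof -
    have "path_image (crv e) \<inter> path_image (crv f) \<subseteq> pos ` ({tail G e, head G e} \<inter> {tail G f, head G f})"
      by (rule curves_meet) (use e that out in auto)
    also have "\<dots> \<subseteq> pos ` ({tail G e, head G e} \<inter> W)" using that by (intro image_mono) auto
    finally show ?thesis .
  qed
  ultimately show "path_image (crv e) \<inter> drawn G pos crv W \<subseteq> pos ` ({tail G e, head G e} \<inter> W)"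
    unfolding drawn_def by blast
  show "pos ` ({tail G e, head G e} \<inter> W) \<subseteq> path_image (crv e) \<inter> drawn G pos crv W"
    using curve(5,6)[OF e] by (auto simp: drawn_def)
qed

lemma drawn_disjoint:
  assumes "W \<subseteq> verts G" "W' \<subseteq> verts G" "W \<inter> W' = {}"
  shows "drawn G pos crv W \<inter> drawn G pos crv W' = {}"
proof -
  have curves: "path_image (crv e) \<inter> drawn G pos crv W' = {}" if "e \<in> arcs G" "tail G e \<in> W" "head G e \<in> W" for e
    using curve_Int_drawn[of e W'] that assms by auto
  have "pos v \<notin> drawn G pos crv W'" if "v \<in> W" for v
  proof
    assume "pos v \<in> drawn G pos crv W'"
    then consider v' where "v' \<in> W'" "pos v = pos v'"
      | e where "e \<in> arcs G" "tail G e \<in> W'" "head G e \<in> W'" "pos v \<in> path_image (crv e)"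
      by (auto simp: drawn_def)
    then show False
    proof cases
      case 1
      then have "v = v'" using pos_inj[of v v'] that assms by auto
      then show False using 1 that assms by auto
    next
      case 2
      then have "v \<in> {tail G e, head G e}" using vertex_on_curve[of e v] that assms by auto
      then show False using 2 that assms by auto
    qed
  qed
  with curves show ?thesis unfolding drawn_def[of G pos crv W] by blast
qed

lemma no_K6_model:
  assumes model: "clique_model (adjacency G) CC" and sub: "\<Union> CC \<subseteq> verts G" and six: "card CC = 6"
  shows False
proof -
  have finCC: "finite CC" using six card.infinite by fastforce
  obtain W :: "nat \<Rightarrow> 'g set" where W: "bij_betw W {0..<6} CC" using ex_bij_betw_nat_finite[OF finCC] six by auto
  have W_in: "W i \<in> CC" if "i < 6" for i using W that by (auto simp: bij_betw_def)
  have W_ne: "W i \<noteq> W j" if "i < 6" "j < 6" "i \<noteq> j" for i j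
    using W that by (auto simp: bij_betw_def inj_on_def)
  have WV: "W i \<subseteq> verts G" if "i < 6" for i using W_in[OF that] sub by auto
  have Wdisj: "W i \<inter> W j = {}" if "i < 6" "j < 6" "i \<noteq> j" for i j
    using model W_in[OF that(1)] W_in[OF that(2)] W_ne[OF that] by (auto simp: clique_model_def)
  have "\<exists>e\<in>arcs G. tail G e \<in> W i \<and> head G e \<in> W j \<or> tail G e \<in> W j \<and> head G e \<in> W i"
    if "i < 6" "j < 6" "i \<noteq> j" for i j
  proof -
    have "\<exists>u\<in>W i. \<exists>v\<in>W j. (u, v) \<in> adjacency G"
      using model W_in[OF that(1)] W_in[OF that(2)] W_ne[OF that] by (simp add: clique_model_def)
    then show ?thesis by (auto simp: adjacency_iff)
  qed
  then obtain ee where ee: "\<And>i j. i < 6 \<Longrightarrow> j < 6 \<Longrightarrow> i \<noteq> j \<Longrightarrow> ee i j \<in> arcs G"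
    and ends: "\<And>i j. i < 6 \<Longrightarrow> j < 6 \<Longrightarrow> i \<noteq> j \<Longrightarrow> tail G (ee i j) \<in> W i \<and> head G (ee i j) \<in> W j \<or>
      tail G (ee i j) \<in> W j \<and> head G (ee i j) \<in> W i"
    by metis
  \<comment> \<open>An arc of the circuit may point either way between two branch sets; the reversal
    makes \<open>g i j\<close> always start in \<open>W i\<close>.\<close>
  define g where "g i j = (if tail G (ee i j) \<in> W i then crv (ee i j) else reversepath (crv (ee i j)))" for i j
  define b where "b i = drawn G pos crv (W i)" for i
  have img: "path_image (g i j) = path_image (crv (ee i j))" for i j by (simp add: g_def)
  have not_both: "\<not> {tail G (ee i j), head G (ee i j)} \<subseteq> W k" if "i < 6" "j < 6" "k < 6" "i \<noteq> j" for i j k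
  proof
    assume *: "{tail G (ee i j), head G (ee i j)} \<subseteq> W k"
    show False
      using Wdisj[OF that(1,3)] Wdisj[OF that(2,3)] ends[OF that(1,2,4)] * that(4) by (cases "i = k"; cases "j = k") auto
  qed
  have int: "path_image (g i j) \<inter> b k = pos ` ({tail G (ee i j), head G (ee i j)} \<inter> W k)"
    if "i < 6" "j < 6" "k < 6" "i \<noteq> j" for i j k
    unfolding img b_def by (rule curve_Int_drawn[OF ee[OF that(1,2,4)] WV[OF that(3)] not_both[OF that]])
  have sf: "path_image (g i j) \<inter> b i = {pathstart (g i j)} \<and> path_image (g i j) \<inter> b j = {pathfinish (g i j)}"
    if "i < 6" "j < 6" "i \<noteq> j" for i j
    using int[OF that(1,2,1,3)] int[OF that(1,2,2,3)] ends[OF that] Wdisj[OF that] curve(3,4)[OF ee[OF that]]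
    by (auto simp: g_def)
  show False
  proof (rule no_drawing_of_K6[of b g])
    fix i :: nat assume i: "i < 6"
    show "compact (b i)" unfolding b_def by (rule compact_drawn[OF WV[OF i]])
    show "path_connected (b i)" unfolding b_def
      by (rule path_connected_drawn) (use model W_in[OF i] in \<open>auto simp: clique_model_def\<close>)
  next
    fix i j :: nat assume ij: "i < 6" "j < 6" "i \<noteq> j"
    show "b i \<inter> b j = {}" unfolding b_def by (rule drawn_disjoint[OF WV[OF ij(1)] WV[OF ij(2)] Wdisj[OF ij]])
    have ne: "tail G (ee i j) \<noteq> head G (ee i j)" using ends[OF ij] Wdisj[OF ij] by auto
    then have "pos (tail G (ee i j)) \<noteq> pos (head G (ee i j))"
      using pos_inj curve(7,8)[OF ee[OF ij]] by blast
    then have "arc (crv (ee i j))"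
      by (intro simple_path_imp_arc) (use curve(1,3,4)[OF ee[OF ij]] in auto)
    then show "arc (g i j)" by (simp add: g_def arc_reversepath)
    show "path_image (g i j) \<inter> b i = {pathstart (g i j)}" "path_image (g i j) \<inter> b j = {pathfinish (g i j)}"
      using sf[OF ij] by auto
  next
    fix i j k :: nat assume ijk: "i < 6" "j < 6" "k < 6" "i \<noteq> j" "k \<notin> {i, j}"
    then have "W i \<inter> W k = {}" "W j \<inter> W k = {}" using Wdisj by auto
    then show "path_image (g i j) \<inter> b k = {}"
      unfolding int[OF ijk(1-4)] using ends[OF ijk(1,2,4)] by auto
  next
    fix i j k l :: nat
    assume ij: "i < 6" "j < 6" and kl: "k < 6" "l < 6" and ne: "i \<noteq> j" "k \<noteq> l" and "{i, j} \<noteq> {k, l}"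
    let ?e = "ee i j" and ?f = "ee k l"
    have same: "m = m'" if "m < 6" "m' < 6" "v \<in> W m" "v \<in> W m'" for m m' v
      using Wdisj that by blast
    have "?e \<noteq> ?f"
    proof
      assume "?e = ?f"
      then have "{i, j} = {k, l}"
        using ends[OF ij ne(1)] ends[OF kl ne(2)] same ij kl by (metis doubleton_eq_iff)
      then show False using \<open>{i, j} \<noteq> {k, l}\<close> by simp
    qed
    then have "path_image (g i j) \<inter> path_image (g k l) \<subseteq> pos ` ({tail G ?e, head G ?e} \<inter> {tail G ?f, head G ?f})"
      unfolding img by (rule curves_meet[OF ee[OF ij ne(1)] ee[OF kl ne(2)]])
    also have "\<dots> \<subseteq> \<Union> (b ` ({i, j} \<inter> {k, l}))"
    proof
      fix x assume "x \<in> pos ` ({tail G ?e, head G ?e} \<inter> {tail G ?f, head G ?f})"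
      then obtain v where v: "x = pos v" "v \<in> {tail G ?e, head G ?e}" "v \<in> {tail G ?f, head G ?f}" by auto
      obtain m where m: "m \<in> {i, j}" "v \<in> W m" using v(2) ends[OF ij ne(1)] by auto
      obtain m' where m': "m' \<in> {k, l}" "v \<in> W m'" using v(3) ends[OF kl ne(2)] by auto
      have "m = m'" using same[of m m' v] m m' ij kl by auto
      moreover have "x \<in> b m" using v(1) m(2) by (auto simp: b_def drawn_def)
      ultimately show "x \<in> \<Union> (b ` ({i, j} \<inter> {k, l}))" using m m' by auto
    qed
    finally show "path_image (g i j) \<inter> path_image (g k l) \<subseteq> \<Union> (b ` ({i, j} \<inter> {k, l}))" .
  qed
qed

end

section \<open>The ring of multivariate polynomials\<close>

lemma finite_submultisets: "finite {k. k \<subseteq># m}"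
proof (rule finite_subset)
  show "{k. k \<subseteq># m} \<subseteq> mset ` {xs. set xs \<subseteq> set_mset m \<and> length xs \<le> size m}"
  proof clarify
    fix k assume k: "k \<subseteq># m"
    obtain xs where "mset xs = k" using ex_mset by blast
    with k show "k \<in> mset ` {xs. set xs \<subseteq> set_mset m \<and> length xs \<le> size m}"
      by (auto intro!: image_eqI[of _ _ xs] dest: mset_subset_eqD size_mset_mono)
  qed
qed (intro finite_imageI finite_lists_length_le, simp)

lemma submultisets_empty: "{k. k \<subseteq># {#}} = {{#}}"
  by auto

lemma submultisets_single: "{k. k \<subseteq># {#z#}} = {{#}, {#z#}}"
proof -
  have "k = {#} \<or> k = {#z#}" if "k \<subseteq># {#z#}" for k
    using that by (cases k) (auto simp: subset_mset.le_iff_add add_eq_conv_ex dest: multi_member_split)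
  then show ?thesis by auto
qed

lemma submultisets_pair: "{k. k \<subseteq># {#a, b#}} = {{#}, {#a#}, {#b#}, {#a, b#}}"
proof -
  have "k \<in> {{#}, {#a#}, {#b#}, {#a, b#}}" if k: "k \<subseteq># {#a, b#}" for k
  proof -
    obtain l where l: "{#a, b#} = k + l" using k unfolding mset_subset_eq_exists_conv by blast
    have "size k + size l = 2" using arg_cong[OF l, of size] by simp
    then have "size k = 0 \<or> size k = 1 \<or> size k = 2" by arith
    then consider "k = {#}" | c where "k = {#c#}" | "size k = 2"
      using size_1_singleton_mset[of k] by auto
    then show ?thesis
    proof cases
      case 2
      then have "c \<in># {#a, b#}" using l by simp
      then show ?thesis using 2 by auto
    next
      case 3
      then have "size l = 0" using arg_cong[OF l, of size] by simp
      then show ?thesis using l by simp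
    qed simp
  qed
  then have "{k. k \<subseteq># {#a, b#}} \<subseteq> {{#}, {#a#}, {#b#}, {#a, b#}}" by blast
  moreover have "{{#}, {#a#}, {#b#}, {#a, b#}} \<subseteq> {k. k \<subseteq># {#a, b#}}"
    by (auto simp: mset_subset_eq_single)
  ultimately show ?thesis by (rule equalityI)
qed

section \<open>Closure, associativity and commutativity of the convolution product\<close>

context ring
begin

lemma mpoly_simps:
  "carrier mpoly_ring = indexed_pset UNIV (carrier R)" "mult mpoly_ring = indexed_times"
  "one mpoly_ring = indexed_const \<one>" "zero mpoly_ring = indexed_const \<zero>" "add mpoly_ring = indexed_padd"
  by (simp_all add: mpoly_ring_def)

lemma coeff_closed: "P \<in> carrier mpoly_ring \<Longrightarrow> P m \<in> carrier R"
  using indexed_pset_in_carrier[of "carrier R" P UNIV] by (auto simp: mpoly_simps carrier_coeff_def)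

text \<open>Polynomials are generated by constants, sums and multiplication by a variable. This
  lemma and the next two evaluate a product whose left factor is so built, so that closure and
  associativity follow by induction on that factor, without double convolutions.\<close>

lemma indexed_times_const_left:
  assumes "a \<in> carrier R" "\<And>m. Q m \<in> carrier R"
  shows "indexed_times (indexed_const a) Q = (\<lambda>m. a \<otimes> Q m)"
proof
  fix m
  have "(\<Oplus>k\<in>{k. k \<subseteq># m}. indexed_const a k \<otimes> Q (m - k)) = (\<Oplus>k\<in>{k. k \<subseteq># m}. if {#} = k then a \<otimes> Q (m - k) else \<zero>)"
    using assms by (intro finsum_cong') (auto simp: indexed_const_def)
  also have "\<dots> = a \<otimes> Q m"
    using assms by (subst finsum_singleton) (auto simp: finite_submultisets)
  finally show "indexed_times (indexed_const a) Q m = a \<otimes> Q m" by (simp add: indexed_times_def)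
qed

lemma indexed_times_padd_left:
  assumes "\<And>m. P m \<in> carrier R" "\<And>m. P' m \<in> carrier R" "\<And>m. Q m \<in> carrier R"
  shows "indexed_times (indexed_padd P P') Q = indexed_padd (indexed_times P Q) (indexed_times P' Q)"
proof
  fix m
  show "indexed_times (indexed_padd P P') Q m = indexed_padd (indexed_times P Q) (indexed_times P' Q) m"
    using assms by (simp add: indexed_times_def indexed_padd_def l_distr Pi_def finsum_addf)
qed

lemma indexed_times_pmult_left:
  assumes "\<And>m. P m \<in> carrier R" "\<And>m. Q m \<in> carrier R"
  shows "indexed_times (indexed_pmult P i) Q = indexed_pmult (indexed_times P Q) i"
proof
  fix m
  let ?f = "\<lambda>k. indexed_pmult P i k \<otimes> Q (m - k)"
  have cl: "?f k \<in> carrier R" for k using assms by (auto simp: indexed_pmult_def)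
  have "(\<Oplus>k\<in>{k. k \<subseteq># m}. ?f k) = (\<Oplus>k\<in>{k. k \<subseteq># m \<and> i \<in># k}. ?f k)"
    using assms cl by (intro add.finprod_mono_neutral_cong_right) (auto simp: finite_submultisets indexed_pmult_def)
  also have "\<dots> = indexed_pmult (indexed_times P Q) i m"
  proof (cases "i \<in># m")
    case False
    then have "{k. k \<subseteq># m \<and> i \<in># k} = {}" by (auto dest: mset_subset_eqD)
    then show ?thesis using False by (simp only: finsum_empty) (simp add: indexed_pmult_def)
  next
    case True
    define n where "n = m - {#i#}"
    have m: "m = add_mset i n" using True by (simp add: n_def)
    have "{k. k \<subseteq># m \<and> i \<in># k} = add_mset i ` {k. k \<subseteq># n}"
    proof (intro equalityI subsetI)
      fix k assume "k \<in> {k. k \<subseteq># m \<and> i \<in># k}"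
      then have "k = add_mset i (k - {#i#})" "k - {#i#} \<subseteq># n"
        by (auto simp: m) (metis insert_DiffM mset_subset_eq_add_mset_cancel)
      then show "k \<in> add_mset i ` {k. k \<subseteq># n}" by blast
    qed (auto simp: m)
    then have "(\<Oplus>k\<in>{k. k \<subseteq># m \<and> i \<in># k}. ?f k) = (\<Oplus>k\<in>{k. k \<subseteq># n}. ?f (add_mset i k))"
      using cl by (simp add: finsum_reindex inj_on_def Pi_def)
    also have "\<dots> = (\<Oplus>k\<in>{k. k \<subseteq># n}. P k \<otimes> Q (n - k))"
      by (intro finsum_cong') (use assms in \<open>auto simp: indexed_pmult_def m\<close>)
    finally show ?thesis using True by (simp add: indexed_pmult_def indexed_times_def n_def)
  qed
  finally show "indexed_times (indexed_pmult P i) Q m = indexed_pmult (indexed_times P Q) i m"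
    by (simp add: indexed_times_def)
qed

lemma coeffs_closed:
  "P \<in> indexed_pset UNIV (carrier R) \<Longrightarrow> P m \<in> carrier R"
  using coeff_closed by (simp add: mpoly_simps)

lemma indexed_scale_closed:
  fixes P :: "'c multiset \<Rightarrow> 'a"
  assumes "a \<in> carrier R" "P \<in> indexed_pset UNIV (carrier R)"
  shows "(\<lambda>m. a \<otimes> P m) \<in> indexed_pset UNIV (carrier R)"
  using assms(2)
proof (induction rule: indexed_pset.induct)
  case (indexed_const k)
  have "(\<lambda>m::'c multiset. a \<otimes> indexed_const k m) = indexed_const (a \<otimes> k)"
    using assms(1) by (auto simp: indexed_const_def)
  then show ?case using indexed_const assms(1) by (simp add: indexed_pset.indexed_const)
next
  case (indexed_padd P Q)
  have "(\<lambda>m. a \<otimes> indexed_padd P Q m) = indexed_padd (\<lambda>m. a \<otimes> P m) (\<lambda>m. a \<otimes> Q m)"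
    using assms(1) coeffs_closed[OF indexed_padd(1)] coeffs_closed[OF indexed_padd(2)] by (auto simp: indexed_padd_def r_distr)
  then show ?case using indexed_padd by (simp add: indexed_pset.indexed_padd)
next
  case (indexed_pmult P i)
  have "(\<lambda>m. a \<otimes> indexed_pmult P i m) = indexed_pmult (\<lambda>m. a \<otimes> P m) i"
    using assms(1) by (auto simp: indexed_pmult_def)
  then show ?case using indexed_pmult by (simp add: indexed_pset.indexed_pmult)
qed

lemma indexed_times_closed:
  assumes "P \<in> indexed_pset UNIV (carrier R)" "Q \<in> indexed_pset UNIV (carrier R)"
  shows "indexed_times P Q \<in> indexed_pset UNIV (carrier R)"
  using assms(1)
proof (induction rule: indexed_pset.induct)
  case (indexed_const k)
  then show ?case
    using indexed_scale_closed[OF _ assms(2)] by (simp add: indexed_times_const_left coeffs_closed[OF assms(2)])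
next
  case (indexed_padd P P')
  then show ?case
    using coeffs_closed[OF assms(2)] coeffs_closed[OF indexed_padd(1)] coeffs_closed[OF indexed_padd(2)]
    by (simp add: indexed_times_padd_left indexed_pset.indexed_padd)
next
  case (indexed_pmult P i)
  then show ?case
    using coeffs_closed[OF assms(2)] coeffs_closed[OF indexed_pmult(1)]
    by (simp add: indexed_times_pmult_left indexed_pset.indexed_pmult)
qed

lemma indexed_times_assoc:
  assumes "P \<in> indexed_pset UNIV (carrier R)" "Q \<in> indexed_pset UNIV (carrier R)" "S \<in> indexed_pset UNIV (carrier R)"
  shows "indexed_times (indexed_times P Q) S = indexed_times P (indexed_times Q S)"
proof -
  have QS: "\<And>m. Q m \<in> carrier R" "\<And>m. S m \<in> carrier R" "\<And>m. indexed_times Q S m \<in> carrier R"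
    using assms coeffs_closed indexed_times_closed by blast+
  show ?thesis
    using assms(1)
  proof (induction rule: indexed_pset.induct)
    case (indexed_const k)
    have "indexed_times (\<lambda>m. k \<otimes> Q m) S = (\<lambda>m. k \<otimes> indexed_times Q S m)"
      using indexed_const QS by (auto simp: indexed_times_def m_assoc finsum_rdistr finite_submultisets Pi_def)
    then show ?case using indexed_const QS by (simp add: indexed_times_const_left)
  next
    case (indexed_padd P P')
    then show ?case
      using QS coeffs_closed[OF indexed_padd(1)] coeffs_closed[OF indexed_padd(2)]
        coeffs_closed[OF indexed_times_closed[OF indexed_padd(1) assms(2)]]
        coeffs_closed[OF indexed_times_closed[OF indexed_padd(2) assms(2)]]
      by (simp add: indexed_times_padd_left)
  next
    case (indexed_pmult P i)
    then show ?case
      using QS coeffs_closed[OF indexed_pmult(1)] coeffs_closed[OF indexed_times_closed[OF indexed_pmult(1) assms(2)]]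
      by (simp add: indexed_times_pmult_left)
  qed
qed

lemma abelian_monoid_mpoly: "abelian_monoid mpoly_ring"
proof (rule abelian_monoidI)
  fix P Q S :: "'c multiset \<Rightarrow> 'a"
  assume P: "P \<in> carrier mpoly_ring" and Q: "Q \<in> carrier mpoly_ring"
  show "P \<oplus>\<^bsub>mpoly_ring\<^esub> Q \<in> carrier mpoly_ring"
    using P Q by (simp add: mpoly_simps indexed_pset.indexed_padd)
  show "P \<oplus>\<^bsub>mpoly_ring\<^esub> Q = Q \<oplus>\<^bsub>mpoly_ring\<^esub> P"
    using coeff_closed[OF P] coeff_closed[OF Q] by (auto simp: mpoly_simps indexed_padd_def a_comm)
  assume S: "S \<in> carrier mpoly_ring"
  show "P \<oplus>\<^bsub>mpoly_ring\<^esub> Q \<oplus>\<^bsub>mpoly_ring\<^esub> S = P \<oplus>\<^bsub>mpoly_ring\<^esub> (Q \<oplus>\<^bsub>mpoly_ring\<^esub> S)"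
    using coeff_closed[OF P] coeff_closed[OF Q] coeff_closed[OF S]
    by (auto simp: mpoly_simps indexed_padd_def a_assoc)
next
  fix P :: "'c multiset \<Rightarrow> 'a" assume P: "P \<in> carrier mpoly_ring"
  show "\<zero>\<^bsub>mpoly_ring\<^esub> \<oplus>\<^bsub>mpoly_ring\<^esub> P = P"
    using coeff_closed[OF P] by (auto simp: mpoly_simps indexed_padd_def indexed_const_def)
qed (simp add: mpoly_simps indexed_pset.indexed_const)

lemma coeff_finsum:
  assumes "finite A" "\<And>e. e \<in> A \<Longrightarrow> f e \<in> carrier mpoly_ring"
  shows "(\<Oplus>\<^bsub>mpoly_ring\<^esub>e\<in>A. f e) m = (\<Oplus>e\<in>A. f e m)"
proof -
  interpret mp: abelian_monoid mpoly_ring by (rule abelian_monoid_mpoly)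
  show ?thesis
    using assms
  proof (induction A rule: finite_induct)
    case empty
    then show ?case by (simp add: mpoly_simps indexed_const_def)
  next
    case (insert a A)
    have c: "\<And>e. e \<in> insert a A \<Longrightarrow> f e m \<in> carrier R" using insert(4) coeff_closed by blast
    have "(\<Oplus>\<^bsub>mpoly_ring\<^esub>e\<in>insert a A. f e) m = (f a \<oplus>\<^bsub>mpoly_ring\<^esub> (\<Oplus>\<^bsub>mpoly_ring\<^esub>e\<in>A. f e)) m"
      using insert by (subst mp.finsum_insert) auto
    also have "\<dots> = f a m \<oplus> (\<Oplus>e\<in>A. f e m)"
      using insert by (simp add: mpoly_simps indexed_padd_def)
    also have "\<dots> = (\<Oplus>e\<in>insert a A. f e m)"
      using insert c by (subst finsum_insert) auto
    finally show ?case .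
  qed
qed

end

text \<open>The substitution of \<open>m - k\<close> for \<open>k\<close> is an involution on the
  sub-multisets of \<open>m\<close> and exchanges the factors.\<close>

lemma (in cring) indexed_times_commute:
  fixes P Q :: "'c multiset \<Rightarrow> 'a"
  assumes "\<And>m. P m \<in> carrier R" "\<And>m. Q m \<in> carrier R"
  shows "indexed_times P Q = indexed_times Q P"
proof
  fix m :: "'c multiset"
  have "bij_betw (\<lambda>k. m - k) {k. k \<subseteq># m} {k. k \<subseteq># m}"
    by (rule bij_betw_byWitness[where f'="\<lambda>k. m - k"]) (auto simp: subset_mset.diff_diff_right)
  then have "(\<lambda>k. m - k) ` {k. k \<subseteq># m} = {k. k \<subseteq># m}" "inj_on (\<lambda>k. m - k) {k. k \<subseteq># m}"
    by (auto simp: bij_betw_def)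
  then have "(\<Oplus>k\<in>{k. k \<subseteq># m}. P k \<otimes> Q (m - k)) = (\<Oplus>k\<in>{k. k \<subseteq># m}. P (m - k) \<otimes> Q (m - (m - k)))"
    using finsum_reindex[of "\<lambda>k. P k \<otimes> Q (m - k)" "\<lambda>k. m - k" "{k. k \<subseteq># m}"] assms by (simp add: Pi_def)
  also have "\<dots> = (\<Oplus>k\<in>{k. k \<subseteq># m}. Q k \<otimes> P (m - k))"
    using assms by (intro finsum_cong') (auto simp: subset_mset.diff_diff_right m_comm)
  finally show "indexed_times P Q m = indexed_times Q P m"
    by (simp add: indexed_times_def)
qed

lemma (in cring) comm_monoid_mpoly: "comm_monoid mpoly_ring"
proof (rule comm_monoidI)
  fix P Q S :: "'c multiset \<Rightarrow> 'a"
  assume P: "P \<in> carrier mpoly_ring" and Q: "Q \<in> carrier mpoly_ring"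
  show "P \<otimes>\<^bsub>mpoly_ring\<^esub> Q \<in> carrier mpoly_ring"
    using P Q indexed_times_closed by (simp add: mpoly_simps)
  show "P \<otimes>\<^bsub>mpoly_ring\<^esub> Q = Q \<otimes>\<^bsub>mpoly_ring\<^esub> P"
    using indexed_times_commute[OF coeff_closed[OF P] coeff_closed[OF Q]] by (simp add: mpoly_simps)
  assume S: "S \<in> carrier mpoly_ring"
  show "P \<otimes>\<^bsub>mpoly_ring\<^esub> Q \<otimes>\<^bsub>mpoly_ring\<^esub> S = P \<otimes>\<^bsub>mpoly_ring\<^esub> (Q \<otimes>\<^bsub>mpoly_ring\<^esub> S)"
    using P Q S indexed_times_assoc by (simp add: mpoly_simps)
next
  fix P :: "'c multiset \<Rightarrow> 'a" assume P: "P \<in> carrier mpoly_ring"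
  show "\<one>\<^bsub>mpoly_ring\<^esub> \<otimes>\<^bsub>mpoly_ring\<^esub> P = P"
    using P indexed_times_const_left[OF one_closed coeff_closed[OF P]] coeff_closed[OF P] by (simp add: mpoly_simps)
qed (simp add: mpoly_simps indexed_pset.indexed_const)

section \<open>Coefficients of degree at most two\<close>

context ring
begin

lemma coeff_times_empty:
  assumes "P \<in> carrier mpoly_ring" "Q \<in> carrier mpoly_ring"
  shows "(P \<otimes>\<^bsub>mpoly_ring\<^esub> Q) {#} = P {#} \<otimes> Q {#}"
  using coeff_closed[OF assms(1)] coeff_closed[OF assms(2)]
  by (simp add: mpoly_simps(2) indexed_times_def submultisets_empty)

lemma coeff_times_single:
  assumes "P \<in> carrier mpoly_ring" "Q \<in> carrier mpoly_ring"
  shows "(P \<otimes>\<^bsub>mpoly_ring\<^esub> Q) {#z#} = P {#} \<otimes> Q {#z#} \<oplus> P {#z#} \<otimes> Q {#}"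
  using coeff_closed[OF assms(1)] coeff_closed[OF assms(2)]
  by (simp add: mpoly_simps(2) indexed_times_def submultisets_single Pi_def)

text \<open>For \<open>a \<noteq> b\<close> the monomial has four distinct divisors; for
  \<open>a = b\<close> the middle two would coincide. The two middle terms, outer products of linear
  parts, are the ones the rank argument has to control.\<close>

lemma coeff_times_pair:
  assumes "P \<in> carrier mpoly_ring" "Q \<in> carrier mpoly_ring" "a \<noteq> b"
  shows "(P \<otimes>\<^bsub>mpoly_ring\<^esub> Q) {#a, b#} =
    P {#} \<otimes> Q {#a, b#} \<oplus> (P {#a#} \<otimes> Q {#b#} \<oplus> (P {#b#} \<otimes> Q {#a#} \<oplus> P {#a, b#} \<otimes> Q {#}))"
  using coeff_closed[OF assms(1)] coeff_closed[OF assms(2)] assms(3)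
  by (simp add: mpoly_simps(2) indexed_times_def submultisets_pair Pi_def add_mset_commute[of b a] add_eq_conv_ex)

lemma coeff_var: "indexed_var z m = (if m = {#z#} then \<one> else \<zero>)"
  by (auto simp: indexed_var_def indexed_pmult_def indexed_const_def dest: multi_member_split)

lemma coeff_const: "indexed_const a m = (if m = {#} then a else \<zero>)"
  by (simp add: indexed_const_def)

lemma indexed_var_closed: "indexed_var z \<in> carrier mpoly_ring"
  by (simp add: mpoly_simps indexed_var_def indexed_pset.intros)

lemma indexed_const_closed: "a \<in> carrier R \<Longrightarrow> indexed_const a \<in> carrier mpoly_ring"
  by (simp add: mpoly_simps indexed_pset.intros)

end

text \<open>Recovers \<open>M\<close> from the polynomial: as all variables are distinct, only one
  summand contains the monomial. This is all that the rank argument learns about the bilinear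
  form.\<close>

lemma (in cring) coeff_bilinear_form:
  assumes M: "M \<in> {..<n} \<rightarrow> {..<n} \<rightarrow> carrier R"
    and x: "inj_on x {..<n}" and y: "inj_on y {..<n}" and xy: "x ` {..<n} \<inter> y ` {..<n} = {}"
    and i: "i < n" and j: "j < n"
  shows "bilinear_form n y M x {#y i, x j#} = M i j"
proof -
  interpret mp: abelian_monoid mpoly_ring by (rule abelian_monoid_mpoly)
  interpret mc: comm_monoid mpoly_ring by (rule comm_monoid_mpoly)
  let ?t = "\<lambda>i j. indexed_var (y i) \<otimes>\<^bsub>mpoly_ring\<^esub> indexed_const (M i j) \<otimes>\<^bsub>mpoly_ring\<^esub> indexed_var (x j)"
  have Mc: "M i j \<in> carrier R" if "i < n" "j < n" for i j using M that by auto
  have t: "?t i' j' \<in> carrier mpoly_ring" if "i' < n" "j' < n" for i' j'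
    using Mc[OF that] by (intro mc.m_closed indexed_var_closed indexed_const_closed)
  have tc: "?t i' j' {#y i, x j#} = (if i = i' \<and> j = j' then M i' j' else \<zero>)" if ij: "i' < n" "j' < n" for i' j'
  proof -
    have ne: "y i \<noteq> x j" using xy i j by auto
    have ne': "y i \<noteq> x j'" "y i' \<noteq> x j" using xy i j ij by auto
    have yi: "y i = y i' \<longleftrightarrow> i = i'" and xj: "x j = x j' \<longleftrightarrow> j = j'"
      using x y i j ij by (auto simp: inj_on_eq_iff)
    have c: "indexed_var (y i') \<otimes>\<^bsub>mpoly_ring\<^esub> indexed_const (M i' j') \<in> carrier mpoly_ring"
      using Mc[OF ij] by (intro mc.m_closed indexed_var_closed indexed_const_closed)
    show ?thesis
      using Mc[OF ij] ne ne' yi xj coeff_closed[OF c]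
      by (simp add: coeff_times_pair[OF c indexed_var_closed ne] coeff_times_empty[OF indexed_var_closed indexed_const_closed[OF Mc[OF ij]]]
          coeff_times_single[OF indexed_var_closed indexed_const_closed[OF Mc[OF ij]]] coeff_var coeff_const)
  qed
  have row: "(\<Oplus>\<^bsub>mpoly_ring\<^esub>j'\<in>{..<n}. ?t i' j') {#y i, x j#} = (\<Oplus>j'\<in>{..<n}. ?t i' j' {#y i, x j#})"
    if "i' < n" for i'
    by (rule coeff_finsum) (use t that in auto)
  have "bilinear_form n y M x {#y i, x j#} = (\<Oplus>i'\<in>{..<n}. (\<Oplus>\<^bsub>mpoly_ring\<^esub>j'\<in>{..<n}. ?t i' j') {#y i, x j#})"
    unfolding bilinear_form_def by (rule coeff_finsum) (use t in \<open>auto intro!: mp.finsum_closed\<close>)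
  also have "\<dots> = (\<Oplus>i'\<in>{..<n}. \<Oplus>j'\<in>{..<n}. ?t i' j' {#y i, x j#})"
  proof (rule finsum_cong')
    show "(\<lambda>i'. \<Oplus>j'\<in>{..<n}. ?t i' j' {#y i, x j#}) \<in> {..<n} \<rightarrow> carrier R"
      using Mc by (auto simp: tc intro!: finsum_closed)
  qed (use row in auto)
  also have "\<dots> = (\<Oplus>i'\<in>{..<n}. if i = i' then M i' j else \<zero>)"
  proof (rule finsum_cong')
    fix i' assume i': "i' \<in> {..<n}"
    have "(\<Oplus>j'\<in>{..<n}. ?t i' j' {#y i, x j#}) = (\<Oplus>j'\<in>{..<n}. if j = j' then (if i = i' then M i' j' else \<zero>) else \<zero>)"
      using i' Mc by (intro finsum_cong') (auto simp: tc)
    also have "\<dots> = (if i = i' then M i' j else \<zero>)"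
      using i' j Mc by (subst finsum_singleton) auto
    finally show "(\<Oplus>j'\<in>{..<n}. ?t i' j' {#y i, x j#}) = (if i = i' then M i' j else \<zero>)" .
  qed (use Mc j in auto)
  also have "\<dots> = M i j" using i j Mc by (subst finsum_singleton) auto
  finally show ?thesis .
qed

section \<open>Matrices of low rank\<close>

lemma (in abelian_monoid) finsum_swap:
  assumes "finite A" "finite B" "\<And>i j. i \<in> A \<Longrightarrow> j \<in> B \<Longrightarrow> f i j \<in> carrier G"
  shows "(\<Oplus>i\<in>A. \<Oplus>j\<in>B. f i j) = (\<Oplus>j\<in>B. \<Oplus>i\<in>A. f i j)"
  using assms(1,3)
proof (induction A rule: finite_induct)
  case (insert a A)
  have "(\<Oplus>i\<in>insert a A. \<Oplus>j\<in>B. f i j) = (\<Oplus>j\<in>B. f a j) \<oplus> (\<Oplus>j\<in>B. \<Oplus>i\<in>A. f i j)"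
    using insert by (subst finsum_insert) auto
  also have "\<dots> = (\<Oplus>j\<in>B. f a j \<oplus> (\<Oplus>i\<in>A. f i j))"
    using insert by (subst finsum_addf) auto
  also have "\<dots> = (\<Oplus>j\<in>B. \<Oplus>i\<in>insert a A. f i j)"
    using insert by (intro finsum_cong') auto
  finally show ?case .
qed auto

text \<open>A vector is a function whose values outside \<open>D\<close> are disregarded. The
  generators form an indexed family, so that \<open>card T\<close> counts them even with
  repetitions.\<close>

definition (in ring) span_on :: "'i set \<Rightarrow> 't set \<Rightarrow> ('t \<Rightarrow> 'i \<Rightarrow> 'a) \<Rightarrow> ('i \<Rightarrow> 'a) \<Rightarrow> bool" where
  "span_on D T e v \<longleftrightarrow> (\<exists>c \<in> T \<rightarrow> carrier R. \<forall>i\<in>D. v i = (\<Oplus>t\<in>T. c t \<otimes> e t i))"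

context cring
begin

context
  fixes D :: "'i set" and T :: "'t set" and e :: "'t \<Rightarrow> 'i \<Rightarrow> 'a"
  assumes fin: "finite T" and e: "\<And>t i. t \<in> T \<Longrightarrow> i \<in> D \<Longrightarrow> e t i \<in> carrier R"
begin

lemma span_on_zero: "span_on D T e (\<lambda>i. \<zero>)"
  unfolding span_on_def
  by (rule bexI[of _ "\<lambda>t. \<zero>"]) (use e in \<open>auto intro!: add.finprod_one_eqI[symmetric]\<close>)

lemma span_on_add:
  assumes "span_on D T e u" "span_on D T e v"
  shows "span_on D T e (\<lambda>i. u i \<oplus> v i)"
proof -
  obtain c d where c: "c \<in> T \<rightarrow> carrier R" "\<forall>i\<in>D. u i = (\<Oplus>t\<in>T. c t \<otimes> e t i)"
    and d: "d \<in> T \<rightarrow> carrier R" "\<forall>i\<in>D. v i = (\<Oplus>t\<in>T. d t \<otimes> e t i)"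
    using assms by (auto simp: span_on_def)
  have "u i \<oplus> v i = (\<Oplus>t\<in>T. (c t \<oplus> d t) \<otimes> e t i)" if i: "i \<in> D" for i
  proof -
    have "u i \<oplus> v i = (\<Oplus>t\<in>T. c t \<otimes> e t i \<oplus> d t \<otimes> e t i)"
      using c d i e by (subst finsum_addf) auto
    also have "\<dots> = (\<Oplus>t\<in>T. (c t \<oplus> d t) \<otimes> e t i)"
      by (intro finsum_cong') (use c d i e in \<open>auto simp: l_distr Pi_def\<close>)
    finally show ?thesis .
  qed
  then show ?thesis
    unfolding span_on_def by (intro bexI[of _ "\<lambda>t. c t \<oplus> d t"]) (use c d in auto)
qed

lemma span_on_scale:
  assumes "span_on D T e u" "a \<in> carrier R"
  shows "span_on D T e (\<lambda>i. a \<otimes> u i)"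
proof -
  obtain c where c: "c \<in> T \<rightarrow> carrier R" "\<forall>i\<in>D. u i = (\<Oplus>t\<in>T. c t \<otimes> e t i)"
    using assms by (auto simp: span_on_def)
  have "a \<otimes> u i = (\<Oplus>t\<in>T. (a \<otimes> c t) \<otimes> e t i)" if i: "i \<in> D" for i
  proof -
    have "a \<otimes> u i = (\<Oplus>t\<in>T. a \<otimes> (c t \<otimes> e t i))"
      using c i e assms(2) fin by (subst finsum_rdistr[symmetric]) auto
    also have "\<dots> = (\<Oplus>t\<in>T. (a \<otimes> c t) \<otimes> e t i)"
      by (intro finsum_cong') (use c i e assms(2) in \<open>auto simp: m_assoc Pi_def\<close>)
    finally show ?thesis .
  qed
  then show ?thesis
    unfolding span_on_def by (intro bexI[of _ "\<lambda>t. a \<otimes> c t"]) (use c assms(2) in auto)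
qed

lemma span_on_member:
  assumes "s \<in> T" "\<And>i. i \<in> D \<Longrightarrow> v i = e s i"
  shows "span_on D T e v"
  unfolding span_on_def
proof (intro bexI[of _ "\<lambda>t. if s = t then \<one> else \<zero>"] ballI)
  fix i assume i: "i \<in> D"
  have "(\<Oplus>t\<in>T. (if s = t then \<one> else \<zero>) \<otimes> e t i) = (\<Oplus>t\<in>T. if s = t then e t i else \<zero>)"
    by (intro finsum_cong') (use e i in auto)
  also have "\<dots> = e s i" using assms(1) fin e i by (subst finsum_singleton) auto
  finally show "v i = (\<Oplus>t\<in>T. (if s = t then \<one> else \<zero>) \<otimes> e t i)" using assms(2)[OF i] by simp
qed auto

lemma span_on_closed: "span_on D T e v \<Longrightarrow> i \<in> D \<Longrightarrow> v i \<in> carrier R"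
  using e by (auto simp: span_on_def Pi_iff intro!: finsum_closed m_closed)

lemma span_on_annihilated:
  assumes v: "span_on D T e v" and D: "finite D" and u: "u \<in> D \<rightarrow> carrier R"
    and ann: "\<And>t. t \<in> T \<Longrightarrow> (\<Oplus>i\<in>D. u i \<otimes> e t i) = \<zero>"
  shows "(\<Oplus>i\<in>D. u i \<otimes> v i) = \<zero>"
proof -
  obtain c where c: "c \<in> T \<rightarrow> carrier R" "\<forall>i\<in>D. v i = (\<Oplus>t\<in>T. c t \<otimes> e t i)"
    using v by (auto simp: span_on_def)
  have "(\<Oplus>i\<in>D. u i \<otimes> v i) = (\<Oplus>i\<in>D. \<Oplus>t\<in>T. c t \<otimes> (u i \<otimes> e t i))"
  proof (intro finsum_cong')
    fix i assume i: "i \<in> D"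
    have "u i \<otimes> v i = (\<Oplus>t\<in>T. u i \<otimes> (c t \<otimes> e t i))"
      using c i e u fin by (subst finsum_rdistr[symmetric]) auto
    also have "\<dots> = (\<Oplus>t\<in>T. c t \<otimes> (u i \<otimes> e t i))"
      by (intro finsum_cong') (use c i e u in \<open>auto simp: m_lcomm Pi_def\<close>)
    finally show "u i \<otimes> v i = (\<Oplus>t\<in>T. c t \<otimes> (u i \<otimes> e t i))" .
  qed (use c e u in \<open>auto simp: Pi_def intro!: finsum_closed\<close>)
  also have "\<dots> = (\<Oplus>t\<in>T. \<Oplus>i\<in>D. c t \<otimes> (u i \<otimes> e t i))"
    by (rule finsum_swap) (use c e u D fin in \<open>auto simp: Pi_iff intro!: m_closed\<close>)
  also have "\<dots> = (\<Oplus>t\<in>T. \<zero>)"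
  proof (intro finsum_cong')
    fix t assume t: "t \<in> T"
    have "(\<Oplus>i\<in>D. c t \<otimes> (u i \<otimes> e t i)) = c t \<otimes> (\<Oplus>i\<in>D. u i \<otimes> e t i)"
      using c e u D t by (subst finsum_rdistr) auto
    then show "(\<Oplus>i\<in>D. c t \<otimes> (u i \<otimes> e t i)) = \<zero>" using ann[OF t] c t by (auto simp: Pi_iff)
  qed auto
  finally show ?thesis by (simp add: finsum_zero)
qed

end

end

text \<open>Gaussian elimination: a nonzero coefficient of an equation serves as pivot, and its
  unknown is eliminated from the others. The strict inequality of cardinalities survives because one
  equation and one unknown disappear together.\<close>

lemma (in field) homogeneous_system:
  assumes "finite T" "finite I" "card T < card I" "\<And>t i. t \<in> T \<Longrightarrow> i \<in> I \<Longrightarrow> a t i \<in> carrier R"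
  shows "\<exists>u \<in> I \<rightarrow> carrier R. (\<exists>i\<in>I. u i \<noteq> \<zero>) \<and> (\<forall>t\<in>T. (\<Oplus>i\<in>I. u i \<otimes> a t i) = \<zero>)"
  using assms
proof (induction T arbitrary: I a rule: finite_induct)
  case empty
  then have "I \<noteq> {}" by auto
  then show ?case by (intro bexI[of _ "\<lambda>_. \<one>"]) auto
next
  case (insert t T)
  have a: "\<And>s i. s \<in> T \<Longrightarrow> i \<in> I \<Longrightarrow> a s i \<in> carrier R" "\<And>i. i \<in> I \<Longrightarrow> a t i \<in> carrier R"
    using insert by auto
  show ?case
  proof (cases "\<forall>i\<in>I. a t i = \<zero>")
    case True
    have "card T < card I" using insert by simp
    then have "\<exists>u \<in> I \<rightarrow> carrier R. (\<exists>i\<in>I. u i \<noteq> \<zero>) \<and> (\<forall>s\<in>T. (\<Oplus>i\<in>I. u i \<otimes> a s i) = \<zero>)"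
      by (intro insert.IH insert.prems(1) a(1))
    then obtain u where u: "u \<in> I \<rightarrow> carrier R" "\<exists>i\<in>I. u i \<noteq> \<zero>" "\<forall>s\<in>T. (\<Oplus>i\<in>I. u i \<otimes> a s i) = \<zero>"
      by (rule bexE) (elim conjE, rule that)
    have "(\<Oplus>i\<in>I. u i \<otimes> a t i) = (\<Oplus>i\<in>I. \<zero>)"
      by (intro finsum_cong') (use True u in \<open>auto simp: Pi_iff\<close>)
    then show ?thesis using u by (intro bexI[of _ u]) (auto simp: finsum_zero)
  next
    case False
    then obtain k where k: "k \<in> I" "a t k \<noteq> \<zero>" by auto
    define d where "d = inv (a t k)"
    have d: "d \<in> carrier R" "d \<otimes> a t k = \<one>"
      using k a(2) field_Units by (auto simp: d_def Units_l_inv Units_inv_closed)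
    define I' where "I' = I - {k}"
    have I': "finite I'" "I = insert k I'" "k \<notin> I'" using insert k by (auto simp: I'_def)
    define a' where "a' s i = a s i \<ominus> a s k \<otimes> (d \<otimes> a t i)" for s i
    have "card T < card I'" using insert I' by simp
    moreover have "a' s i \<in> carrier R" if "s \<in> T" "i \<in> I'" for s i
      using that a d k I' by (simp add: a'_def)
    ultimately have "\<exists>u \<in> I' \<rightarrow> carrier R. (\<exists>i\<in>I'. u i \<noteq> \<zero>) \<and> (\<forall>s\<in>T. (\<Oplus>i\<in>I'. u i \<otimes> a' s i) = \<zero>)"
      by (intro insert.IH I'(1))
    then obtain u where u: "u \<in> I' \<rightarrow> carrier R" "\<exists>i\<in>I'. u i \<noteq> \<zero>" "\<forall>s\<in>T. (\<Oplus>i\<in>I'. u i \<otimes> a' s i) = \<zero>"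
      by (rule bexE) (elim conjE, rule that)
    define S where "S = (\<Oplus>i\<in>I'. u i \<otimes> a t i)"
    have S: "S \<in> carrier R" unfolding S_def using u(1) a I' by (intro finsum_closed) (auto simp: Pi_iff)
    \<comment> \<open>The eliminated unknown is chosen to satisfy the pivot equation; the reduced
      equations then give back the original ones.\<close>
    define w where "w i = (if i = k then \<ominus> (d \<otimes> S) else u i)" for i
    have w: "w \<in> I \<rightarrow> carrier R" using u(1) I' S d by (auto simp: w_def Pi_iff)
    have sum_w: "(\<Oplus>i\<in>I. w i \<otimes> a s i) = \<ominus> (d \<otimes> S) \<otimes> a s k \<oplus> (\<Oplus>i\<in>I'. u i \<otimes> a s i)"
      if "\<And>i. i \<in> I \<Longrightarrow> a s i \<in> carrier R" for s
    proof -
      have "(\<Oplus>i\<in>I. w i \<otimes> a s i) = w k \<otimes> a s k \<oplus> (\<Oplus>i\<in>I'. w i \<otimes> a s i)"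
        unfolding I'(2) using I' w that by (intro finsum_insert) (auto simp: Pi_iff)
      also have "(\<Oplus>i\<in>I'. w i \<otimes> a s i) = (\<Oplus>i\<in>I'. u i \<otimes> a s i)"
        using I' u(1) that by (intro finsum_cong') (auto simp: w_def Pi_iff)
      finally show ?thesis by (simp add: w_def)
    qed
    have "(\<Oplus>i\<in>I. w i \<otimes> a t i) = \<zero>"
    proof -
      have "\<ominus> (d \<otimes> S) \<otimes> a t k \<oplus> S = \<ominus> ((d \<otimes> a t k) \<otimes> S) \<oplus> S"
        using d S a(2)[OF k(1)] by algebra
      then show ?thesis using sum_w[OF a(2)] S d by (simp add: S_def[symmetric] l_neg)
    qed
    moreover have "(\<Oplus>i\<in>I. w i \<otimes> a s i) = \<zero>" if s: "s \<in> T" for s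
    proof -
      have as: "\<And>i. i \<in> I \<Longrightarrow> a s i \<in> carrier R" using a(1)[OF s] .
      have ask: "a s k \<in> carrier R" using as k by auto
      have "\<zero> = (\<Oplus>i\<in>I'. u i \<otimes> a' s i)" using u(3) s by auto
      also have "\<dots> = (\<Oplus>i\<in>I'. u i \<otimes> a s i \<oplus> (\<ominus> (a s k \<otimes> d)) \<otimes> (u i \<otimes> a t i))"
      proof (intro finsum_cong')
        fix i assume "i \<in> I'"
        then have "u i \<in> carrier R" "a s i \<in> carrier R" "a t i \<in> carrier R" using u(1) as a I' by (auto simp: Pi_iff)
        then show "u i \<otimes> a' s i = u i \<otimes> a s i \<oplus> (\<ominus> (a s k \<otimes> d)) \<otimes> (u i \<otimes> a t i)"
          unfolding a'_def using ask d by algebra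
      qed (use u(1) as a I' ask d in \<open>auto simp: Pi_iff\<close>)
      also have "\<dots> = (\<Oplus>i\<in>I'. u i \<otimes> a s i) \<oplus> (\<Oplus>i\<in>I'. (\<ominus> (a s k \<otimes> d)) \<otimes> (u i \<otimes> a t i))"
        using u(1) as a I' ask d by (intro finsum_addf) (auto simp: Pi_iff)
      also have "(\<Oplus>i\<in>I'. (\<ominus> (a s k \<otimes> d)) \<otimes> (u i \<otimes> a t i)) = (\<ominus> (a s k \<otimes> d)) \<otimes> S"
        unfolding S_def using u(1) as a I' ask d by (intro finsum_rdistr[symmetric]) (auto simp: Pi_iff)
      finally have z: "(\<Oplus>i\<in>I'. u i \<otimes> a s i) \<oplus> (\<ominus> (a s k \<otimes> d)) \<otimes> S = \<zero>" by simp
      have us: "(\<Oplus>i\<in>I'. u i \<otimes> a s i) \<in> carrier R" using u(1) as I' by (intro finsum_closed) (auto simp: Pi_iff)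
      have "\<ominus> (d \<otimes> S) \<otimes> a s k \<oplus> (\<Oplus>i\<in>I'. u i \<otimes> a s i) = (\<Oplus>i\<in>I'. u i \<otimes> a s i) \<oplus> (\<ominus> (a s k \<otimes> d)) \<otimes> S"
        using us ask d(1) S by (simp add: l_minus r_minus m_ac a_comm)
      then show ?thesis using sum_w[OF as] z by simp
    qed
    moreover have "\<exists>i\<in>I. w i \<noteq> \<zero>" using u(2) I' by (auto simp: w_def)
    ultimately show ?thesis using w by auto
  qed
qed

text \<open>Rank is bounded by fixing generators, \<open>f\<close> for columns and \<open>h\<close>
  for rows. Numerical rank bounds add up under sums, whereas the matrices of this form are closed
  under sums, so that the bound survives any number of gates.\<close>

definition (in ring) low_rank ::
    "'i set \<Rightarrow> 'j set \<Rightarrow> 't set \<Rightarrow> ('t \<Rightarrow> 'i \<Rightarrow> 'a) \<Rightarrow> 's set \<Rightarrow> ('s \<Rightarrow> 'j \<Rightarrow> 'a) \<Rightarrow> ('i \<Rightarrow> 'j \<Rightarrow> 'a) \<Rightarrow> bool" where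
  "low_rank I J T f S h N \<longleftrightarrow>
    (\<exists>N1 N2. (\<forall>j\<in>J. span_on I T f (\<lambda>i. N1 i j)) \<and> (\<forall>i\<in>I. span_on J S h (N2 i)) \<and>
      (\<forall>i\<in>I. \<forall>j\<in>J. N i j = N1 i j \<oplus> N2 i j))"

lemma (in ring) low_rank_cong:
  assumes "\<And>i j. i \<in> I \<Longrightarrow> j \<in> J \<Longrightarrow> N i j = N' i j" "low_rank I J T f S h N'"
  shows "low_rank I J T f S h N"
  using assms unfolding low_rank_def by metis

text \<open>There is a nonzero row vector \<open>u\<close> orthogonal to all \<open>f t\<close> and
  to the coefficient columns with which the \<open>h s\<close> enter \<open>N2\<close>, if these
  \<open>card T + card S\<close> equations are fewer than \<open>card I\<close>. Then
  \<open>u\<close> annihilates \<open>N\<close>, which a right inverse forbids.\<close>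

lemma (in field) low_rank_nonsingular:
  assumes fin: "finite I" "finite J" "finite T" "finite S"
    and f: "\<And>t i. t \<in> T \<Longrightarrow> i \<in> I \<Longrightarrow> f t i \<in> carrier R"
    and h: "\<And>s j. s \<in> S \<Longrightarrow> j \<in> J \<Longrightarrow> h s j \<in> carrier R"
    and low: "low_rank I J T f S h N" and N: "nonsingular_submatrix N I J"
  shows "card I \<le> card T + card S"
proof (rule ccontr)
  assume big: "\<not> card I \<le> card T + card S"
  obtain N1 N2 where N1: "\<And>j. j \<in> J \<Longrightarrow> span_on I T f (\<lambda>i. N1 i j)"
    and N2: "\<And>i. i \<in> I \<Longrightarrow> span_on J S h (N2 i)" and N12: "\<And>i j. i \<in> I \<Longrightarrow> j \<in> J \<Longrightarrow> N i j = N1 i j \<oplus> N2 i j"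
    using low unfolding low_rank_def by blast
  have "\<exists>c. \<forall>i\<in>I. c i \<in> S \<rightarrow> carrier R \<and> (\<forall>j\<in>J. N2 i j = (\<Oplus>s\<in>S. c i s \<otimes> h s j))"
    using N2 by (intro bchoice) (simp add: span_on_def Bex_def)
  then obtain c where c: "\<And>i s. i \<in> I \<Longrightarrow> s \<in> S \<Longrightarrow> c i s \<in> carrier R"
    and N2c: "\<And>i j. i \<in> I \<Longrightarrow> j \<in> J \<Longrightarrow> N2 i j = (\<Oplus>s\<in>S. c i s \<otimes> h s j)"
    by (auto simp: Pi_def)
  define g where "g r i = (case r of Inl t \<Rightarrow> f t i | Inr s \<Rightarrow> c i s)" for r i
  have "card (T <+> S) < card I" using big fin by (simp add: card_Plus)
  moreover have "g r i \<in> carrier R" if "r \<in> T <+> S" "i \<in> I" for r i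
    using that f c by (auto simp: g_def)
  ultimately have "\<exists>u \<in> I \<rightarrow> carrier R. (\<exists>i\<in>I. u i \<noteq> \<zero>) \<and> (\<forall>r \<in> T <+> S. (\<Oplus>i\<in>I. u i \<otimes> g r i) = \<zero>)"
    using fin by (intro homogeneous_system finite_Plus)
  then obtain u where u: "u \<in> I \<rightarrow> carrier R" "\<exists>i\<in>I. u i \<noteq> \<zero>"
    and ug: "\<forall>r \<in> T <+> S. (\<Oplus>i\<in>I. u i \<otimes> g r i) = \<zero>"
    by (rule bexE) (elim conjE, rule that)
  have uf: "(\<Oplus>i\<in>I. u i \<otimes> f t i) = \<zero>" if "t \<in> T" for t using bspec[OF ug InlI[OF that]] by (simp add: g_def)
  have uc: "(\<Oplus>i\<in>I. u i \<otimes> c i s) = \<zero>" if "s \<in> S" for s using bspec[OF ug InrI[OF that]] by (simp add: g_def)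
  have N1c: "N1 i j \<in> carrier R" if "i \<in> I" "j \<in> J" for i j
    using span_on_closed[OF fin(3) f N1[OF that(2)] that(1)] by simp
  have N2c': "N2 i j \<in> carrier R" if "i \<in> I" "j \<in> J" for i j
    using span_on_closed[OF fin(4) h N2[OF that(1)] that(2)] by simp
  have uN: "(\<Oplus>i\<in>I. u i \<otimes> N i j) = \<zero>" if j: "j \<in> J" for j
  proof -
    have "(\<Oplus>i\<in>I. u i \<otimes> N i j) = (\<Oplus>i\<in>I. u i \<otimes> N1 i j \<oplus> u i \<otimes> N2 i j)"
      using u(1) N1c N2c' j N12 by (intro finsum_cong') (auto simp: r_distr Pi_def)
    also have "\<dots> = (\<Oplus>i\<in>I. u i \<otimes> N1 i j) \<oplus> (\<Oplus>i\<in>I. u i \<otimes> N2 i j)"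
      using u(1) N1c N2c' j by (intro finsum_addf) (auto simp: Pi_iff)
    also have "(\<Oplus>i\<in>I. u i \<otimes> N1 i j) = \<zero>"
      using span_on_annihilated[OF fin(3) f N1[OF j] fin(1) u(1) uf] by simp
    also have "(\<Oplus>i\<in>I. u i \<otimes> N2 i j) = \<zero>"
    proof (rule span_on_annihilated[OF fin(4), of I "\<lambda>s i. c i s", OF _ _ fin(1) u(1) uc])
      show "span_on I S (\<lambda>s i. c i s) (\<lambda>i. N2 i j)"
        unfolding span_on_def
        by (intro bexI[of _ "\<lambda>s. h s j"] ballI)
          (use N2c c h j in \<open>auto intro!: finsum_cong' simp: m_comm Pi_iff\<close>)
    qed (use c in auto)
    finally show ?thesis by simp
  qed
  have Nc: "N i j \<in> carrier R" if "i \<in> I" "j \<in> J" for i j using N12[OF that] N1c[OF that] N2c'[OF that] by simp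
  obtain B where B: "B \<in> J \<rightarrow> I \<rightarrow> carrier R"
    and inv: "\<And>i i'. i \<in> I \<Longrightarrow> i' \<in> I \<Longrightarrow> (\<Oplus>j\<in>J. N i j \<otimes> B j i') = (if i = i' then \<one> else \<zero>)"
    using N unfolding nonsingular_submatrix_def by auto
  have Bc: "B j i \<in> carrier R" if "j \<in> J" "i \<in> I" for i j using B that by auto
  have "u k = \<zero>" if k: "k \<in> I" for k
  proof -
    have "u k = (\<Oplus>i\<in>I. if k = i then u i else \<zero>)"
      using fin k u(1) by (subst finsum_singleton) (auto simp: Pi_iff)
    also have "\<dots> = (\<Oplus>i\<in>I. \<Oplus>j\<in>J. u i \<otimes> N i j \<otimes> B j k)"
    proof (intro finsum_cong')
      fix i assume i: "i \<in> I"
      have ui: "u i \<in> carrier R" using u(1) i by (auto simp: Pi_iff)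
      have "(\<Oplus>j\<in>J. u i \<otimes> N i j \<otimes> B j k) = (\<Oplus>j\<in>J. u i \<otimes> (N i j \<otimes> B j k))"
        using ui Nc[OF i] Bc[OF _ k] by (intro finsum_cong') (auto simp: m_assoc)
      also have "\<dots> = u i \<otimes> (\<Oplus>j\<in>J. N i j \<otimes> B j k)"
        using ui Nc[OF i] Bc[OF _ k] fin by (intro finsum_rdistr[symmetric]) (auto simp: Pi_iff)
      also have "\<dots> = (if k = i then u i else \<zero>)" using inv[OF i k] ui by auto
      finally show "(if k = i then u i else \<zero>) = (\<Oplus>j\<in>J. u i \<otimes> N i j \<otimes> B j k)" by simp
    qed (use u(1) Nc Bc k in \<open>auto simp: Pi_iff intro!: finsum_closed\<close>)
    also have "\<dots> = (\<Oplus>j\<in>J. \<Oplus>i\<in>I. u i \<otimes> N i j \<otimes> B j k)"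
      by (rule finsum_swap) (use fin u(1) Nc Bc k in \<open>auto simp: Pi_iff\<close>)
    also have "\<dots> = (\<Oplus>j\<in>J. \<zero>)"
    proof (intro finsum_cong')
      fix j assume j: "j \<in> J"
      have "(\<Oplus>i\<in>I. u i \<otimes> N i j \<otimes> B j k) = (\<Oplus>i\<in>I. u i \<otimes> N i j) \<otimes> B j k"
        using u(1) Nc[OF _ j] Bc[OF j k] fin by (intro finsum_ldistr[symmetric]) (auto simp: Pi_iff)
      then show "(\<Oplus>i\<in>I. u i \<otimes> N i j \<otimes> B j k) = \<zero>" using uN[OF j] Bc[OF j k] by simp
    qed auto
    finally show ?thesis by (simp add: finsum_zero)
  qed
  with u(2) show False by auto
qed

section \<open>Bilinear parts of polynomials\<close>

text \<open>
  Polynomials are considered modulo everything except the coefficients of 1, \<open>y i\<close>, \<open>x j\<close> and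
  \<open>y i * x j\<close>. Both \<open>left_poly\<close> and \<open>right_poly\<close> below describe subrings, since the mixed
  coefficients of a product only involve outer products of the linear parts of its factors.
\<close>
locale split_coefficients = cring R for R (structure) +
  fixes I :: "'i set" and J :: "'j set" and T :: "'t set" and f :: "'t \<Rightarrow> 'i \<Rightarrow> 'a"
    and S :: "'s set" and h :: "'s \<Rightarrow> 'j \<Rightarrow> 'a" and y :: "'i \<Rightarrow> 'x" and x :: "'j \<Rightarrow> 'x"
  assumes fin: "finite T" "finite S"
    and f: "\<And>t i. t \<in> T \<Longrightarrow> i \<in> I \<Longrightarrow> f t i \<in> carrier R"
    and h: "\<And>s j. s \<in> S \<Longrightarrow> j \<in> J \<Longrightarrow> h s j \<in> carrier R"
    and xy: "\<And>i j. i \<in> I \<Longrightarrow> j \<in> J \<Longrightarrow> y i \<noteq> x j"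
begin

abbreviation "low \<equiv> low_rank I J T f S h"
abbreviation "spanL \<equiv> span_on I T f"
abbreviation "spanR \<equiv> span_on J S h"

lemma low_zero: "low (\<lambda>i j. \<zero>)"
  unfolding low_rank_def using span_on_zero[OF fin(1) f] span_on_zero[OF fin(2) h]
  by (intro exI[of _ "\<lambda>i j. \<zero>"]) auto

lemma low_add:
  assumes "low M" "low N"
  shows "low (\<lambda>i j. M i j \<oplus> N i j)"
proof -
  obtain M1 M2 where M: "\<And>j. j \<in> J \<Longrightarrow> spanL (\<lambda>i. M1 i j)" "\<And>i. i \<in> I \<Longrightarrow> spanR (M2 i)"
      "\<And>i j. i \<in> I \<Longrightarrow> j \<in> J \<Longrightarrow> M i j = M1 i j \<oplus> M2 i j"
    using assms(1) unfolding low_rank_def by blast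
  obtain N1 N2 where N: "\<And>j. j \<in> J \<Longrightarrow> spanL (\<lambda>i. N1 i j)" "\<And>i. i \<in> I \<Longrightarrow> spanR (N2 i)"
      "\<And>i j. i \<in> I \<Longrightarrow> j \<in> J \<Longrightarrow> N i j = N1 i j \<oplus> N2 i j"
    using assms(2) unfolding low_rank_def by blast
  have "M i j \<oplus> N i j = (M1 i j \<oplus> N1 i j) \<oplus> (M2 i j \<oplus> N2 i j)" if "i \<in> I" "j \<in> J" for i j
    using span_on_closed[OF fin(1) f M(1)[OF that(2)] that(1)] span_on_closed[OF fin(2) h M(2)[OF that(1)] that(2)]
      span_on_closed[OF fin(1) f N(1)[OF that(2)] that(1)] span_on_closed[OF fin(2) h N(2)[OF that(1)] that(2)]
    by (simp add: M(3)[OF that] N(3)[OF that] a_ac)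
  then show ?thesis
    unfolding low_rank_def using span_on_add[OF fin(1) f M(1) N(1)] span_on_add[OF fin(2) h M(2) N(2)]
    by (intro exI[of _ "\<lambda>i j. M1 i j \<oplus> N1 i j"] exI[of _ "\<lambda>i j. M2 i j \<oplus> N2 i j"]) auto
qed

lemma low_scale:
  assumes "low M" "a \<in> carrier R"
  shows "low (\<lambda>i j. a \<otimes> M i j)"
proof -
  obtain M1 M2 where M: "\<And>j. j \<in> J \<Longrightarrow> spanL (\<lambda>i. M1 i j)" "\<And>i. i \<in> I \<Longrightarrow> spanR (M2 i)"
      "\<And>i j. i \<in> I \<Longrightarrow> j \<in> J \<Longrightarrow> M i j = M1 i j \<oplus> M2 i j"
    using assms(1) unfolding low_rank_def by blast
  have "a \<otimes> M i j = a \<otimes> M1 i j \<oplus> a \<otimes> M2 i j" if "i \<in> I" "j \<in> J" for i j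
    using span_on_closed[OF fin(1) f M(1)[OF that(2)] that(1)] span_on_closed[OF fin(2) h M(2)[OF that(1)] that(2)] assms(2)
    by (simp add: M(3)[OF that] r_distr)
  then show ?thesis
    unfolding low_rank_def using span_on_scale[OF fin(1) f M(1) assms(2)] span_on_scale[OF fin(2) h M(2) assms(2)]
    by (intro exI[of _ "\<lambda>i j. a \<otimes> M1 i j"] exI[of _ "\<lambda>i j. a \<otimes> M2 i j"]) auto
qed

lemma low_outer_left:
  assumes "spanL u" "\<And>j. j \<in> J \<Longrightarrow> w j \<in> carrier R"
  shows "low (\<lambda>i j. w j \<otimes> u i)"
  unfolding low_rank_def
  using span_on_scale[OF fin(1) f assms(1) assms(2)] span_on_zero[OF fin(2) h]
    span_on_closed[OF fin(1) f assms(1)] assms(2)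
  by (intro exI[of _ "\<lambda>i j. w j \<otimes> u i"] exI[of _ "\<lambda>i j. \<zero>"]) auto

lemma low_outer_right:
  assumes "spanR u" "\<And>i. i \<in> I \<Longrightarrow> w i \<in> carrier R"
  shows "low (\<lambda>i j. w i \<otimes> u j)"
  unfolding low_rank_def
  using span_on_scale[OF fin(2) h assms(1) assms(2)] span_on_zero[OF fin(1) f]
    span_on_closed[OF fin(2) h assms(1)] assms(2)
  by (intro exI[of _ "\<lambda>i j. \<zero>"] exI[of _ "\<lambda>i j. w i \<otimes> u j"]) auto

text \<open>On its own not preserved by products, whose cross terms are outer products of arbitrary
  linear parts. Controlling one linear part, as in \<open>left_poly\<close> and
  \<open>right_poly\<close>, repairs this.\<close>

definition low_poly :: "('x multiset \<Rightarrow> 'a) \<Rightarrow> bool" where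
  "low_poly P \<longleftrightarrow> P \<in> carrier mpoly_ring \<and> low (\<lambda>i j. P {#y i, x j#})"

definition left_poly :: "('x multiset \<Rightarrow> 'a) \<Rightarrow> bool" where
  "left_poly P \<longleftrightarrow> low_poly P \<and> spanL (\<lambda>i. P {#y i#})"

definition right_poly :: "('x multiset \<Rightarrow> 'a) \<Rightarrow> bool" where
  "right_poly P \<longleftrightarrow> low_poly P \<and> spanR (\<lambda>j. P {#x j#})"

lemma mpoly_carrier: "low_poly P \<Longrightarrow> P \<in> carrier mpoly_ring" "left_poly P \<Longrightarrow> P \<in> carrier mpoly_ring"
  "right_poly P \<Longrightarrow> P \<in> carrier mpoly_ring"
  by (auto simp: low_poly_def left_poly_def right_poly_def)

text \<open>The cross terms are left as hypotheses in order to serve products of two left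
  polynomials, of two right ones, and the mixed products at separator gates.\<close>

lemma low_poly_times:
  assumes P: "low_poly P" and Q: "low_poly Q"
    and cross: "low (\<lambda>i j. P {#y i#} \<otimes> Q {#x j#})" "low (\<lambda>i j. P {#x j#} \<otimes> Q {#y i#})"
  shows "low_poly (P \<otimes>\<^bsub>mpoly_ring\<^esub> Q)"
proof -
  note c = mpoly_carrier(1)[OF P] mpoly_carrier(1)[OF Q]
  interpret mc: comm_monoid mpoly_ring by (rule comm_monoid_mpoly)
  have lowP: "low (\<lambda>i j. Q {#} \<otimes> P {#y i, x j#})" and lowQ: "low (\<lambda>i j. P {#} \<otimes> Q {#y i, x j#})"
    using P Q coeff_closed[OF c(1)] coeff_closed[OF c(2)] by (auto simp: low_poly_def intro: low_scale)
  have "low (\<lambda>i j. (P \<otimes>\<^bsub>mpoly_ring\<^esub> Q) {#y i, x j#})"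
    by (rule low_rank_cong[OF _ low_add[OF lowQ low_add[OF cross(1) low_add[OF cross(2) lowP]]]])
      (use coeff_closed[OF c(1)] coeff_closed[OF c(2)] in \<open>simp add: coeff_times_pair[OF c xy] m_comm\<close>)
  then show ?thesis using c by (auto simp: low_poly_def)
qed

lemma span_times:
  assumes "finite U" "\<And>t i. t \<in> U \<Longrightarrow> i \<in> D \<Longrightarrow> e t i \<in> carrier R"
    and P: "P \<in> carrier mpoly_ring" "span_on D U e (\<lambda>i. P {#z i#})"
    and Q: "Q \<in> carrier mpoly_ring" "span_on D U e (\<lambda>i. Q {#z i#})"
  shows "span_on D U e (\<lambda>i. (P \<otimes>\<^bsub>mpoly_ring\<^esub> Q) {#z i#})"
proof -
  have "(\<lambda>i. (P \<otimes>\<^bsub>mpoly_ring\<^esub> Q) {#z i#}) = (\<lambda>i. P {#} \<otimes> Q {#z i#} \<oplus> Q {#} \<otimes> P {#z i#})"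
    using coeff_closed[OF P(1)] coeff_closed[OF Q(1)] by (simp add: coeff_times_single[OF P(1) Q(1)] m_comm)
  moreover have "span_on D U e (\<lambda>i. P {#} \<otimes> Q {#z i#} \<oplus> Q {#} \<otimes> P {#z i#})"
    by (intro span_on_add[OF assms(1,2)] span_on_scale[OF assms(1,2)] P(2) Q(2) coeff_closed P(1) Q(1))
  ultimately show ?thesis by simp
qed

lemma left_poly_times:
  assumes "left_poly P" "left_poly Q"
  shows "left_poly (P \<otimes>\<^bsub>mpoly_ring\<^esub> Q)"
proof -
  note c = mpoly_carrier(2)[OF assms(1)] mpoly_carrier(2)[OF assms(2)]
  have PQ: "low_poly P" "low_poly Q" "spanL (\<lambda>i. P {#y i#})" "spanL (\<lambda>i. Q {#y i#})"
    using assms by (auto simp: left_poly_def)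
  have "low (\<lambda>i j. P {#y i#} \<otimes> Q {#x j#})"
    by (rule low_rank_cong[OF _ low_outer_left[OF PQ(3), of "\<lambda>j. Q {#x j#}"]])
      (use coeff_closed[OF c(1)] coeff_closed[OF c(2)] in \<open>auto simp: m_comm\<close>)
  moreover have "low (\<lambda>i j. P {#x j#} \<otimes> Q {#y i#})"
    by (rule low_outer_left[OF PQ(4)]) (rule coeff_closed[OF c(1)])
  ultimately show ?thesis
    using low_poly_times[OF PQ(1,2)] span_times[OF fin(1) f c(1) PQ(3) c(2) PQ(4)] by (simp add: left_poly_def)
qed

lemma right_poly_times:
  assumes "right_poly P" "right_poly Q"
  shows "right_poly (P \<otimes>\<^bsub>mpoly_ring\<^esub> Q)"
proof -
  note c = mpoly_carrier(3)[OF assms(1)] mpoly_carrier(3)[OF assms(2)]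
  have PQ: "low_poly P" "low_poly Q" "spanR (\<lambda>i. P {#x i#})" "spanR (\<lambda>i. Q {#x i#})"
    using assms by (auto simp: right_poly_def)
  have "low (\<lambda>i j. P {#x j#} \<otimes> Q {#y i#})"
    by (rule low_rank_cong[OF _ low_outer_right[OF PQ(3), of "\<lambda>i. Q {#y i#}"]])
      (use coeff_closed[OF c(1)] coeff_closed[OF c(2)] in \<open>auto simp: m_comm\<close>)
  moreover have "low (\<lambda>i j. P {#y i#} \<otimes> Q {#x j#})"
    by (rule low_outer_right[OF PQ(4)]) (rule coeff_closed[OF c(1)])
  ultimately show ?thesis
    using low_poly_times[OF PQ(1,2)] span_times[OF fin(2) h c(1) PQ(3) c(2) PQ(4)] by (simp add: right_poly_def)
qed

lemma affine_poly:
  assumes "p \<in> carrier mpoly_ring" "\<And>i j. i \<in> I \<Longrightarrow> j \<in> J \<Longrightarrow> p {#y i, x j#} = \<zero>"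
  shows "low_poly p"
    and "(\<And>i. i \<in> I \<Longrightarrow> p {#y i#} = \<zero>) \<Longrightarrow> left_poly p"
    and "(\<And>j. j \<in> J \<Longrightarrow> p {#x j#} = \<zero>) \<Longrightarrow> right_poly p"
proof -
  show 1: "low_poly p"
    unfolding low_poly_def using assms(1) by (intro conjI low_rank_cong[OF _ low_zero] assms(2))
  show "left_poly p" if "\<And>i. i \<in> I \<Longrightarrow> p {#y i#} = \<zero>"
    using 1 span_on_zero[OF fin(1) f] that by (simp add: left_poly_def span_on_def)
  show "right_poly p" if "\<And>j. j \<in> J \<Longrightarrow> p {#x j#} = \<zero>"
    using 1 span_on_zero[OF fin(2) h] that by (simp add: right_poly_def span_on_def)
qed

lemma const_poly:
  assumes "a \<in> carrier R"
  shows "low_poly (indexed_const a)" "left_poly (indexed_const a)" "right_poly (indexed_const a)"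
  using indexed_const_closed[OF assms] by (auto intro!: affine_poly simp: coeff_const)

lemma low_poly_scale:
  assumes "a \<in> carrier R" "low_poly P"
  shows "low_poly (indexed_const a \<otimes>\<^bsub>mpoly_ring\<^esub> P)"
proof (rule low_poly_times[OF const_poly(1)[OF assms(1)] assms(2)])
  have c: "P m \<in> carrier R" for m using coeff_closed[OF mpoly_carrier(1)[OF assms(2)]] .
  show "low (\<lambda>i j. indexed_const a {#y i#} \<otimes> P {#x j#})" "low (\<lambda>i j. indexed_const a {#x j#} \<otimes> P {#y i#})"
    by (rule low_rank_cong[OF _ low_zero]; use c in \<open>simp add: coeff_const\<close>)+
qed

lemma padd_poly:
  assumes "low_poly P" "low_poly Q"
  shows "low_poly (P \<oplus>\<^bsub>mpoly_ring\<^esub> Q)"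
    and "left_poly P \<Longrightarrow> left_poly Q \<Longrightarrow> left_poly (P \<oplus>\<^bsub>mpoly_ring\<^esub> Q)"
    and "right_poly P \<Longrightarrow> right_poly Q \<Longrightarrow> right_poly (P \<oplus>\<^bsub>mpoly_ring\<^esub> Q)"
proof -
  interpret mp: abelian_monoid mpoly_ring by (rule abelian_monoid_mpoly)
  have add: "(P \<oplus>\<^bsub>mpoly_ring\<^esub> Q) m = P m \<oplus> Q m" for m
    by (simp add: mpoly_simps indexed_padd_def)
  show 1: "low_poly (P \<oplus>\<^bsub>mpoly_ring\<^esub> Q)"
    using assms by (auto simp: low_poly_def add intro: low_add)
  show "left_poly P \<Longrightarrow> left_poly Q \<Longrightarrow> left_poly (P \<oplus>\<^bsub>mpoly_ring\<^esub> Q)"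
    using 1 by (auto simp: left_poly_def add intro: span_on_add[OF fin(1) f])
  show "right_poly P \<Longrightarrow> right_poly Q \<Longrightarrow> right_poly (P \<oplus>\<^bsub>mpoly_ring\<^esub> Q)"
    using 1 by (auto simp: right_poly_def add intro: span_on_add[OF fin(2) h])
qed

lemma finsum_poly:
  assumes "finite E" "\<And>e. e \<in> E \<Longrightarrow> low_poly (p e)"
  shows "low_poly (\<Oplus>\<^bsub>mpoly_ring\<^esub>e\<in>E. p e)
    \<and> ((\<forall>e\<in>E. left_poly (p e)) \<longrightarrow> left_poly (\<Oplus>\<^bsub>mpoly_ring\<^esub>e\<in>E. p e))
    \<and> ((\<forall>e\<in>E. right_poly (p e)) \<longrightarrow> right_poly (\<Oplus>\<^bsub>mpoly_ring\<^esub>e\<in>E. p e))"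
proof -
  interpret mp: abelian_monoid mpoly_ring by (rule abelian_monoid_mpoly)
  show ?thesis
    using assms
  proof (induction E rule: finite_induct)
    case empty
    then show ?case using const_poly[OF zero_closed] by (simp add: mpoly_simps)
  next
    case (insert a E)
    have "(\<Oplus>\<^bsub>mpoly_ring\<^esub>e\<in>insert a E. p e) = p a \<oplus>\<^bsub>mpoly_ring\<^esub> (\<Oplus>\<^bsub>mpoly_ring\<^esub>e\<in>E. p e)"
      using insert mpoly_carrier(1) by (intro mp.finsum_insert) auto
    then show ?case using insert padd_poly by simp
  qed
qed

lemma finprod_poly:
  assumes "finite E"
  shows "((\<forall>e\<in>E. left_poly (p e)) \<longrightarrow> left_poly (\<Otimes>\<^bsub>mpoly_ring\<^esub>e\<in>E. p e))
    \<and> ((\<forall>e\<in>E. right_poly (p e)) \<longrightarrow> right_poly (\<Otimes>\<^bsub>mpoly_ring\<^esub>e\<in>E. p e))"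
proof -
  interpret mc: comm_monoid mpoly_ring by (rule comm_monoid_mpoly)
  show ?thesis
    using assms
  proof (induction E rule: finite_induct)
    case empty
    then show ?case using const_poly[OF one_closed] by (simp add: mpoly_simps)
  next
    case (insert a E)
    have ins: "(\<Otimes>\<^bsub>mpoly_ring\<^esub>e\<in>insert a E. p e) = p a \<otimes>\<^bsub>mpoly_ring\<^esub> (\<Otimes>\<^bsub>mpoly_ring\<^esub>e\<in>E. p e)"
      if "\<forall>e\<in>insert a E. p e \<in> carrier mpoly_ring"
      using insert that by (intro mc.finprod_insert) auto
    show ?case using insert ins mpoly_carrier left_poly_times right_poly_times by simp
  qed
qed

end

section \<open>Separators of circuits\<close>

context arithmetic_circuit
begin

section \<open>Values of gates\<close>

lemma gate_closed: "gate_computes C v p \<Longrightarrow> p \<in> carrier mpoly_ring"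
proof (induction rule: gate_computes.induct)
  case (var v z)
  show ?case by (rule indexed_var_closed)
next
  case (const v a)
  then have "in_arcs (graph C) v = {}" using operation_label[of v] by auto
  then have "a \<in> carrier R" using input_label[of v] const by auto
  then show ?case by (rule indexed_const_closed)
next
  case (plus v p)
  interpret mc: comm_monoid mpoly_ring by (rule comm_monoid_mpoly)
  interpret mp: abelian_monoid mpoly_ring by (rule abelian_monoid_mpoly)
  show ?case
    by (rule mp.finsum_closed) (use plus in \<open>auto intro!: mc.m_closed indexed_const_closed weight simp: in_arcs_def\<close>)
next
  case (times v p)
  interpret mc: comm_monoid mpoly_ring by (rule comm_monoid_mpoly)
  show ?case
    by (rule mc.finprod_closed) (use times in \<open>auto intro!: mc.m_closed indexed_const_closed weight simp: in_arcs_def\<close>)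
qed

lemma wire_closed:
  assumes "e \<in> in_arcs (graph C) v" "gate_computes C (tail (graph C) e) q"
  shows "indexed_const (weight C e) \<otimes>\<^bsub>mpoly_ring\<^esub> q \<in> carrier mpoly_ring"
proof -
  interpret mc: comm_monoid mpoly_ring by (rule comm_monoid_mpoly)
  show ?thesis
    using assms by (intro mc.m_closed indexed_const_closed weight gate_closed) auto
qed

text \<open>\<open>gate_computes\<close> is a relation, with \<open>p\<close> free outside the
  incoming wires. Uniqueness yields the function \<open>val\<close>, by which generators can be
  assigned to gates before the induction over the circuit.\<close>

lemma gate_unique: "gate_computes C v p \<Longrightarrow> gate_computes C v q \<Longrightarrow> q = p"
proof (induction arbitrary: q rule: gate_computes.induct)
  case (var v z)
  then show ?case by (auto elim: gate_computes.cases)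
next
  case (const v a)
  then show ?case by (auto elim: gate_computes.cases)
next
  case (plus v p)
  interpret mp: abelian_monoid mpoly_ring by (rule abelian_monoid_mpoly)
  obtain p' where p': "\<And>e. e \<in> in_arcs (graph C) v \<Longrightarrow> gate_computes C (tail (graph C) e) (p' e)"
    and q: "q = (\<Oplus>\<^bsub>mpoly_ring\<^esub>e\<in>in_arcs (graph C) v. indexed_const (weight C e) \<otimes>\<^bsub>mpoly_ring\<^esub> p' e)"
    using plus(5) plus(2) by (cases rule: gate_computes.cases) auto
  have "p' e = p e" if "e \<in> in_arcs (graph C) v" for e using plus(4)[OF that p'[OF that]] .
  then show ?case
    unfolding q by (intro mp.finsum_cong') (use wire_closed plus(3) in auto)
next
  case (times v p)
  interpret mc: comm_monoid mpoly_ring by (rule comm_monoid_mpoly)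
  obtain p' where p': "\<And>e. e \<in> in_arcs (graph C) v \<Longrightarrow> gate_computes C (tail (graph C) e) (p' e)"
    and q: "q = (\<Otimes>\<^bsub>mpoly_ring\<^esub>e\<in>in_arcs (graph C) v. indexed_const (weight C e) \<otimes>\<^bsub>mpoly_ring\<^esub> p' e)"
    using times(5) times(2) by (cases rule: gate_computes.cases) auto
  have "p' e = p e" if "e \<in> in_arcs (graph C) v" for e using times(4)[OF that p'[OF that]] .
  then show ?case
    unfolding q by (intro mc.finprod_cong') (use wire_closed times(3) in auto)
qed

definition val :: "'g \<Rightarrow> 'x multiset \<Rightarrow> 'a" where
  "val v = (THE p. gate_computes C v p)"

lemma val_eq: "gate_computes C v p \<Longrightarrow> val v = p"
  unfolding val_def using gate_unique by blast

text \<open>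
  A separator gate \<open>s\<close> contributes three rank-one terms: the linear \<open>y\<close>-part and \<open>x\<close>-part of its own
  polynomial, and, if it is a product gate, the linear \<open>y\<close>-part of the product of its inputs
  outside \<open>A\<close>.
\<close>
theorem separator_rank:
  fixes I :: "'i set" and J :: "'j set"
  assumes fin: "finite S"
    and cover: "verts (graph C) \<subseteq> A \<union> S \<union> B"
    and sepA: "\<And>e. e \<in> arcs (graph C) \<Longrightarrow> head (graph C) e \<in> A \<Longrightarrow> tail (graph C) e \<in> A \<union> S"
    and sepB: "\<And>e. e \<in> arcs (graph C) \<Longrightarrow> head (graph C) e \<in> B \<Longrightarrow> tail (graph C) e \<in> B \<union> S"
    and yA: "\<And>v i. v \<in> A \<Longrightarrow> i \<in> I \<Longrightarrow> label C v \<noteq> Var (y i)"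
    and xB: "\<And>v j. v \<in> B \<Longrightarrow> j \<in> J \<Longrightarrow> label C v \<noteq> Var (x j)"
    and xy: "\<And>i j. i \<in> I \<Longrightarrow> j \<in> J \<Longrightarrow> y i \<noteq> x j"
    and out: "gate_computes C v0 p0"
  obtains f h where "\<And>t i. t \<in> S \<times> (UNIV :: bool set) \<Longrightarrow> i \<in> I \<Longrightarrow> f t i \<in> carrier R"
    "\<And>s j. s \<in> S \<Longrightarrow> j \<in> J \<Longrightarrow> h s j \<in> carrier R"
    "low_rank I J (S \<times> (UNIV :: bool set)) f S h (\<lambda>i j. p0 {#y i, x j#})"
proof -
  interpret mc: comm_monoid mpoly_ring by (rule comm_monoid_mpoly)
  interpret mp: abelian_monoid mpoly_ring by (rule abelian_monoid_mpoly)
  define wire where "wire e = indexed_const (weight C e) \<otimes>\<^bsub>mpoly_ring\<^esub> val (tail (graph C) e)" for e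
  define arcsA where "arcsA v = {e \<in> in_arcs (graph C) v. tail (graph C) e \<in> A}" for v
  \<comment> \<open>The wires not coming from \<open>A\<close> come from
    \<open>S \<union> B\<close>. At a separator gate the first group multiplies to a left polynomial
    and the second to a right one.\<close>
  define arcsB where "arcsB v = {e \<in> in_arcs (graph C) v. tail (graph C) e \<notin> A}" for v
  define PB where "PB v = (\<Otimes>\<^bsub>mpoly_ring\<^esub>e\<in>arcsB v. wire e)" for v
  \<comment> \<open>Nothing is known of \<open>val\<close> and \<open>PB\<close> at a member of
    \<open>S\<close> that computes nothing; zero as default keeps such generators in the
    field.\<close>
  define cf where "cf P m = (if P \<in> carrier mpoly_ring then P m else \<zero>)" for P :: "'x multiset \<Rightarrow> 'a" and m
  define f where "f t i = cf (if snd t then val (fst t) else PB (fst t)) {#y i#}" for t i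
  define h where "h s j = cf (val s) {#x j#}" for s j
  have cf: "cf P m \<in> carrier R" for P m using coeff_closed[of P m] by (simp add: cf_def)
  interpret sc: split_coefficients R I J "S \<times> (UNIV :: bool set)" f S h y x
    by unfold_locales (use fin xy cf in \<open>auto simp: f_def h_def\<close>)
  have fin_arcs: "finite (in_arcs (graph C) v)" for v
    using fin_digraph.finite_arcs[OF fin_digraph] by (rule finite_subset[rotated]) auto
  have tail_cases: "tail (graph C) e \<in> A \<union> S \<union> B" if "e \<in> in_arcs (graph C) v" for e v
    using that cover wf_digraph.tail_in_verts[OF fin_digraph.axioms(1)[OF fin_digraph]] by auto
  have memberL: "span_on I (S \<times> (UNIV :: bool set)) f (\<lambda>i. p {#y i#})" if "v \<in> S" "gate_computes C v p" for v p
    by (rule span_on_member[OF sc.fin(1) sc.f, where s="(v, True)"])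
      (use that val_eq[OF that(2)] gate_closed[OF that(2)] in \<open>auto simp: f_def cf_def\<close>)
  have memberR: "span_on J S h (\<lambda>j. p {#x j#})" if "v \<in> S" "gate_computes C v p" for v p
    by (rule span_on_member[OF sc.fin(2) sc.h, where s=v])
      (use that val_eq[OF that(2)] gate_closed[OF that(2)] in \<open>auto simp: h_def cf_def\<close>)
  \<comment> \<open>Gates in \<open>A\<close> read no \<open>y i\<close>, so linear
    \<open>y\<close>-terms reach them only through \<open>S\<close>, and dually for
    \<open>B\<close>. Gates in \<open>S\<close> satisfy both linear conditions because their own
    linear parts are generators; for them only the mixed coefficients need an argument.\<close>
  have "sc.low_poly p \<and> (v \<in> A \<union> S \<longrightarrow> sc.left_poly p) \<and> (v \<in> B \<union> S \<longrightarrow> sc.right_poly p)"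
    if "gate_computes C v p" for v p
    using that
  proof (induction rule: gate_computes.induct)
    case (var v z)
    have low: "sc.low_poly (indexed_var z)"
      by (rule sc.affine_poly) (simp_all add: indexed_var_closed coeff_var)
    have comp: "gate_computes C v (indexed_var z)" using var by (rule gate_computes.var)
    have "sc.left_poly (indexed_var z)" if "v \<in> A"
      by (rule sc.affine_poly) (use yA[OF that] var in \<open>auto simp: indexed_var_closed coeff_var\<close>)
    moreover have "sc.right_poly (indexed_var z)" if "v \<in> B"
      by (rule sc.affine_poly) (use xB[OF that] var in \<open>auto simp: indexed_var_closed coeff_var\<close>)
    moreover have "sc.left_poly (indexed_var z)" "sc.right_poly (indexed_var z)" if "v \<in> S"
      using low memberL[OF that comp] memberR[OF that comp] by (auto simp: sc.left_poly_def sc.right_poly_def)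
    ultimately show ?case using low by auto
  next
    case (const v a)
    have comp: "gate_computes C v (indexed_const a)" using const by (rule gate_computes.const)
    have "a \<in> carrier R" using coeff_closed[OF gate_closed[OF comp], of "{#}"] by (simp add: coeff_const)
    then show ?case using sc.const_poly by auto
  next
    case (plus v p)
    let ?q = "\<Oplus>\<^bsub>mpoly_ring\<^esub>e\<in>in_arcs (graph C) v. indexed_const (weight C e) \<otimes>\<^bsub>mpoly_ring\<^esub> p e"
    have comp: "gate_computes C v ?q"
      using plus by (intro gate_computes.plus) auto
    have w: "weight C e \<in> carrier R" if "e \<in> in_arcs (graph C) v" for e using that weight by auto
    have low: "sc.low_poly ?q"
      and left: "\<forall>e\<in>in_arcs (graph C) v. sc.left_poly (indexed_const (weight C e) \<otimes>\<^bsub>mpoly_ring\<^esub> p e) \<Longrightarrow> sc.left_poly ?q"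
      and right: "\<forall>e\<in>in_arcs (graph C) v. sc.right_poly (indexed_const (weight C e) \<otimes>\<^bsub>mpoly_ring\<^esub> p e) \<Longrightarrow> sc.right_poly ?q"
      using sc.finsum_poly[OF fin_arcs[of v], of "\<lambda>e. indexed_const (weight C e) \<otimes>\<^bsub>mpoly_ring\<^esub> p e"]
        sc.low_poly_scale[OF w] plus(4) by auto
    have "sc.left_poly ?q" if "v \<in> A"
    proof (rule left, rule ballI, rule sc.left_poly_times)
      fix e assume e: "e \<in> in_arcs (graph C) v"
      show "sc.left_poly (indexed_const (weight C e))" using sc.const_poly w[OF e] by simp
      show "sc.left_poly (p e)" using plus(4)[OF e] sepA[of e] e that by auto
    qed
    moreover have "sc.right_poly ?q" if "v \<in> B"
    proof (rule right, rule ballI, rule sc.right_poly_times)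
      fix e assume e: "e \<in> in_arcs (graph C) v"
      show "sc.right_poly (indexed_const (weight C e))" using sc.const_poly w[OF e] by simp
      show "sc.right_poly (p e)" using plus(4)[OF e] sepB[of e] e that by auto
    qed
    moreover have "sc.left_poly ?q" "sc.right_poly ?q" if "v \<in> S"
      using low memberL[OF that comp] memberR[OF that comp] by (auto simp: sc.left_poly_def sc.right_poly_def)
    ultimately show ?case using low by auto
  next
    case (times v p)
    let ?w = "\<lambda>e. indexed_const (weight C e) \<otimes>\<^bsub>mpoly_ring\<^esub> p e"
    let ?q = "\<Otimes>\<^bsub>mpoly_ring\<^esub>e\<in>in_arcs (graph C) v. ?w e"
    have comp: "gate_computes C v ?q"
      using times by (intro gate_computes.times) auto
    have wire: "wire e = ?w e" if "e \<in> in_arcs (graph C) v" for e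
      using val_eq[OF times(3)[OF that]] by (simp add: wire_def)
    have wc: "?w e \<in> carrier mpoly_ring" if "e \<in> in_arcs (graph C) v" for e
      by (rule wire_closed[OF that times(3)[OF that]])
    have w: "weight C e \<in> carrier R" if "e \<in> in_arcs (graph C) v" for e using that weight by auto
    have wl: "sc.left_poly (?w e)" if "e \<in> in_arcs (graph C) v" "tail (graph C) e \<in> A \<union> S" for e
      using times(4)[OF that(1)] that(2) sc.const_poly(2)[OF w[OF that(1)]] by (auto intro: sc.left_poly_times)
    have wr: "sc.right_poly (?w e)" if "e \<in> in_arcs (graph C) v" "tail (graph C) e \<in> B \<union> S" for e
      using times(4)[OF that(1)] that(2) sc.const_poly(3)[OF w[OF that(1)]] by (auto intro: sc.right_poly_times)
    have left: "sc.left_poly ?q" if "v \<in> A"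
      using sc.finprod_poly[OF fin_arcs[of v], of ?w] wl sepA that by fastforce
    have right: "sc.right_poly ?q" if "v \<in> B"
      using sc.finprod_poly[OF fin_arcs[of v], of ?w] wr sepB that by fastforce
    \<comment> \<open>The critical case, where inputs from both sides are multiplied. Each cross
      term pairs an \<open>x\<close>-part with a \<open>y\<close>-part in the span: that of
      \<open>?PA\<close> is there as a left polynomial, that of \<open>PB v\<close> as generator
      \<open>(v, False)\<close>. One extra generator thus settles both.\<close>
    have low: "sc.low_poly ?q" if "v \<in> S"
    proof -
      let ?PA = "\<Otimes>\<^bsub>mpoly_ring\<^esub>e\<in>arcsA v. ?w e"
      have fA: "finite (arcsA v)" and fB: "finite (arcsB v)"
        by (auto simp: arcsA_def arcsB_def intro: finite_subset[OF _ fin_arcs[of v]])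
      have PB: "PB v = (\<Otimes>\<^bsub>mpoly_ring\<^esub>e\<in>arcsB v. ?w e)"
        unfolding PB_def by (intro mc.finprod_cong') (use wire wc in \<open>auto simp: arcsB_def\<close>)
      have lA: "sc.left_poly ?PA"
        using sc.finprod_poly[OF fA, of ?w] wl by (auto simp: arcsA_def)
      have "sc.right_poly (?w e)" if "e \<in> arcsB v" for e
        using wr[of e] tail_cases[of e v] that by (auto simp: arcsB_def)
      then have rB: "sc.right_poly (PB v)"
        unfolding PB using sc.finprod_poly[OF fB, of ?w] by blast
      have "in_arcs (graph C) v = arcsA v \<union> arcsB v" by (auto simp: arcsA_def arcsB_def)
      then have "?q = (\<Otimes>\<^bsub>mpoly_ring\<^esub>e\<in>arcsA v \<union> arcsB v. ?w e)" by (simp only:)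
      also have "\<dots> = ?PA \<otimes>\<^bsub>mpoly_ring\<^esub> PB v"
        unfolding PB by (rule mc.finprod_Un_disjoint[OF fA fB]) (use wc in \<open>auto simp: arcsA_def arcsB_def\<close>)
      finally have q: "?q = ?PA \<otimes>\<^bsub>mpoly_ring\<^esub> PB v" .
      have c: "?PA \<in> carrier mpoly_ring" "PB v \<in> carrier mpoly_ring" using sc.mpoly_carrier lA rB by auto
      have "span_on I (S \<times> (UNIV :: bool set)) f (\<lambda>i. PB v {#y i#})"
        by (rule span_on_member[OF sc.fin(1) sc.f, where s="(v, False)"])
          (use \<open>v \<in> S\<close> c in \<open>auto simp: f_def cf_def\<close>)
      then have 1: "sc.low (\<lambda>i j. ?PA {#x j#} \<otimes> PB v {#y i#})"
        by (rule sc.low_outer_left) (rule coeff_closed[OF c(1)])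
      have "span_on I (S \<times> (UNIV :: bool set)) f (\<lambda>i. ?PA {#y i#})" using lA by (simp add: sc.left_poly_def)
      then have 2: "sc.low (\<lambda>i j. ?PA {#y i#} \<otimes> PB v {#x j#})"
        using low_rank_cong[OF _ sc.low_outer_left[of "\<lambda>i. ?PA {#y i#}" "\<lambda>j. PB v {#x j#}"]]
          coeff_closed[OF c(1)] coeff_closed[OF c(2)] by (simp add: m_comm)
      show ?thesis unfolding q
        by (rule sc.low_poly_times[OF _ _ 2 1]) (use lA rB in \<open>auto simp: sc.left_poly_def sc.right_poly_def\<close>)
    qed
    have "v \<in> A \<union> S \<union> B" using cover times(1) by auto
    then have "sc.low_poly ?q" using left right low by (auto simp: sc.left_poly_def sc.right_poly_def)
    moreover have "sc.left_poly ?q" "sc.right_poly ?q" if "v \<in> S"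
      using low[OF that] memberL[OF that comp] memberR[OF that comp] by (auto simp: sc.left_poly_def sc.right_poly_def)
    ultimately show ?case using left right by auto
  qed
  from this[OF out] have "sc.low (\<lambda>i j. p0 {#y i, x j#})" by (simp add: sc.low_poly_def)
  with sc.f sc.h show thesis by (rule that)
qed

end

section \<open>The size bound\<close>

text \<open>The factor 3 counts generators: two \<open>y\<close>-vectors and one
  \<open>x\<close>-vector per separator gate. The rule is applied below with exchanged sides and
  also with an empty separator.\<close>

lemma (in arithmetic_circuit) separator_bound:
  assumes M: "M \<in> {..<n} \<rightarrow> {..<n} \<rightarrow> carrier R" "totally_regular n M"
    and inj: "inj_on x {..<n}" "inj_on y {..<n}" "x ` {..<n} \<inter> y ` {..<n} = {}"
    and out: "circuit_computes C (bilinear_form n y M x)"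
    and IJ: "I \<subseteq> {..<n}" "J \<subseteq> {..<n}" "card I = card J"
    and S: "finite S" "verts (graph C) \<subseteq> A \<union> S \<union> B"
    and sepA: "\<And>e. e \<in> arcs (graph C) \<Longrightarrow> head (graph C) e \<in> A \<Longrightarrow> tail (graph C) e \<in> A \<union> S"
    and sepB: "\<And>e. e \<in> arcs (graph C) \<Longrightarrow> head (graph C) e \<in> B \<Longrightarrow> tail (graph C) e \<in> B \<union> S"
    and yA: "\<And>v i. v \<in> A \<Longrightarrow> i \<in> I \<Longrightarrow> label C v \<noteq> Var (y i)"
    and xB: "\<And>v j. v \<in> B \<Longrightarrow> j \<in> J \<Longrightarrow> label C v \<noteq> Var (x j)"
  shows "card I \<le> 3 * card S"
proof -
  let ?p = "bilinear_form n y M x"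
  obtain v0 where v0: "gate_computes C v0 ?p" using out by (auto simp: circuit_computes_def)
  have fin: "finite I" "finite J" using IJ finite_subset by auto
  have xy: "y i \<noteq> x j" if "i \<in> I" "j \<in> J" for i j using inj(3) IJ that by blast
  show ?thesis
  proof (rule separator_rank[OF S])
    show "tail (graph C) e \<in> A \<union> S" if "e \<in> arcs (graph C)" "head (graph C) e \<in> A" for e
      by (rule sepA[OF that])
    show "tail (graph C) e \<in> B \<union> S" if "e \<in> arcs (graph C)" "head (graph C) e \<in> B" for e
      by (rule sepB[OF that])
    show "label C v \<noteq> Var (y i)" if "v \<in> A" "i \<in> I" for v i by (rule yA[OF that])
    show "label C v \<noteq> Var (x j)" if "v \<in> B" "j \<in> J" for v j by (rule xB[OF that])
    show "y i \<noteq> x j" if "i \<in> I" "j \<in> J" for i j by (rule xy[OF that])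
    show "gate_computes C v0 ?p" by (rule v0)
  next
    fix f h
    assume f: "\<And>t i. t \<in> S \<times> (UNIV :: bool set) \<Longrightarrow> i \<in> I \<Longrightarrow> f t i \<in> carrier R"
      and h: "\<And>s j. s \<in> S \<Longrightarrow> j \<in> J \<Longrightarrow> h s j \<in> carrier R"
      and low: "low_rank I J (S \<times> (UNIV :: bool set)) f S h (\<lambda>i j. ?p {#y i, x j#})"
    have low_M: "low_rank I J (S \<times> (UNIV :: bool set)) f S h M"
      by (rule low_rank_cong[OF _ low], rule coeff_bilinear_form[OF M(1) inj, symmetric]) (use IJ in auto)
    have "nonsingular_submatrix M I J" using M(2) IJ by (simp add: totally_regular_def)
    from low_rank_nonsingular[OF fin _ S(1) f h low_M this] show ?thesis
      using S(1) by (simp add: card_cartesian_product)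
  qed
qed

text \<open>Total regularity speaks of square submatrices only; if both sets exceeded
  \<open>k\<close>, subsets of size \<open>Suc k\<close> would break the bound.\<close>

lemma card_subset_bound:
  assumes bound: "\<And>I J. I \<subseteq> I0 \<Longrightarrow> J \<subseteq> J0 \<Longrightarrow> card I = card J \<Longrightarrow> card I \<le> k"
  shows "card I0 \<le> k \<or> card J0 \<le> k"
proof (rule ccontr)
  assume "\<not> ?thesis"
  then obtain I J where "I \<subseteq> I0" "card I = Suc k" "J \<subseteq> J0" "card J = Suc k"
    using obtain_subset_with_card_n[of "Suc k"] by (metis not_less_eq_eq)
  then show False using bound[of I J] by simp
qed

text \<open>If every component had at most half of the \<open>x\<close>-gates, some union of
  components would hold between a quarter and three quarters of them, and a split so balanced
  contradicts the rank bound.\<close>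

lemma (in arithmetic_circuit) haven:
  assumes M: "M \<in> {..<n} \<rightarrow> {..<n} \<rightarrow> carrier R" "totally_regular n M"
    and inj: "inj_on x {..<n}" "inj_on y {..<n}" "x ` {..<n} \<inter> y ` {..<n} = {}"
    and out: "circuit_computes C (bilinear_form n y M x)"
    and once: "read_once C"
  obtains gx :: "nat \<Rightarrow> 'g" where "\<And>U. U \<subseteq> verts (graph C) \<Longrightarrow> 16 * card U < n \<Longrightarrow>
    \<exists>K. rel_component (adjacency (graph C)) (verts (graph C) - U) K \<and> n < 2 * card {j. j < n \<and> gx j \<in> K}"
proof -
  let ?V = "verts (graph C)"
  let ?E = "adjacency (graph C)"
  note bound = separator_bound[OF M inj out]
  have finV: "finite ?V" using fin_digraph.finite_verts[OF fin_digraph] .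
  have wf: "tail (graph C) e \<in> ?V" "head (graph C) e \<in> ?V" if "e \<in> arcs (graph C)" for e
    using fin_digraph that by (auto simp: fin_digraph_def wf_digraph_def)
  \<comment> \<open>An unread variable would make the empty set a separator for a 1 by 1 submatrix,
    with all gates on one side; the bound would then say \<open>1 \<le> 0\<close>.\<close>
  have "\<exists>v\<in>?V. label C v = Var (x j)" if "j < n" for j
    using bound[of "{j}" "{j}" "{}" "{}" ?V] that wf by auto
  then obtain gx where gx: "\<And>j. j < n \<Longrightarrow> gx j \<in> ?V" "\<And>j. j < n \<Longrightarrow> label C (gx j) = Var (x j)"
    by metis
  have "\<exists>v\<in>?V. label C v = Var (y i)" if "i < n" for i
    using bound[of "{i}" "{i}" "{}" ?V "{}"] that wf by auto
  then obtain gy where gy: "\<And>i. i < n \<Longrightarrow> gy i \<in> ?V" "\<And>i. i < n \<Longrightarrow> label C (gy i) = Var (y i)"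
    by metis
  \<comment> \<open>Read-once enters here: only because a single gate carries an input does the
    input lie on one definite side.\<close>
  have X_eq: "v = gx j" if "v \<in> ?V" "j < n" "label C v = Var (x j)" for v j
    using once gx[OF that(2)] that unfolding read_once_def by blast
  have Y_eq: "v = gy j" if "v \<in> ?V" "j < n" "label C v = Var (y j)" for v j
    using once gy[OF that(2)] that unfolding read_once_def by blast
  have inj_gates: "inj_on g {..<n}"
    if g: "\<And>j. j < n \<Longrightarrow> label C (g j) = Var (z j)" and z: "inj_on z {..<n}" for g :: "nat \<Rightarrow> 'g" and z
  proof (rule inj_onI)
    fix i j assume ij: "i \<in> {..<n}" "j \<in> {..<n}" "g i = g j"
    then have "z i = z j" using g[of i] g[of j] by simp
    then show "i = j" using z ij by (auto dest: inj_onD)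
  qed
  note injX = inj_gates[OF gx(2) inj(1)] and injY = inj_gates[OF gy(2) inj(2)]
  define cx where "cx A = card {j. j < n \<and> gx j \<in> A}" for A
  define cy where "cy A = card {i. i < n \<and> gy i \<in> A}" for A
  have count: "card {j. j < n \<and> Z j \<in> A} + card {j. j < n \<and> Z j \<in> ?V - U - A} + card U \<ge> n"
    if "U \<subseteq> ?V" "A \<subseteq> ?V - U" "inj_on Z {..<n}" "\<And>j. j < n \<Longrightarrow> Z j \<in> ?V" for U A and Z :: "nat \<Rightarrow> 'g"
  proof -
    have "card {j. j < n \<and> Z j \<in> U} \<le> card U"
      by (rule card_inj_on_le[of Z]) (use that finV in \<open>auto simp: inj_on_def intro: finite_subset\<close>)
    moreover have "{..<n} = {j. j < n \<and> Z j \<in> A} \<union> {j. j < n \<and> Z j \<in> ?V - U - A} \<union> {j. j < n \<and> Z j \<in> U}"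
      using that by auto
    then have "card {..<n} \<le> card {j. j < n \<and> Z j \<in> A} + card {j. j < n \<and> Z j \<in> ?V - U - A} + card {j. j < n \<and> Z j \<in> U}"
      using order_trans[OF card_Un_le add_right_mono[OF card_Un_le]] by simp
    ultimately show ?thesis by simp
  qed
  have "\<exists>K. rel_component ?E (?V - U) K \<and> n < 2 * cx K" if U: "U \<subseteq> ?V" "16 * card U < n" for U
  proof (rule ccontr)
    assume "\<not> ?thesis"
    then have small: "2 * cx K \<le> n" if "rel_component ?E (?V - U) K" for K
      using that by (meson not_le_imp_less)
    define closed where "closed A \<longleftrightarrow> A \<subseteq> ?V - U \<and> (\<forall>u\<in>A. \<forall>v\<in>?V - U. (u, v) \<in> ?E \<longrightarrow> v \<in> A)" for A
    \<comment> \<open>Adding a component, which has at most half of the \<open>x\<close>-gates, to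
      an \<open>A\<close> with less than a quarter stays below three quarters. A maximal light
      \<open>A\<close> therefore holds at least a quarter.\<close>
    define light where "light = {A. closed A \<and> 4 * cx A \<le> 3 * n}"
    have "{} \<in> light" by (simp add: light_def closed_def cx_def)
    moreover have "finite light"
      by (rule finite_subset[of _ "Pow ?V"]) (use finV in \<open>auto simp: light_def closed_def\<close>)
    ultimately obtain A where "A \<in> light" and max: "\<forall>A'\<in>light. A \<subseteq> A' \<longrightarrow> A = A'"
      using finite_has_maximal[of light] by blast
    then have A: "closed A" "4 * cx A \<le> 3 * n" by (auto simp: light_def)
    have AV: "A \<subseteq> ?V - U" using A by (simp add: closed_def)
    have countX: "cx A + cx (?V - U - A) + card U \<ge> n"
      unfolding cx_def by (rule count[OF U(1) AV injX gx(1)])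
    have countY: "cy A + cy (?V - U - A) + card U \<ge> n"
      unfolding cy_def by (rule count[OF U(1) AV injY gy(1)])
    \<comment> \<open>Both sides contain at least about \<open>n / 4\<close> of the \<open>x\<close>-gates, and one of them half of the
      \<open>y\<close>-gates; that side paired with the other one violates the rank bound.\<close>
    have big: "n \<le> 4 * cx A"
    proof (rule ccontr)
      assume "\<not> ?thesis"
      then have "cx (?V - U - A) \<noteq> 0" using countX U(2) by linarith
      then obtain v where v: "v \<in> ?V - U - A"
        by (auto simp: cx_def card_gt_0_iff)
      obtain K where K: "rel_component ?E (?V - U) K" "v \<in> K"
        using rel_component_exists[OF sym_adjacency, of v "?V - U"] v by auto
      have "cx (A \<union> K) \<le> cx A + cx K"
      proof -
        have "{j. j < n \<and> gx j \<in> A \<union> K} = {j. j < n \<and> gx j \<in> A} \<union> {j. j < n \<and> gx j \<in> K}" by auto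
        then show ?thesis unfolding cx_def by (metis card_Un_le)
      qed
      then have "4 * cx (A \<union> K) \<le> 3 * n" using small[OF K(1)] \<open>\<not> n \<le> 4 * cx A\<close> by linarith
      moreover have "closed (A \<union> K)" using A K(1) by (auto simp: closed_def rel_component_def)
      ultimately have "A = A \<union> K" using max by (auto simp: light_def)
      then show False using K(2) v by auto
    qed
    define B where "B = ?V - U - A"
    have cover: "?V \<subseteq> A \<union> U \<union> B" "?V \<subseteq> B \<union> U \<union> A" by (auto simp: B_def)
    have finU: "finite U" using U finV by (auto intro: finite_subset)
    have sepA: "tail (graph C) e \<in> A \<union> U" if "e \<in> arcs (graph C)" "head (graph C) e \<in> A" for e
    proof -
      have "(head (graph C) e, tail (graph C) e) \<in> ?E" using that(1) by (auto simp: adjacency_iff)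
      then show ?thesis using A that wf(1)[OF that(1)] by (auto simp: closed_def)
    qed
    have sepB: "tail (graph C) e \<in> B \<union> U" if "e \<in> arcs (graph C)" "head (graph C) e \<in> B" for e
    proof -
      have "(tail (graph C) e, head (graph C) e) \<in> ?E" using that(1) by (auto simp: adjacency_iff)
      then show ?thesis using A that wf(1)[OF that(1)] by (auto simp: closed_def B_def)
    qed
    have AB: "A \<inter> B = {}" "A \<subseteq> ?V" "B \<subseteq> ?V" using AV by (auto simp: B_def)
    have "card {i. i < n \<and> gy i \<in> B} \<le> 3 * card U \<or> card {j. j < n \<and> gx j \<in> A} \<le> 3 * card U"
    proof (rule card_subset_bound)
      fix I J assume IJ: "I \<subseteq> {i. i < n \<and> gy i \<in> B}" "J \<subseteq> {j. j < n \<and> gx j \<in> A}" "card I = card J"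
      show "card I \<le> 3 * card U"
        by (rule bound[OF _ _ IJ(3) finU cover(1) sepA sepB]) (use IJ AB X_eq Y_eq in blast)+
    qed
    moreover have "card {i. i < n \<and> gy i \<in> A} \<le> 3 * card U \<or> card {j. j < n \<and> gx j \<in> B} \<le> 3 * card U"
    proof (rule card_subset_bound)
      fix I J assume IJ: "I \<subseteq> {i. i < n \<and> gy i \<in> A}" "J \<subseteq> {j. j < n \<and> gx j \<in> B}" "card I = card J"
      show "card I \<le> 3 * card U"
        by (rule bound[OF _ _ IJ(3) finU cover(2) sepB sepA]) (use IJ AB X_eq Y_eq in blast)+
    qed
    \<comment> \<open>The constant 16 is used here: \<open>cx A \<ge> n / 4\<close> and
      \<open>cx B \<ge> n / 4 - card U\<close> both exceed \<open>3 * card U\<close>. Hence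
      \<open>cy A\<close> and \<open>cy B\<close> do not, and \<open>n \<le> 7 * card U\<close> is
      absurd.\<close>
    ultimately have "cy B \<le> 3 * card U \<or> cx A \<le> 3 * card U" "cy A \<le> 3 * card U \<or> cx B \<le> 3 * card U"
      by (auto simp: cx_def cy_def)
    then show False
      using countX countY big A U(2) unfolding B_def[symmetric] by linarith
  qed
  then show ?thesis using that[of gx] by (simp add: cx_def)
qed

text \<open>A clique minor with 6 branch sets needs a haven for sets of size \<open>6 * q\<close>,
  and \<open>96 = 16 * 6\<close>. Big components touch because two sets with more than half of the
  \<open>x\<close>-gates each share one.\<close>

lemma (in arithmetic_circuit) size_bound:
  assumes M: "M \<in> {..<n} \<rightarrow> {..<n} \<rightarrow> carrier R" "totally_regular n M"
    and inj: "inj_on x {..<n}" "inj_on y {..<n}" "x ` {..<n} \<inter> y ` {..<n} = {}"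
    and out: "circuit_computes C (bilinear_form n y M x)"
    and once: "read_once C" and planar: "planar (graph C)"
    and q: "0 < q" "96 * q < n"
  shows "q * q < 6 * circuit_size C"
proof (rule ccontr)
  assume "\<not> ?thesis"
  then have small: "6 * card (verts (graph C)) \<le> q * q" by (simp add: circuit_size_def)
  obtain pos crv where drawing: "planar_drawing (graph C) pos crv" using planar by (auto simp: planar_def)
  have finV: "finite (verts (graph C))" using fin_digraph.finite_verts[OF fin_digraph] .
  obtain gx where gx: "\<And>U. U \<subseteq> verts (graph C) \<Longrightarrow> 16 * card U < n \<Longrightarrow>
      \<exists>K. rel_component (adjacency (graph C)) (verts (graph C) - U) K \<and> n < 2 * card {j. j < n \<and> gx j \<in> K}"
    using haven[OF M inj out once] by blast
  obtain CC where "clique_model (adjacency (graph C)) CC" "\<Union> CC \<subseteq> verts (graph C)" "card CC = 6"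
  proof (rule clique_model_of_haven[OF sym_adjacency finV q(1) small, where big="\<lambda>K. n < 2 * card {j. j < n \<and> gx j \<in> K}"])
    fix U assume "U \<subseteq> verts (graph C)" "card U \<le> 6 * q"
    then show "\<exists>K. rel_component (adjacency (graph C)) (verts (graph C) - U) K \<and> n < 2 * card {j. j < n \<and> gx j \<in> K}"
      using gx[of U] q(2) by simp
  next
    fix K K' assume KK': "n < 2 * card {j. j < n \<and> gx j \<in> K}" "n < 2 * card {j. j < n \<and> gx j \<in> K'}"
    show "K \<inter> K' \<noteq> {}"
    proof
      assume "K \<inter> K' = {}"
      then have "card {j. j < n \<and> gx j \<in> K} + card {j. j < n \<and> gx j \<in> K'} =
          card ({j. j < n \<and> gx j \<in> K} \<union> {j. j < n \<and> gx j \<in> K'})"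
        by (intro card_Un_disjoint[symmetric]) auto
      also have "\<dots> \<le> card {..<n}" by (rule card_mono) auto
      finally show False using KK' by simp
    qed
  qed
  then show False by (rule no_K6_model[OF drawing fin_digraph])
qed

theorem theorem1p3:
  shows "\<exists>c>0. \<forall>\<^sub>F n in sequentially.
    \<forall>(F :: 'a ring) (M :: nat \<Rightarrow> nat \<Rightarrow> 'a) (x :: nat \<Rightarrow> 'x) (y :: nat \<Rightarrow> 'x)
      (C :: ('g, 'w, 'x, 'a) circuit).
      field F \<longrightarrow>
      M \<in> {..<n} \<rightarrow> {..<n} \<rightarrow> carrier F \<longrightarrow>
      ring.totally_regular F n M \<longrightarrow>
      inj_on x {..<n} \<longrightarrow> inj_on y {..<n} \<longrightarrow> x ` {..<n} \<inter> y ` {..<n} = {} \<longrightarrow>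
      arithmetic_circuit F C \<longrightarrow>
      planar (graph C) \<longrightarrow>
      read_once C \<longrightarrow>
      ring.circuit_computes F C (ring.bilinear_form F n y M x) \<longrightarrow>
      real (circuit_size C) \<ge> c * real n ^ 2"
\<comment> \<open>\<open>240000 = 6 * 200 * 200\<close>, from
  \<open>q * q < 6 * circuit_size C\<close> and \<open>n \<le> 200 * q\<close>.\<close>
proof (intro exI[of _ "1 / 240000"] conjI)
  show "(0::real) < 1 / 240000" by simp
  show "\<forall>\<^sub>F n in sequentially.
    \<forall>(F :: 'a ring) (M :: nat \<Rightarrow> nat \<Rightarrow> 'a) (x :: nat \<Rightarrow> 'x) (y :: nat \<Rightarrow> 'x)
      (C :: ('g, 'w, 'x, 'a) circuit).
      field F \<longrightarrow>
      M \<in> {..<n} \<rightarrow> {..<n} \<rightarrow> carrier F \<longrightarrow>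
      ring.totally_regular F n M \<longrightarrow>
      inj_on x {..<n} \<longrightarrow> inj_on y {..<n} \<longrightarrow> x ` {..<n} \<inter> y ` {..<n} = {} \<longrightarrow>
      arithmetic_circuit F C \<longrightarrow>
      planar (graph C) \<longrightarrow>
      read_once C \<longrightarrow>
      ring.circuit_computes F C (ring.bilinear_form F n y M x) \<longrightarrow>
      real (circuit_size C) \<ge> 1 / 240000 * real n ^ 2"
    using eventually_ge_at_top[of 200]
  proof (eventually_elim, intro allI impI)
    fix n :: nat and F :: "'a ring" and M x y and C :: "('g, 'w, 'x, 'a) circuit"
    assume n: "200 \<le> n" and M: "M \<in> {..<n} \<rightarrow> {..<n} \<rightarrow> carrier F" "ring.totally_regular F n M"
      and inj: "inj_on x {..<n}" "inj_on y {..<n}" "x ` {..<n} \<inter> y ` {..<n} = {}"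
      and C: "arithmetic_circuit F C" "planar (graph C)" "read_once C"
      and out: "ring.circuit_computes F C (ring.bilinear_form F n y M x)"
    \<comment> \<open>Dividing by 100 leaves some slack over 96; as \<open>q\<close> is positive,
      the remainder is less than \<open>100 * q\<close>, whence
      \<open>n \<le> 200 * q\<close>.\<close>
    define q where "q = n div 100"
    have q: "0 < q" "96 * q < n" "n \<le> 200 * q" using n unfolding q_def by linarith+
    have "q * q < 6 * circuit_size C"
      by (rule arithmetic_circuit.size_bound[OF C(1) M inj out C(3,2) q(1,2)])
    moreover have "n * n \<le> (200 * q) * (200 * q)" using q(3) by (intro mult_le_mono)
    ultimately have "n * n \<le> 240000 * circuit_size C" by linarith
    then have "real (n * n) \<le> real (240000 * circuit_size C)" by (rule of_nat_mono)
    then show "1 / 240000 * real n ^ 2 \<le> real (circuit_size C)" by (simp add: power2_eq_square)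
  qed
qed

end
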